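(* Let $\mathcal{A}$ be an AB3 abelian category and let $\mathcal{U}$ be a set of objects of $\mathcal{A}$. Denote $\mathcal{B}=\operatorname{Pres}(\mathcal{U})$. Then the following are equivalent: (1) $\mathcal{B}$ is a coreflective abelian exact subcategory of $\mathcal{A}$. (2) Each morphism $f:\hat{U}\to\tilde{U}$ in $\operatorname{Sum}(\mathcal{U})$ has its kernel in $\operatorname{Gen}(\mathcal{U})$ and one (resp. all) of the following conditions hold: (a) for each $\tilde{U}\in\operatorname{Sum}(\mathcal{U})$ and each subobject $K$ of $\tilde{U}$, we have $\mathcal{A}\left(U,\frac{K}{\operatorname{tr}_{\mathcal{U}}(K)}\right)=0$ for all $U\in\mathcal{U}$; (b) $\mathcal{A}\left(U,\frac{\operatorname{Ker}\varepsilon_A}{\operatorname{tr}_{\mathcal{U}}(\operatorname{Ker}\varepsilon_A)}\right)=0$ for all $A\in\mathcal{A}$ and all $U\in\mathcal{U}$; (c) for each $B\in\mathcal{B}$, the canonical morphism $\varepsilon_B:\hat{U}_B\to B$ has its kernel in $\operatorname{Gen}(\mathcal{U})$. (That is: (1), each of the three versions of (2) requiring just one of (a), (b), (c), and the version of (2) requiring all of them, are all equivalent.)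
   Context: AB3 means cocomplete. Subcategories are full and closed under isomorphisms; $\mathcal{B}$ is coreflective if its inclusion has a right adjoint. A subcategory of $\mathcal{A}$ is abelian exact if it is abelian and its inclusion functor is exact; equivalently, it is closed under finite coproducts, kernels and cokernels in $\mathcal{A}$. $\operatorname{Sum}(\mathcal{U})$ is the full subcategory of all (set-indexed) coproducts of objects from $\mathcal{U}$; $\operatorname{Gen}(\mathcal{U})$ consists of the epimorphic images of objects of $\operatorname{Sum}(\mathcal{U})$ ($\mathcal{U}$-generated objects); $\operatorname{Pres}(\mathcal{U})$ consists of the objects isomorphic to cokernels of morphisms in $\operatorname{Sum}(\mathcal{U})$. For $A\in\mathcal{A}$, $\hat{U}_A=\coprod_{U\in\mathcal{U}}U^{(\mathcal{A}(U,A))}$ and $\varepsilon_A:\hat{U}_A\to A$ is the canonical morphism whose component at $\alpha\in\mathcal{A}(U,A)$ is $\alpha$. The trace $\operatorname{tr}_{\mathcal{U}}(A)$ is the largest $\mathcal{U}$-generated subobject of $A$. *)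

theory Defs
  imports Main "HOL-Algebra.Group"
begin

section \<open>Categories and functors\<close>

record ('o, 'm) precategory =
  Ob :: "'o set"
  Ar :: "'m set"
  Dom :: "'m \<Rightarrow> 'o"
  Cod :: "'m \<Rightarrow> 'o"
  Ident :: "'o \<Rightarrow> 'm"
  Comp :: "'m \<Rightarrow> 'm \<Rightarrow> 'm"  (infixl \<open>\<cdot>\<index>\<close> 70)

definition Hom :: "('o, 'm, 'z) precategory_scheme \<Rightarrow> 'o \<Rightarrow> 'o \<Rightarrow> 'm set" where
  "Hom C a b = {f \<in> Ar C. Dom C f = a \<and> Cod C f = b}"

locale category =
  fixes C :: "('o, 'm, 'z) precategory_scheme" (structure)
  assumes Dom_closed: "f \<in> Ar C \<Longrightarrow> Dom C f \<in> Ob C"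
    and Cod_closed: "f \<in> Ar C \<Longrightarrow> Cod C f \<in> Ob C"
    and Ident_closed: "a \<in> Ob C \<Longrightarrow> Ident C a \<in> Hom C a a"
    and Comp_closed: "\<lbrakk>f \<in> Hom C a b; g \<in> Hom C b c\<rbrakk> \<Longrightarrow> g \<cdot> f \<in> Hom C a c"
    and Comp_assoc:
      "\<lbrakk>f \<in> Hom C a b; g \<in> Hom C b c; h \<in> Hom C c d\<rbrakk> \<Longrightarrow> (h \<cdot> g) \<cdot> f = h \<cdot> (g \<cdot> f)"
    and Comp_Ident_left: "f \<in> Hom C a b \<Longrightarrow> Ident C b \<cdot> f = f"
    and Comp_Ident_right: "f \<in> Hom C a b \<Longrightarrow> f \<cdot> Ident C a = f"

definition is_mono :: "('o, 'm, 'z) precategory_scheme \<Rightarrow> 'm \<Rightarrow> bool" where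
  "is_mono C f \<longleftrightarrow> f \<in> Ar C \<and>
     (\<forall>a \<in> Ob C. \<forall>g \<in> Hom C a (Dom C f). \<forall>h \<in> Hom C a (Dom C f).
        f \<cdot>\<^bsub>C\<^esub> g = f \<cdot>\<^bsub>C\<^esub> h \<longrightarrow> g = h)"

definition is_epi :: "('o, 'm, 'z) precategory_scheme \<Rightarrow> 'm \<Rightarrow> bool" where
  "is_epi C f \<longleftrightarrow> f \<in> Ar C \<and>
     (\<forall>b \<in> Ob C. \<forall>g \<in> Hom C (Cod C f) b. \<forall>h \<in> Hom C (Cod C f) b.
        g \<cdot>\<^bsub>C\<^esub> f = h \<cdot>\<^bsub>C\<^esub> f \<longrightarrow> g = h)"

definition isomorphic_objects :: "('o, 'm, 'z) precategory_scheme \<Rightarrow> 'o \<Rightarrow> 'o \<Rightarrow> bool" where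
  "isomorphic_objects C a b \<longleftrightarrow> a \<in> Ob C \<and> b \<in> Ob C \<and>
     (\<exists>f \<in> Hom C a b. \<exists>g \<in> Hom C b a. g \<cdot>\<^bsub>C\<^esub> f = Ident C a \<and> f \<cdot>\<^bsub>C\<^esub> g = Ident C b)"

definition full_subcategory ::
    "('o, 'm, 'z) precategory_scheme \<Rightarrow> 'o set \<Rightarrow> ('o, 'm, 'z) precategory_scheme" where
  "full_subcategory C B = C\<lparr>Ob := B, Ar := {f \<in> Ar C. Dom C f \<in> B \<and> Cod C f \<in> B}\<rparr>"

text \<open>A functor is given by its object map and its arrow map.\<close>

definition is_functor ::
    "('o, 'm, 'z) precategory_scheme \<Rightarrow> ('p, 'n, 'y) precategory_scheme
      \<Rightarrow> ('o \<Rightarrow> 'p) \<Rightarrow> ('m \<Rightarrow> 'n) \<Rightarrow> bool" where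
  "is_functor C D Fo Fm \<longleftrightarrow>
     (\<forall>a \<in> Ob C. Fo a \<in> Ob D) \<and>
     (\<forall>a \<in> Ob C. \<forall>b \<in> Ob C. \<forall>f \<in> Hom C a b. Fm f \<in> Hom D (Fo a) (Fo b)) \<and>
     (\<forall>a \<in> Ob C. Fm (Ident C a) = Ident D (Fo a)) \<and>
     (\<forall>a \<in> Ob C. \<forall>b \<in> Ob C. \<forall>c \<in> Ob C. \<forall>f \<in> Hom C a b. \<forall>g \<in> Hom C b c.
        Fm (g \<cdot>\<^bsub>C\<^esub> f) = Fm g \<cdot>\<^bsub>D\<^esub> Fm f)"

text \<open>\<open>F : C \<rightarrow> D\<close> is left adjoint to \<open>G : D \<rightarrow> C\<close> via the natural bijections
  \<open>\<phi> c d : Hom D (F c) d \<rightarrow> Hom C c (G d)\<close>.\<close>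

definition adjunction ::
    "('o, 'm, 'z) precategory_scheme \<Rightarrow> ('p, 'n, 'y) precategory_scheme
      \<Rightarrow> ('o \<Rightarrow> 'p) \<Rightarrow> ('m \<Rightarrow> 'n) \<Rightarrow> ('p \<Rightarrow> 'o) \<Rightarrow> ('n \<Rightarrow> 'm)
      \<Rightarrow> ('o \<Rightarrow> 'p \<Rightarrow> 'n \<Rightarrow> 'm) \<Rightarrow> bool" where
  "adjunction C D Fo Fm Go Gm \<phi> \<longleftrightarrow>
     is_functor C D Fo Fm \<and> is_functor D C Go Gm \<and>
     (\<forall>c \<in> Ob C. \<forall>d \<in> Ob D. bij_betw (\<phi> c d) (Hom D (Fo c) d) (Hom C c (Go d))) \<and>
     (\<forall>c \<in> Ob C. \<forall>c' \<in> Ob C. \<forall>d \<in> Ob D. \<forall>d' \<in> Ob D.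
        \<forall>h \<in> Hom C c' c. \<forall>f \<in> Hom D (Fo c) d. \<forall>k \<in> Hom D d d'.
          \<phi> c' d' (k \<cdot>\<^bsub>D\<^esub> f \<cdot>\<^bsub>D\<^esub> Fm h) = Gm k \<cdot>\<^bsub>C\<^esub> \<phi> c d f \<cdot>\<^bsub>C\<^esub> h)"


section \<open>Smallness, colimits and coproducts\<close>

text \<open>The set/class distinction is expressed by an infinite regular cardinal \<open>\<kappa>\<close>: the small
  sets are those of cardinality less than \<open>\<kappa>\<close>. For a strongly inaccessible \<open>\<kappa>\<close> these are,
  up to bijection, the elements of a Grothendieck universe; only infinity and regularity
  (small unions of small sets are small) are required.\<close>

definition regular_cardinal :: "'i rel \<Rightarrow> bool" where
  "regular_cardinal \<kappa> \<longleftrightarrow> Card_order \<kappa> \<and> infinite (Field \<kappa>) \<and> regularCard \<kappa>"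

definition small :: "'i rel \<Rightarrow> 'x set \<Rightarrow> bool" where
  "small \<kappa> S \<longleftrightarrow> (card_of S, \<kappa>) \<in> ordLess"

definition is_cocone ::
    "('p, 'n, 'y) precategory_scheme \<Rightarrow> ('o, 'm, 'z) precategory_scheme
      \<Rightarrow> ('p \<Rightarrow> 'o) \<Rightarrow> ('n \<Rightarrow> 'm) \<Rightarrow> 'o \<Rightarrow> ('p \<Rightarrow> 'm) \<Rightarrow> bool" where
  "is_cocone J C Fo Fm c \<iota> \<longleftrightarrow> c \<in> Ob C \<and>
     (\<forall>j \<in> Ob J. \<iota> j \<in> Hom C (Fo j) c) \<and>
     (\<forall>u \<in> Ar J. \<iota> (Cod J u) \<cdot>\<^bsub>C\<^esub> Fm u = \<iota> (Dom J u))"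

definition is_colimit ::
    "('p, 'n, 'y) precategory_scheme \<Rightarrow> ('o, 'm, 'z) precategory_scheme
      \<Rightarrow> ('p \<Rightarrow> 'o) \<Rightarrow> ('n \<Rightarrow> 'm) \<Rightarrow> 'o \<Rightarrow> ('p \<Rightarrow> 'm) \<Rightarrow> bool" where
  "is_colimit J C Fo Fm c \<iota> \<longleftrightarrow> is_cocone J C Fo Fm c \<iota> \<and>
     (\<forall>d \<gamma>. is_cocone J C Fo Fm d \<gamma> \<longrightarrow>
        (\<exists>!h. h \<in> Hom C c d \<and> (\<forall>j \<in> Ob J. h \<cdot>\<^bsub>C\<^esub> \<iota> j = \<gamma> j)))"

text \<open>Every small category is isomorphic to one whose objects and arrows are taken from the
  field type of \<open>\<kappa>\<close>, so it suffices to quantify over the latter.\<close>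

definition cocomplete :: "'i rel \<Rightarrow> ('o, 'm, 'z) precategory_scheme \<Rightarrow> bool" where
  "cocomplete \<kappa> C \<longleftrightarrow>
     (\<forall>(J :: ('i, 'i) precategory) Fo Fm.
        category J \<and> small \<kappa> (Ob J) \<and> small \<kappa> (Ar J) \<and> is_functor J C Fo Fm \<longrightarrow>
        (\<exists>c \<iota>. is_colimit J C Fo Fm c \<iota>))"

definition is_coproduct ::
    "('o, 'm, 'z) precategory_scheme \<Rightarrow> 'j set \<Rightarrow> ('j \<Rightarrow> 'o) \<Rightarrow> 'o \<Rightarrow> ('j \<Rightarrow> 'm) \<Rightarrow> bool" where
  "is_coproduct C I X c \<iota> \<longleftrightarrow> c \<in> Ob C \<and>
     (\<forall>i \<in> I. \<iota> i \<in> Hom C (X i) c) \<and>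
     (\<forall>d \<in> Ob C. \<forall>g. (\<forall>i \<in> I. g i \<in> Hom C (X i) d) \<longrightarrow>
        (\<exists>!h. h \<in> Hom C c d \<and> (\<forall>i \<in> I. h \<cdot>\<^bsub>C\<^esub> \<iota> i = g i)))"


section \<open>Abelian categories\<close>

record ('o, 'm) preadditive_data = "('o, 'm) precategory" +
  Add :: "'m \<Rightarrow> 'm \<Rightarrow> 'm"  (infixl \<open>\<oplus>\<^sub>A\<index>\<close> 65)
  Zero :: "'o \<Rightarrow> 'o \<Rightarrow> 'm"

definition Hom_group ::
    "('o, 'm, 'z) preadditive_data_scheme \<Rightarrow> 'o \<Rightarrow> 'o \<Rightarrow> 'm monoid" where
  "Hom_group C a b = \<lparr>carrier = Hom C a b, mult = Add C, one = Zero C a b\<rparr>"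

locale preadditive_category = category C
  for C :: "('o, 'm, 'z) preadditive_data_scheme" (structure) +
  assumes Hom_comm_group: "\<lbrakk>a \<in> Ob C; b \<in> Ob C\<rbrakk> \<Longrightarrow> comm_group (Hom_group C a b)"
    and Comp_Add_left: "\<lbrakk>f \<in> Hom C a b; g \<in> Hom C b c; h \<in> Hom C b c\<rbrakk>
      \<Longrightarrow> (g \<oplus>\<^sub>A h) \<cdot> f = (g \<cdot> f) \<oplus>\<^sub>A (h \<cdot> f)"
    and Comp_Add_right: "\<lbrakk>f \<in> Hom C a b; g \<in> Hom C a b; h \<in> Hom C b c\<rbrakk>
      \<Longrightarrow> h \<cdot> (f \<oplus>\<^sub>A g) = (h \<cdot> f) \<oplus>\<^sub>A (h \<cdot> g)"

definition is_zero_object :: "('o, 'm, 'z) precategory_scheme \<Rightarrow> 'o \<Rightarrow> bool" where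
  "is_zero_object C z \<longleftrightarrow> z \<in> Ob C \<and>
     (\<forall>a \<in> Ob C. (\<exists>!f. f \<in> Hom C a z) \<and> (\<exists>!f. f \<in> Hom C z a))"

definition is_biproduct ::
    "('o, 'm, 'z) preadditive_data_scheme \<Rightarrow> 'o \<Rightarrow> 'o \<Rightarrow> 'o
      \<Rightarrow> 'm \<Rightarrow> 'm \<Rightarrow> 'm \<Rightarrow> 'm \<Rightarrow> bool" where
  "is_biproduct C a b c i\<^sub>1 i\<^sub>2 p\<^sub>1 p\<^sub>2 \<longleftrightarrow> c \<in> Ob C \<and>
     i\<^sub>1 \<in> Hom C a c \<and> i\<^sub>2 \<in> Hom C b c \<and> p\<^sub>1 \<in> Hom C c a \<and> p\<^sub>2 \<in> Hom C c b \<and>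
     p\<^sub>1 \<cdot>\<^bsub>C\<^esub> i\<^sub>1 = Ident C a \<and> p\<^sub>2 \<cdot>\<^bsub>C\<^esub> i\<^sub>2 = Ident C b \<and>
     (i\<^sub>1 \<cdot>\<^bsub>C\<^esub> p\<^sub>1) \<oplus>\<^sub>A\<^bsub>C\<^esub> (i\<^sub>2 \<cdot>\<^bsub>C\<^esub> p\<^sub>2) = Ident C c"

definition is_kernel :: "('o, 'm, 'z) preadditive_data_scheme \<Rightarrow> 'm \<Rightarrow> 'm \<Rightarrow> bool" where
  "is_kernel C f k \<longleftrightarrow> f \<in> Ar C \<and> k \<in> Ar C \<and> Cod C k = Dom C f \<and>
     f \<cdot>\<^bsub>C\<^esub> k = Zero C (Dom C k) (Cod C f) \<and>
     (\<forall>a \<in> Ob C. \<forall>g \<in> Hom C a (Dom C f). f \<cdot>\<^bsub>C\<^esub> g = Zero C a (Cod C f) \<longrightarrow>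
        (\<exists>!h. h \<in> Hom C a (Dom C k) \<and> k \<cdot>\<^bsub>C\<^esub> h = g))"

definition is_cokernel :: "('o, 'm, 'z) preadditive_data_scheme \<Rightarrow> 'm \<Rightarrow> 'm \<Rightarrow> bool" where
  "is_cokernel C f q \<longleftrightarrow> f \<in> Ar C \<and> q \<in> Ar C \<and> Dom C q = Cod C f \<and>
     q \<cdot>\<^bsub>C\<^esub> f = Zero C (Dom C f) (Cod C q) \<and>
     (\<forall>b \<in> Ob C. \<forall>g \<in> Hom C (Cod C f) b. g \<cdot>\<^bsub>C\<^esub> f = Zero C (Dom C f) b \<longrightarrow>
        (\<exists>!h. h \<in> Hom C (Cod C q) b \<and> h \<cdot>\<^bsub>C\<^esub> q = g))"

locale abelian_category = preadditive_category C
  for C :: "('o, 'm, 'z) preadditive_data_scheme" (structure) +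
  assumes ex_zero_object: "\<exists>z. is_zero_object C z"
    and ex_biproduct: "\<lbrakk>a \<in> Ob C; b \<in> Ob C\<rbrakk>
      \<Longrightarrow> \<exists>c i\<^sub>1 i\<^sub>2 p\<^sub>1 p\<^sub>2. is_biproduct C a b c i\<^sub>1 i\<^sub>2 p\<^sub>1 p\<^sub>2"
    and ex_kernel: "f \<in> Ar C \<Longrightarrow> \<exists>k. is_kernel C f k"
    and ex_cokernel: "f \<in> Ar C \<Longrightarrow> \<exists>q. is_cokernel C f q"
    and mono_normal: "is_mono C f \<Longrightarrow> \<exists>g. is_kernel C g f"
    and epi_normal: "is_epi C f \<Longrightarrow> \<exists>g. is_cokernel C g f"

text \<open>\<open>0 \<rightarrow> a \<rightarrow> b \<rightarrow> c \<rightarrow> 0\<close> with maps \<open>f : a \<rightarrow> b\<close> and \<open>g : b \<rightarrow> c\<close>.\<close>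

definition short_exact :: "('o, 'm, 'z) preadditive_data_scheme \<Rightarrow> 'm \<Rightarrow> 'm \<Rightarrow> bool" where
  "short_exact C f g \<longleftrightarrow> is_kernel C g f \<and> is_cokernel C f g"

definition exact_functor ::
    "('o, 'm, 'z) preadditive_data_scheme \<Rightarrow> ('p, 'n, 'y) preadditive_data_scheme
      \<Rightarrow> ('o \<Rightarrow> 'p) \<Rightarrow> ('m \<Rightarrow> 'n) \<Rightarrow> bool" where
  "exact_functor C D Fo Fm \<longleftrightarrow> is_functor C D Fo Fm \<and>
     (\<forall>a \<in> Ob C. \<forall>b \<in> Ob C. \<forall>f \<in> Hom C a b. \<forall>g \<in> Hom C a b.
        Fm (f \<oplus>\<^sub>A\<^bsub>C\<^esub> g) = Fm f \<oplus>\<^sub>A\<^bsub>D\<^esub> Fm g) \<and>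
     (\<forall>f g. short_exact C f g \<longrightarrow> short_exact D (Fm f) (Fm g))"

text \<open>Full subcategories are identified with their sets of objects.\<close>

definition replete :: "('o, 'm, 'z) precategory_scheme \<Rightarrow> 'o set \<Rightarrow> bool" where
  "replete C B \<longleftrightarrow> B \<subseteq> Ob C \<and> (\<forall>a \<in> B. \<forall>b. isomorphic_objects C a b \<longrightarrow> b \<in> B)"

definition coreflective_subcategory :: "('o, 'm, 'z) precategory_scheme \<Rightarrow> 'o set \<Rightarrow> bool" where
  "coreflective_subcategory C B \<longleftrightarrow> replete C B \<and>
     (\<exists>Go Gm \<phi>. adjunction (full_subcategory C B) C (\<lambda>a. a) (\<lambda>f. f) Go Gm \<phi>)"

definition abelian_exact_subcategory ::
    "('o, 'm, 'z) preadditive_data_scheme \<Rightarrow> 'o set \<Rightarrow> bool" where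
  "abelian_exact_subcategory C B \<longleftrightarrow> replete C B \<and>
     abelian_category (full_subcategory C B) \<and>
     exact_functor (full_subcategory C B) C (\<lambda>a. a) (\<lambda>f. f)"


section \<open>Objects generated and presented by a set of objects\<close>

text \<open>As in the definition of cocompleteness, every small index set is represented by a
  subset of the field type of \<open>\<kappa>\<close>.\<close>

definition Sum :: "'i rel \<Rightarrow> ('o, 'm, 'z) precategory_scheme \<Rightarrow> 'o set \<Rightarrow> 'o set" where
  "Sum \<kappa> C \<U> = {c \<in> Ob C. \<exists>(I :: 'i set) X \<iota>.
     small \<kappa> I \<and> (\<forall>i \<in> I. X i \<in> \<U>) \<and> is_coproduct C I X c \<iota>}"

definition Gen :: "'i rel \<Rightarrow> ('o, 'm, 'z) precategory_scheme \<Rightarrow> 'o set \<Rightarrow> 'o set" where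
  "Gen \<kappa> C \<U> = {a \<in> Ob C. \<exists>s \<in> Sum \<kappa> C \<U>. \<exists>p \<in> Hom C s a. is_epi C p}"

definition Pres :: "'i rel \<Rightarrow> ('o, 'm, 'z) preadditive_data_scheme \<Rightarrow> 'o set \<Rightarrow> 'o set" where
  "Pres \<kappa> C \<U> = {a \<in> Ob C. \<exists>s \<in> Sum \<kappa> C \<U>. \<exists>t \<in> Sum \<kappa> C \<U>. \<exists>f \<in> Hom C s t. \<exists>q.
     is_cokernel C f q \<and> isomorphic_objects C (Cod C q) a}"

text \<open>\<open>\<epsilon>\<close> is a canonical morphism to \<open>a\<close> for some choice of the coproduct of the family
  which contains \<open>U\<close> once for each pair \<open>(U, \<alpha>)\<close> with \<open>U \<in> \<U>\<close> and \<open>\<alpha> : U \<rightarrow> a\<close>. Such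
  \<open>\<epsilon>\<close> is determined up to a canonical isomorphism of its domain.\<close>

definition is_canonical_morphism ::
    "('o, 'm, 'z) precategory_scheme \<Rightarrow> 'o set \<Rightarrow> 'o \<Rightarrow> 'm \<Rightarrow> bool" where
  "is_canonical_morphism C \<U> a \<epsilon> \<longleftrightarrow> \<epsilon> \<in> Ar C \<and> Cod C \<epsilon> = a \<and>
     (\<exists>\<iota>. is_coproduct C (SIGMA U:\<U>. Hom C U a) fst (Dom C \<epsilon>) \<iota> \<and>
       (\<forall>U \<in> \<U>. \<forall>\<alpha> \<in> Hom C U a. \<epsilon> \<cdot>\<^bsub>C\<^esub> \<iota> (U, \<alpha>) = \<alpha>))"

text \<open>The monomorphism \<open>t\<close> represents the largest \<open>\<U>\<close>-generated subobject of \<open>a\<close>.\<close>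

definition is_trace ::
    "'i rel \<Rightarrow> ('o, 'm, 'z) precategory_scheme \<Rightarrow> 'o set \<Rightarrow> 'o \<Rightarrow> 'm \<Rightarrow> bool" where
  "is_trace \<kappa> C \<U> a t \<longleftrightarrow> is_mono C t \<and> Cod C t = a \<and> Dom C t \<in> Gen \<kappa> C \<U> \<and>
     (\<forall>s. is_mono C s \<and> Cod C s = a \<and> Dom C s \<in> Gen \<kappa> C \<U> \<longrightarrow>
        (\<exists>h \<in> Hom C (Dom C s) (Dom C t). t \<cdot>\<^bsub>C\<^esub> h = s))"

text \<open>\<open>Hom(U, K / tr(K)) = 0\<close> for all \<open>U \<in> \<U>\<close>. Here and below, kernels, cokernels, traces
  and canonical morphisms are only determined up to isomorphism; the conditions refer to
  all choices of them.\<close>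

definition no_maps_mod_trace ::
    "'i rel \<Rightarrow> ('o, 'm, 'z) preadditive_data_scheme \<Rightarrow> 'o set \<Rightarrow> 'o \<Rightarrow> bool" where
  "no_maps_mod_trace \<kappa> C \<U> K \<longleftrightarrow>
     (\<forall>t q. is_trace \<kappa> C \<U> K t \<and> is_cokernel C t q \<longrightarrow>
        (\<forall>U \<in> \<U>. Hom C U (Cod C q) = {Zero C U (Cod C q)}))"

definition Sum_kernels_generated ::
    "'i rel \<Rightarrow> ('o, 'm, 'z) preadditive_data_scheme \<Rightarrow> 'o set \<Rightarrow> bool" where
  "Sum_kernels_generated \<kappa> C \<U> \<longleftrightarrow>
     (\<forall>s \<in> Sum \<kappa> C \<U>. \<forall>t \<in> Sum \<kappa> C \<U>. \<forall>f \<in> Hom C s t. \<forall>k.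
        is_kernel C f k \<longrightarrow> Dom C k \<in> Gen \<kappa> C \<U>)"

definition condition_a ::
    "'i rel \<Rightarrow> ('o, 'm, 'z) preadditive_data_scheme \<Rightarrow> 'o set \<Rightarrow> bool" where
  "condition_a \<kappa> C \<U> \<longleftrightarrow>
     (\<forall>s \<in> Sum \<kappa> C \<U>. \<forall>k. is_mono C k \<and> Cod C k = s \<longrightarrow> no_maps_mod_trace \<kappa> C \<U> (Dom C k))"

definition condition_b ::
    "'i rel \<Rightarrow> ('o, 'm, 'z) preadditive_data_scheme \<Rightarrow> 'o set \<Rightarrow> bool" where
  "condition_b \<kappa> C \<U> \<longleftrightarrow>
     (\<forall>a \<in> Ob C. \<forall>\<epsilon> k. is_canonical_morphism C \<U> a \<epsilon> \<and> is_kernel C \<epsilon> k \<longrightarrow>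
        no_maps_mod_trace \<kappa> C \<U> (Dom C k))"

definition condition_c ::
    "'i rel \<Rightarrow> ('o, 'm, 'z) preadditive_data_scheme \<Rightarrow> 'o set \<Rightarrow> bool" where
  "condition_c \<kappa> C \<U> \<longleftrightarrow>
     (\<forall>b \<in> Pres \<kappa> C \<U>. \<forall>\<epsilon> k. is_canonical_morphism C \<U> b \<epsilon> \<and> is_kernel C \<epsilon> k \<longrightarrow>
        Dom C k \<in> Gen \<kappa> C \<U>)"

end

theory Submission
  imports Defs
begin

text \<open>
  Write \<open>S \<rightarrow> A\<close> for the canonical morphism \<open>\<epsilon>\<^sub>A\<close> and \<open>K\<close> for its kernel. The implication
  (a) \<open>\<Longrightarrow>\<close> (b) is the special case \<open>K \<subseteq> S\<close>. For (b) \<open>\<Longrightarrow>\<close> (c), let \<open>A\<close> be presented by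
  \<open>s\<^sub>1 \<rightarrow> s\<^sub>0 \<rightarrow> A\<close>. As there are no maps from \<open>s\<^sub>1\<close> to \<open>X = K / tr K\<close>, the lift \<open>s\<^sub>0 \<rightarrow> S\<close> induces a
  section of \<open>S / tr K \<rightarrow> A\<close>, so that \<open>X\<close> is a quotient of \<open>S\<close>, hence \<open>X = 0\<close>.

  If the kernels of the morphisms of \<open>Sum\<close> are generated and (c) holds, then pulling back along
  \<open>\<epsilon>\<close> shows that kernels of morphisms from \<open>Sum\<close> to \<open>Pres\<close> are generated. This gives the closure of
  \<open>Pres\<close> under kernels and cokernels, and shows that \<open>S / tr K \<rightarrow> A\<close> is a coreflection.

  Conversely, let \<open>\<rho> : R \<rightarrow> K\<close> be the coreflection of a subobject \<open>K\<close> of \<open>S \<in> Sum\<close>. Its kernel is that of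
  \<open>R \<rightarrow> S\<close>, so it lies in \<open>Pres\<close> and therefore vanishes; hence \<open>R\<close> is the trace of \<open>K\<close> and \<open>S / R\<close> lies in
  \<open>Pres\<close>. The pullback of \<open>U \<rightarrow> K / R \<subseteq> S / R\<close> along \<open>S \<rightarrow> S / R\<close> lies in \<open>Pres\<close> and maps to \<open>K\<close>, hence
  to \<open>R\<close>, so the given map \<open>U \<rightarrow> K / R\<close> is zero.
\<close>


subsection \<open>Categories and preadditive categories\<close>

context category
begin

text \<open>As a simp rule this turns the typing of morphisms into equations about
  \<open>Dom\<close> and \<open>Cod\<close>; proofs that treat hom-sets as sets delete it
  again.\<close>

lemma Hom_iff [simp]: "f \<in> Hom C a b \<longleftrightarrow> f \<in> Ar C \<and> Dom C f = a \<and> Cod C f = b"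
  by (simp add: Hom_def)

lemma Dom_Ob [simp]: "f \<in> Ar C \<Longrightarrow> Dom C f \<in> Ob C"
  by (rule Dom_closed)

lemma Cod_Ob [simp]: "f \<in> Ar C \<Longrightarrow> Cod C f \<in> Ob C"
  by (rule Cod_closed)

lemma Hom_Ob: "f \<in> Hom C a b \<Longrightarrow> a \<in> Ob C" "f \<in> Hom C a b \<Longrightarrow> b \<in> Ob C"
  by auto

lemma Ident_simps [simp]:
  assumes "a \<in> Ob C"
  shows "Ident C a \<in> Ar C" "Dom C (Ident C a) = a" "Cod C (Ident C a) = a"
  using Ident_closed[OF assms] by simp_all

lemma Comp_simps [simp]:
  assumes "f \<in> Ar C" "g \<in> Ar C" "Cod C f = Dom C g"
  shows "g \<cdot> f \<in> Ar C" "Dom C (g \<cdot> f) = Dom C f" "Cod C (g \<cdot> f) = Cod C g"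
  using Comp_closed[of f "Dom C f" "Cod C f" g "Cod C g"] assms by simp_all

lemma Comp_assoc' [simp]:
  assumes "f \<in> Ar C" "g \<in> Ar C" "h \<in> Ar C" "Cod C f = Dom C g" "Cod C g = Dom C h"
  shows "(h \<cdot> g) \<cdot> f = h \<cdot> (g \<cdot> f)"
  using Comp_assoc[of f "Dom C f" "Cod C f" g "Cod C g" h "Cod C h"] assms by simp

lemma Ident_Comp [simp]: "\<lbrakk>f \<in> Ar C; Cod C f = b\<rbrakk> \<Longrightarrow> Ident C b \<cdot> f = f"
  using Comp_Ident_left[of f "Dom C f" b] by simp

lemma Comp_Ident [simp]: "\<lbrakk>f \<in> Ar C; Dom C f = a\<rbrakk> \<Longrightarrow> f \<cdot> Ident C a = f"
  using Comp_Ident_right[of f a "Cod C f"] by simp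

text \<open>Composites are normalised to right-nested form, where \<open>g \<cdot> f\<close> is no
  longer a subterm once something follows on the right. In this form an equation
  \<open>g \<cdot> f = h\<close> still applies there.\<close>

lemma Comp_reduce:
  assumes "g \<cdot> f = h" "f \<in> Ar C" "g \<in> Ar C" "x \<in> Ar C" "Cod C f = Dom C g" "Cod C x = Dom C f"
  shows "g \<cdot> (f \<cdot> x) = h \<cdot> x"
  using Comp_assoc'[of x f g] assms by simp

lemma is_monoD:
  assumes "is_mono C f" "f \<cdot> g = f \<cdot> h" "g \<in> Hom C a (Dom C f)" "h \<in> Hom C a (Dom C f)"
  shows "g = h"
proof -
  have "a \<in> Ob C" using assms(3) by auto
  then show ?thesis using assms unfolding is_mono_def by blast
qed

lemma is_epiD:
  assumes "is_epi C f" "g \<cdot> f = h \<cdot> f" "g \<in> Hom C (Cod C f) b" "h \<in> Hom C (Cod C f) b"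
  shows "g = h"
proof -
  have "b \<in> Ob C" using assms(3) by auto
  then show ?thesis using assms unfolding is_epi_def by blast
qed

lemma is_mono_Ar: "is_mono C f \<Longrightarrow> f \<in> Ar C"
  by (simp add: is_mono_def)

lemma is_epi_Ar: "is_epi C f \<Longrightarrow> f \<in> Ar C"
  by (simp add: is_epi_def)

lemma is_epi_Comp:
  assumes "is_epi C f" "is_epi C g" "Cod C f = Dom C g"
  shows "is_epi C (g \<cdot> f)"
  unfolding is_epi_def
proof (intro conjI ballI impI)
  have [simp]: "f \<in> Ar C" "g \<in> Ar C" using assms by (simp_all add: is_epi_Ar)
  show "g \<cdot> f \<in> Ar C" using assms by simp
  fix b u v
  assume "u \<in> Hom C (Cod C (g \<cdot> f)) b" "v \<in> Hom C (Cod C (g \<cdot> f)) b"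
    and eq: "u \<cdot> (g \<cdot> f) = v \<cdot> (g \<cdot> f)"
  then have [simp]: "u \<in> Ar C" "v \<in> Ar C" "Dom C u = Cod C g" "Dom C v = Cod C g"
    "Cod C u = b" "Cod C v = b" using assms(3) by simp_all
  have "(u \<cdot> g) \<cdot> f = (v \<cdot> g) \<cdot> f" using eq assms(3) by simp
  then have "u \<cdot> g = v \<cdot> g" by (rule is_epiD[OF assms(1)]) (use assms(3) in simp_all)
  then show "u = v" by (rule is_epiD[OF assms(2)]) simp_all
qed

text \<open>Comparison maps are shown to be epi this way below: some epimorphism factors through
  them as its last step.\<close>

lemma is_epi_Comp_left:
  assumes "is_epi C (g \<cdot> f)" "f \<in> Hom C a b" "g \<in> Hom C b c"
  shows "is_epi C g"
  unfolding is_epi_def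
proof (intro conjI ballI impI)
  have [simp]: "f \<in> Ar C" "g \<in> Ar C" "Cod C f = b" "Dom C g = b" "Cod C g = c" using assms by simp_all
  show "g \<in> Ar C" by simp
  fix d u v
  assume "u \<in> Hom C (Cod C g) d" "v \<in> Hom C (Cod C g) d" and eq: "u \<cdot> g = v \<cdot> g"
  then have [simp]: "u \<in> Ar C" "v \<in> Ar C" "Dom C u = c" "Dom C v = c" "Cod C u = d" "Cod C v = d"
    by simp_all
  have "u \<cdot> (g \<cdot> f) = v \<cdot> (g \<cdot> f)"
    using Comp_assoc'[of f g u] Comp_assoc'[of f g v] eq by simp
  then show "u = v" by (rule is_epiD[OF assms(1)]) simp_all
qed

lemma is_epi_Ident: "a \<in> Ob C \<Longrightarrow> is_epi C (Ident C a)"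
  by (simp add: is_epi_def)

end

section \<open>Differences of morphisms; testing monomorphisms and epimorphisms on zero\<close>

context preadditive_category
begin

text \<open>Each hom-set is a group of its own, so the group in which to invert is read off from the
  arrow.\<close>

definition neg :: "'m \<Rightarrow> 'm" where
  "neg f = m_inv (Hom_group C (Dom C f) (Cod C f)) f"

definition sub :: "'m \<Rightarrow> 'm \<Rightarrow> 'm" where
  "sub f g = f \<oplus>\<^sub>A neg g"

lemma Zero_simps [simp]:
  assumes "a \<in> Ob C" "b \<in> Ob C"
  shows "Zero C a b \<in> Ar C" "Dom C (Zero C a b) = a" "Cod C (Zero C a b) = b"
proof -
  interpret comm_group "Hom_group C a b" using assms by (rule Hom_comm_group)
  show "Zero C a b \<in> Ar C" "Dom C (Zero C a b) = a" "Cod C (Zero C a b) = b"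
    using one_closed by (simp_all add: Hom_group_def)
qed

lemma Add_simps [simp]:
  assumes "f \<in> Ar C" "g \<in> Ar C" "Dom C f = Dom C g" "Cod C f = Cod C g"
  shows "f \<oplus>\<^sub>A g \<in> Ar C" "Dom C (f \<oplus>\<^sub>A g) = Dom C g" "Cod C (f \<oplus>\<^sub>A g) = Cod C g"
proof -
  interpret comm_group "Hom_group C (Dom C g) (Cod C g)" using assms by (intro Hom_comm_group) auto
  show "f \<oplus>\<^sub>A g \<in> Ar C" "Dom C (f \<oplus>\<^sub>A g) = Dom C g" "Cod C (f \<oplus>\<^sub>A g) = Cod C g"
    using m_closed[of f g] assms by (simp_all add: Hom_group_def)
qed

lemma neg_simps [simp]:
  assumes "f \<in> Ar C"
  shows "neg f \<in> Ar C" "Dom C (neg f) = Dom C f" "Cod C (neg f) = Cod C f"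
    "f \<oplus>\<^sub>A neg f = Zero C (Dom C f) (Cod C f)"
proof -
  interpret comm_group "Hom_group C (Dom C f) (Cod C f)" using assms by (intro Hom_comm_group) auto
  show "neg f \<in> Ar C" "Dom C (neg f) = Dom C f" "Cod C (neg f) = Cod C f"
    "f \<oplus>\<^sub>A neg f = Zero C (Dom C f) (Cod C f)"
    using inv_closed[of f] r_inv[of f] assms unfolding neg_def by (simp_all add: Hom_group_def)
qed

lemma Add_Zero [simp]:
  assumes "f \<in> Hom C a b"
  shows "f \<oplus>\<^sub>A Zero C a b = f" "Zero C a b \<oplus>\<^sub>A f = f"
proof -
  interpret comm_group "Hom_group C a b" using assms by (intro Hom_comm_group) auto
  show "f \<oplus>\<^sub>A Zero C a b = f" "Zero C a b \<oplus>\<^sub>A f = f"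
    using r_one[of f] l_one[of f] assms by (simp_all add: Hom_group_def)
qed

lemma Add_cancel:
  assumes "f \<in> Hom C a b" "g \<in> Hom C a b" "h \<in> Hom C a b" "f \<oplus>\<^sub>A h = g \<oplus>\<^sub>A h"
  shows "f = g"
proof -
  interpret comm_group "Hom_group C a b" using assms by (intro Hom_comm_group) auto
  show ?thesis using right_cancel[of h f g] assms by (simp add: Hom_group_def)
qed

lemma Add_commute:
  assumes "f \<in> Hom C a b" "g \<in> Hom C a b"
  shows "f \<oplus>\<^sub>A g = g \<oplus>\<^sub>A f"
proof -
  interpret comm_group "Hom_group C a b" using assms by (intro Hom_comm_group) auto
  show ?thesis using m_comm[of f g] assms by (simp add: Hom_group_def)
qed

lemma Add_Comp [simp]:
  assumes "f \<in> Ar C" "g \<in> Ar C" "h \<in> Ar C" "Cod C f = Dom C g" "Dom C h = Dom C g" "Cod C h = Cod C g"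
  shows "(g \<oplus>\<^sub>A h) \<cdot> f = (g \<cdot> f) \<oplus>\<^sub>A (h \<cdot> f)"
  using Comp_Add_left[of f "Dom C f" "Dom C g" g "Cod C g" h] assms by simp

lemma Comp_Add [simp]:
  assumes "f \<in> Ar C" "g \<in> Ar C" "h \<in> Ar C" "Cod C f = Dom C h" "Dom C f = Dom C g" "Cod C f = Cod C g"
  shows "h \<cdot> (f \<oplus>\<^sub>A g) = (h \<cdot> f) \<oplus>\<^sub>A (h \<cdot> g)"
  using Comp_Add_right[of f "Dom C f" "Cod C f" g h "Cod C h"] assms by simp

text \<open>By additivity the composite added to itself is the composite, so cancellation makes it
  zero.\<close>

lemma Comp_Zero [simp]:
  assumes "f \<in> Ar C" "Dom C f = b" "a \<in> Ob C"
  shows "f \<cdot> Zero C a b = Zero C a (Cod C f)"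
proof (rule Add_cancel)
  have [simp]: "b \<in> Ob C" using assms by auto
  show "f \<cdot> Zero C a b \<in> Hom C a (Cod C f)" "Zero C a (Cod C f) \<in> Hom C a (Cod C f)"
    "f \<cdot> Zero C a b \<in> Hom C a (Cod C f)"
    using assms by simp_all
  have "f \<cdot> Zero C a b \<oplus>\<^sub>A f \<cdot> Zero C a b = f \<cdot> (Zero C a b \<oplus>\<^sub>A Zero C a b)"
    using assms by (subst Comp_Add) simp_all
  then show "f \<cdot> Zero C a b \<oplus>\<^sub>A f \<cdot> Zero C a b = Zero C a (Cod C f) \<oplus>\<^sub>A f \<cdot> Zero C a b"
    using assms by simp
qed

lemma Zero_Comp [simp]:
  assumes "f \<in> Ar C" "Cod C f = b" "c \<in> Ob C"
  shows "Zero C b c \<cdot> f = Zero C (Dom C f) c"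
proof (rule Add_cancel)
  have [simp]: "b \<in> Ob C" using assms by auto
  show "Zero C b c \<cdot> f \<in> Hom C (Dom C f) c" "Zero C (Dom C f) c \<in> Hom C (Dom C f) c"
    "Zero C b c \<cdot> f \<in> Hom C (Dom C f) c"
    using assms by simp_all
  have "Zero C b c \<cdot> f \<oplus>\<^sub>A Zero C b c \<cdot> f = (Zero C b c \<oplus>\<^sub>A Zero C b c) \<cdot> f"
    using assms by (subst Add_Comp) simp_all
  then show "Zero C b c \<cdot> f \<oplus>\<^sub>A Zero C b c \<cdot> f = Zero C (Dom C f) c \<oplus>\<^sub>A Zero C b c \<cdot> f"
    using assms by simp
qed

lemma sub_simps [simp]:
  assumes "f \<in> Ar C" "g \<in> Ar C" "Dom C f = Dom C g" "Cod C f = Cod C g"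
  shows "sub f g \<in> Ar C" "Dom C (sub f g) = Dom C g" "Cod C (sub f g) = Cod C g"
  using assms by (simp_all add: sub_def)

lemma sub_Zero [simp]:
  assumes "f \<in> Hom C a b"
  shows "sub f (Zero C a b) = f"
proof -
  have [simp]: "a \<in> Ob C" "b \<in> Ob C" using Hom_Ob assms by blast+
  have "neg (Zero C a b) = Zero C a b"
    using neg_simps(4)[of "Zero C a b"] by (simp del: neg_simps(4))
  then show ?thesis using assms by (simp add: sub_def)
qed

lemma sub_eq_Zero_iff:
  assumes "f \<in> Hom C a b" "g \<in> Hom C a b"
  shows "sub f g = Zero C a b \<longleftrightarrow> f = g"
proof
  assume "sub f g = Zero C a b"
  then have "f \<oplus>\<^sub>A neg g = g \<oplus>\<^sub>A neg g" using assms by (simp add: sub_def)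
  then show "f = g" by (rule Add_cancel[rotated -1]) (use assms in simp_all)
qed (use assms in \<open>simp add: sub_def\<close>)

lemma Comp_neg:
  assumes "f \<in> Hom C a b" "h \<in> Hom C b c"
  shows "h \<cdot> neg f = neg (h \<cdot> f)"
proof (rule Add_cancel)
  have "h \<cdot> f \<oplus>\<^sub>A h \<cdot> neg f = h \<cdot> (f \<oplus>\<^sub>A neg f)" using assms by (subst Comp_Add) simp_all
  then have "h \<cdot> f \<oplus>\<^sub>A h \<cdot> neg f = h \<cdot> f \<oplus>\<^sub>A neg (h \<cdot> f)"
    using assms by auto
  then show "h \<cdot> neg f \<oplus>\<^sub>A h \<cdot> f = neg (h \<cdot> f) \<oplus>\<^sub>A h \<cdot> f"
    using Add_commute[of "h \<cdot> neg f" a c "h \<cdot> f"] Add_commute[of "neg (h \<cdot> f)" a c "h \<cdot> f"] assms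
    by simp
qed (use assms in simp_all)

lemma neg_Comp:
  assumes "f \<in> Hom C a b" "h \<in> Hom C b c"
  shows "neg h \<cdot> f = neg (h \<cdot> f)"
proof (rule Add_cancel)
  have "h \<cdot> f \<oplus>\<^sub>A neg h \<cdot> f = (h \<oplus>\<^sub>A neg h) \<cdot> f" using assms by (subst Add_Comp) simp_all
  then have "h \<cdot> f \<oplus>\<^sub>A neg h \<cdot> f = h \<cdot> f \<oplus>\<^sub>A neg (h \<cdot> f)"
    using assms by auto
  then show "neg h \<cdot> f \<oplus>\<^sub>A h \<cdot> f = neg (h \<cdot> f) \<oplus>\<^sub>A h \<cdot> f"
    using Add_commute[of "neg h \<cdot> f" a c "h \<cdot> f"] Add_commute[of "neg (h \<cdot> f)" a c "h \<cdot> f"] assms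
    by simp
qed (use assms in simp_all)

lemma Comp_sub [simp]:
  assumes "f \<in> Ar C" "g \<in> Ar C" "h \<in> Ar C" "Cod C f = Dom C h" "Dom C f = Dom C g" "Cod C f = Cod C g"
  shows "h \<cdot> sub f g = sub (h \<cdot> f) (h \<cdot> g)"
  using assms Comp_neg[of g "Dom C g" "Cod C g" h "Cod C h"] by (simp add: sub_def)

lemma sub_Comp [simp]:
  assumes "f \<in> Ar C" "g \<in> Ar C" "h \<in> Ar C" "Cod C f = Dom C g" "Dom C h = Dom C g" "Cod C h = Cod C g"
  shows "sub g h \<cdot> f = sub (g \<cdot> f) (h \<cdot> f)"
  using assms neg_Comp[of f "Dom C f" "Dom C g" h "Cod C g"] by (simp add: sub_def)

text \<open>Two arrows with equal composites differ by an arrow with composite zero, so testing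
  \<open>sub g h\<close> suffices.\<close>

lemma is_mono_iff_Zero:
  "is_mono C f \<longleftrightarrow> f \<in> Ar C \<and>
    (\<forall>g \<in> Ar C. Cod C g = Dom C f \<longrightarrow> f \<cdot> g = Zero C (Dom C g) (Cod C f) \<longrightarrow>
       g = Zero C (Dom C g) (Dom C f))" (is "_ \<longleftrightarrow> ?R")
proof
  assume m: "is_mono C f"
  then have [simp]: "f \<in> Ar C" by (rule is_mono_Ar)
  show ?R
  proof (intro conjI ballI impI)
    fix g assume g: "g \<in> Ar C" "Cod C g = Dom C f" "f \<cdot> g = Zero C (Dom C g) (Cod C f)"
    then have "f \<cdot> g = f \<cdot> Zero C (Dom C g) (Dom C f)" by simp
    then show "g = Zero C (Dom C g) (Dom C f)"
      by (rule is_monoD[OF m]) (use g in simp_all)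
  qed simp
next
  assume R: ?R
  then have [simp]: "f \<in> Ar C" by simp
  show "is_mono C f" unfolding is_mono_def
  proof (intro conjI ballI impI)
    fix a g h assume g: "g \<in> Hom C a (Dom C f)" "h \<in> Hom C a (Dom C f)" "f \<cdot> g = f \<cdot> h"
    then have [simp]: "a \<in> Ob C" by auto
    have "f \<cdot> sub g h = Zero C a (Cod C f)"
      using g sub_eq_Zero_iff[of "f \<cdot> g" a "Cod C f" "f \<cdot> h"] by simp
    then have "sub g h = Zero C a (Dom C f)"
      using R g bspec[OF conjunct2[OF R], of "sub g h"] by (simp del: Comp_sub)
    then show "g = h" using sub_eq_Zero_iff g by blast
  qed simp
qed

lemma is_epi_iff_Zero:
  "is_epi C f \<longleftrightarrow> f \<in> Ar C \<and>
    (\<forall>g \<in> Ar C. Dom C g = Cod C f \<longrightarrow> g \<cdot> f = Zero C (Dom C f) (Cod C g) \<longrightarrow>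
       g = Zero C (Cod C f) (Cod C g))" (is "_ \<longleftrightarrow> ?R")
proof
  assume m: "is_epi C f"
  then have [simp]: "f \<in> Ar C" by (rule is_epi_Ar)
  show ?R
  proof (intro conjI ballI impI)
    fix g assume g: "g \<in> Ar C" "Dom C g = Cod C f" "g \<cdot> f = Zero C (Dom C f) (Cod C g)"
    then have "g \<cdot> f = Zero C (Cod C f) (Cod C g) \<cdot> f" by simp
    then show "g = Zero C (Cod C f) (Cod C g)"
      by (rule is_epiD[OF m]) (use g in simp_all)
  qed simp
next
  assume R: ?R
  then have [simp]: "f \<in> Ar C" by simp
  show "is_epi C f" unfolding is_epi_def
  proof (intro conjI ballI impI)
    fix a g h assume g: "g \<in> Hom C (Cod C f) a" "h \<in> Hom C (Cod C f) a" "g \<cdot> f = h \<cdot> f"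
    then have [simp]: "a \<in> Ob C" by auto
    have "sub g h \<cdot> f = Zero C (Dom C f) a"
      using g sub_eq_Zero_iff[of "g \<cdot> f" "Dom C f" a "h \<cdot> f"] by simp
    then have "sub g h = Zero C (Cod C f) a"
      using R g bspec[OF conjunct2[OF R], of "sub g h"] by (simp del: sub_Comp)
    then show "g = h" using sub_eq_Zero_iff g by blast
  qed simp
qed

end

subsection \<open>Kernels, pullbacks and images\<close>

context preadditive_category
begin

lemma is_kernel_Hom:
  assumes "is_kernel C f k"
  shows "f \<in> Ar C" "k \<in> Ar C" "Cod C k = Dom C f" "f \<cdot> k = Zero C (Dom C k) (Cod C f)"
  using assms by (simp_all add: is_kernel_def)

lemma is_cokernel_Hom:
  assumes "is_cokernel C f q"
  shows "f \<in> Ar C" "q \<in> Ar C" "Dom C q = Cod C f" "q \<cdot> f = Zero C (Dom C f) (Cod C q)"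
  using assms by (simp_all add: is_cokernel_def)

lemma is_kernel_lift:
  assumes "is_kernel C f k" "g \<in> Ar C" "Cod C g = Dom C f" "f \<cdot> g = Zero C (Dom C g) (Cod C f)"
  obtains h where "h \<in> Hom C (Dom C g) (Dom C k)" "k \<cdot> h = g"
proof -
  have "g \<in> Hom C (Dom C g) (Dom C f)" "Dom C g \<in> Ob C" using assms by simp_all
  then show ?thesis using assms that unfolding is_kernel_def by blast
qed

lemma is_cokernel_desc:
  assumes "is_cokernel C f q" "g \<in> Ar C" "Dom C g = Cod C f" "g \<cdot> f = Zero C (Dom C f) (Cod C g)"
  obtains h where "h \<in> Hom C (Cod C q) (Cod C g)" "h \<cdot> q = g"
proof -
  have "g \<in> Hom C (Cod C f) (Cod C g)" "Cod C g \<in> Ob C" using assms by simp_all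
  then show ?thesis using assms that unfolding is_cokernel_def by blast
qed

text \<open>Uniqueness of the factorization comes from \<open>k\<close> being mono, so only its
  existence is left to check.\<close>

lemma is_kernelI:
  assumes "f \<in> Hom C b c" "k \<in> Hom C a b" "f \<cdot> k = Zero C a c" "is_mono C k"
    and "\<And>g. \<lbrakk>g \<in> Ar C; Cod C g = b; f \<cdot> g = Zero C (Dom C g) c\<rbrakk>
      \<Longrightarrow> \<exists>h. h \<in> Hom C (Dom C g) a \<and> k \<cdot> h = g"
  shows "is_kernel C f k"
  unfolding is_kernel_def
proof (intro conjI ballI impI)
  fix d g assume "g \<in> Hom C d (Dom C f)" "f \<cdot> g = Zero C d (Cod C f)"
  then obtain h where "h \<in> Hom C d (Dom C k)" "k \<cdot> h = g"
    using assms(5)[of g] assms(1,2) by auto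
  then show "\<exists>!h. h \<in> Hom C d (Dom C k) \<and> k \<cdot> h = g"
    using is_monoD[OF assms(4)] by metis
qed (use assms in simp_all)

lemma is_cokernelI:
  assumes "f \<in> Hom C a b" "q \<in> Hom C b c" "q \<cdot> f = Zero C a c" "is_epi C q"
    and "\<And>g. \<lbrakk>g \<in> Ar C; Dom C g = b; g \<cdot> f = Zero C a (Cod C g)\<rbrakk>
      \<Longrightarrow> \<exists>h. h \<in> Hom C c (Cod C g) \<and> h \<cdot> q = g"
  shows "is_cokernel C f q"
  unfolding is_cokernel_def
proof (intro conjI ballI impI)
  fix d g assume "g \<in> Hom C (Cod C f) d" "g \<cdot> f = Zero C (Dom C f) d"
  then obtain h where "h \<in> Hom C (Cod C q) d" "h \<cdot> q = g"
    using assms(5)[of g] assms(1,2) by auto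
  then show "\<exists>!h. h \<in> Hom C (Cod C q) d \<and> h \<cdot> q = g"
    using is_epiD[OF assms(4)] by metis
qed (use assms in simp_all)

lemma is_kernel_mono:
  assumes "is_kernel C f k"
  shows "is_mono C k"
  unfolding is_mono_def
proof (intro conjI ballI impI)
  note [simp] = is_kernel_Hom[OF assms]
  show "k \<in> Ar C" by simp
  fix a g h assume a: "a \<in> Ob C" "g \<in> Hom C a (Dom C k)" "h \<in> Hom C a (Dom C k)" "k \<cdot> g = k \<cdot> h"
  have "f \<cdot> (k \<cdot> g) = Zero C a (Cod C f)"
    using a(1,2) Comp_assoc'[of g k f] by simp
  moreover have "k \<cdot> g \<in> Hom C a (Dom C f)" using a by simp
  ultimately have "\<exists>!x. x \<in> Hom C a (Dom C k) \<and> k \<cdot> x = k \<cdot> g"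
    using assms a(1) unfolding is_kernel_def by blast
  then show "g = h" using a by metis
qed

lemma is_cokernel_epi:
  assumes "is_cokernel C f q"
  shows "is_epi C q"
  unfolding is_epi_def
proof (intro conjI ballI impI)
  note [simp] = is_cokernel_Hom[OF assms]
  show "q \<in> Ar C" by simp
  fix a g h assume a: "a \<in> Ob C" "g \<in> Hom C (Cod C q) a" "h \<in> Hom C (Cod C q) a" "g \<cdot> q = h \<cdot> q"
  have "(g \<cdot> q) \<cdot> f = Zero C (Dom C f) a"
    using a(1,2) by simp
  moreover have "g \<cdot> q \<in> Hom C (Cod C f) a" using a by simp
  ultimately have "\<exists>!x. x \<in> Hom C (Cod C q) a \<and> x \<cdot> q = g \<cdot> q"
    using assms a(1) unfolding is_cokernel_def by blast
  then show "g = h" using a by metis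
qed

text \<open>Since \<open>g\<close> kills \<open>k\<close>, it factors through the cokernel
  \<open>q\<close>. Whatever \<open>q\<close> kills is thus killed by \<open>g\<close> and factors
  through \<open>k\<close>.\<close>

lemma mono_is_kernel_of_cokernel:
  assumes "is_kernel C g k" "is_cokernel C k q"
  shows "is_kernel C q k"
proof -
  note [simp] = is_kernel_Hom[OF assms(1)] is_cokernel_Hom[OF assms(2)]
  obtain h where h: "h \<in> Hom C (Cod C q) (Cod C g)" "h \<cdot> q = g"
    by (rule is_cokernel_desc[OF assms(2), of g]) simp_all
  show ?thesis
  proof (rule is_kernelI)
    fix x assume x: "x \<in> Ar C" "Cod C x = Cod C k" "q \<cdot> x = Zero C (Dom C x) (Cod C q)"
    have "g \<cdot> x = h \<cdot> (q \<cdot> x)" using h x(1,2) Comp_assoc'[of x q h] by simp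
    then have "g \<cdot> x = Zero C (Dom C x) (Cod C g)" using h x by simp
    then show "\<exists>h. h \<in> Hom C (Dom C x) (Dom C k) \<and> k \<cdot> h = x"
      using is_kernel_lift[OF assms(1), of x] x by auto
  qed (use is_kernel_mono[OF assms(1)] in simp_all)
qed

lemma epi_is_cokernel_of_kernel:
  assumes "is_cokernel C g q" "is_kernel C q k"
  shows "is_cokernel C k q"
proof -
  note [simp] = is_cokernel_Hom[OF assms(1)] is_kernel_Hom[OF assms(2)]
  obtain h where h: "h \<in> Hom C (Dom C g) (Dom C k)" "k \<cdot> h = g"
    by (rule is_kernel_lift[OF assms(2), of g]) simp_all
  show ?thesis
  proof (rule is_cokernelI)
    fix x assume x: "x \<in> Ar C" "Dom C x = Dom C q" "x \<cdot> k = Zero C (Dom C k) (Cod C x)"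
    have "x \<cdot> g = (x \<cdot> k) \<cdot> h" using h x(1,2) Comp_assoc'[of h k x] by simp
    then have "x \<cdot> g = Zero C (Dom C g) (Cod C x)" using h x by simp
    then show "\<exists>h. h \<in> Hom C (Cod C q) (Cod C x) \<and> h \<cdot> q = x"
      using is_cokernel_desc[OF assms(1), of x] x by auto
  qed (use is_cokernel_epi[OF assms(1)] in simp_all)
qed

section \<open>Calculus of biproducts, and pullbacks as kernels of differences\<close>

lemma biproduct_eqI:
  assumes bp: "is_biproduct C a b c i\<^sub>1 i\<^sub>2 p\<^sub>1 p\<^sub>2"
    and "f \<in> Hom C c d" "g \<in> Hom C c d" "f \<cdot> i\<^sub>1 = g \<cdot> i\<^sub>1" "f \<cdot> i\<^sub>2 = g \<cdot> i\<^sub>2"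
  shows "f = g"
proof -
  have [simp]: "i\<^sub>1 \<in> Ar C" "i\<^sub>2 \<in> Ar C" "p\<^sub>1 \<in> Ar C" "p\<^sub>2 \<in> Ar C" "Dom C i\<^sub>1 = a" "Dom C i\<^sub>2 = b"
    "Cod C p\<^sub>1 = a" "Cod C p\<^sub>2 = b" "Cod C i\<^sub>1 = c" "Cod C i\<^sub>2 = c" "Dom C p\<^sub>1 = c" "Dom C p\<^sub>2 = c"
    and 1: "i\<^sub>1 \<cdot> p\<^sub>1 \<oplus>\<^sub>A i\<^sub>2 \<cdot> p\<^sub>2 = Ident C c"
    using bp by (simp_all add: is_biproduct_def)
  have *: "h = (h \<cdot> i\<^sub>1) \<cdot> p\<^sub>1 \<oplus>\<^sub>A (h \<cdot> i\<^sub>2) \<cdot> p\<^sub>2" if "h \<in> Hom C c d" for h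
  proof -
    have "h \<cdot> (i\<^sub>1 \<cdot> p\<^sub>1 \<oplus>\<^sub>A i\<^sub>2 \<cdot> p\<^sub>2) = (h \<cdot> i\<^sub>1) \<cdot> p\<^sub>1 \<oplus>\<^sub>A (h \<cdot> i\<^sub>2) \<cdot> p\<^sub>2"
      using that by simp
    then show ?thesis using that by (simp add: 1)
  qed
  show ?thesis using *[OF assms(2)] *[OF assms(3)] assms(4,5) by simp
qed

text \<open>The definition of a biproduct does not mention the mixed composites. Inserting the
  decomposition of the identity between \<open>p\<^sub>1\<close> and \<open>i\<^sub>2\<close> shows
  that \<open>p\<^sub>1 \<cdot> i\<^sub>2\<close> added to itself is itself, hence zero.\<close>

lemma biproduct_simps:
  assumes bp: "is_biproduct C a b c i\<^sub>1 i\<^sub>2 p\<^sub>1 p\<^sub>2"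
  shows "i\<^sub>1 \<in> Ar C" "i\<^sub>2 \<in> Ar C" "p\<^sub>1 \<in> Ar C" "p\<^sub>2 \<in> Ar C" "Dom C i\<^sub>1 = a" "Dom C i\<^sub>2 = b"
    "Cod C p\<^sub>1 = a" "Cod C p\<^sub>2 = b" "Cod C i\<^sub>1 = c" "Cod C i\<^sub>2 = c" "Dom C p\<^sub>1 = c" "Dom C p\<^sub>2 = c"
    "p\<^sub>1 \<cdot> i\<^sub>1 = Ident C a" "p\<^sub>2 \<cdot> i\<^sub>2 = Ident C b" "p\<^sub>1 \<cdot> i\<^sub>2 = Zero C b a" "p\<^sub>2 \<cdot> i\<^sub>1 = Zero C a b"
proof -
  show [simp]: "i\<^sub>1 \<in> Ar C" "i\<^sub>2 \<in> Ar C" "p\<^sub>1 \<in> Ar C" "p\<^sub>2 \<in> Ar C" "Dom C i\<^sub>1 = a" "Dom C i\<^sub>2 = b"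
    "Cod C p\<^sub>1 = a" "Cod C p\<^sub>2 = b" "Cod C i\<^sub>1 = c" "Cod C i\<^sub>2 = c" "Dom C p\<^sub>1 = c" "Dom C p\<^sub>2 = c"
    "p\<^sub>1 \<cdot> i\<^sub>1 = Ident C a" "p\<^sub>2 \<cdot> i\<^sub>2 = Ident C b"
    using bp by (simp_all add: is_biproduct_def)
  have 1: "i\<^sub>1 \<cdot> p\<^sub>1 \<oplus>\<^sub>A i\<^sub>2 \<cdot> p\<^sub>2 = Ident C c" using bp by (simp add: is_biproduct_def)
  have [simp]: "a \<in> Ob C" "b \<in> Ob C" "c \<in> Ob C"
    using Dom_Ob[of i\<^sub>1] Dom_Ob[of i\<^sub>2] Cod_Ob[of i\<^sub>1] by (simp_all del: Dom_Ob Cod_Ob)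
  have "p\<^sub>1 \<cdot> (i\<^sub>1 \<cdot> p\<^sub>1 \<oplus>\<^sub>A i\<^sub>2 \<cdot> p\<^sub>2) \<cdot> i\<^sub>2 = p\<^sub>1 \<cdot> i\<^sub>2"
    by (simp only: 1) simp
  then have "p\<^sub>1 \<cdot> i\<^sub>2 \<oplus>\<^sub>A p\<^sub>1 \<cdot> i\<^sub>2 = p\<^sub>1 \<cdot> i\<^sub>2"
    by (simp add: Comp_reduce[of p\<^sub>1 i\<^sub>1 "Ident C a"])
  then show "p\<^sub>1 \<cdot> i\<^sub>2 = Zero C b a"
    using Add_cancel[of "p\<^sub>1 \<cdot> i\<^sub>2" b a "Zero C b a" "p\<^sub>1 \<cdot> i\<^sub>2"] by simp
  have "p\<^sub>2 \<cdot> (i\<^sub>1 \<cdot> p\<^sub>1 \<oplus>\<^sub>A i\<^sub>2 \<cdot> p\<^sub>2) \<cdot> i\<^sub>1 = p\<^sub>2 \<cdot> i\<^sub>1"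
    by (simp only: 1) simp
  then have "p\<^sub>2 \<cdot> i\<^sub>1 \<oplus>\<^sub>A p\<^sub>2 \<cdot> i\<^sub>1 = p\<^sub>2 \<cdot> i\<^sub>1"
    by (simp add: Comp_reduce[of p\<^sub>2 i\<^sub>2 "Ident C b"])
  then show "p\<^sub>2 \<cdot> i\<^sub>1 = Zero C a b"
    using Add_cancel[of "p\<^sub>2 \<cdot> i\<^sub>1" a b "Zero C a b" "p\<^sub>2 \<cdot> i\<^sub>1"] by simp
qed

lemma biproduct_reduce:
  assumes bp: "is_biproduct C a b c i\<^sub>1 i\<^sub>2 p\<^sub>1 p\<^sub>2" and "x \<in> Ar C"
  shows "Cod C x = a \<Longrightarrow> p\<^sub>1 \<cdot> (i\<^sub>1 \<cdot> x) = x" "Cod C x = b \<Longrightarrow> p\<^sub>2 \<cdot> (i\<^sub>2 \<cdot> x) = x"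
    "Cod C x = b \<Longrightarrow> p\<^sub>1 \<cdot> (i\<^sub>2 \<cdot> x) = Zero C (Dom C x) a"
    "Cod C x = a \<Longrightarrow> p\<^sub>2 \<cdot> (i\<^sub>1 \<cdot> x) = Zero C (Dom C x) b"
proof -
  note [simp] = biproduct_simps[OF bp]
  have [simp]: "a \<in> Ob C" "b \<in> Ob C"
    using Cod_Ob[of p\<^sub>1] Cod_Ob[of p\<^sub>2] by (simp_all del: Cod_Ob)
  show "Cod C x = a \<Longrightarrow> p\<^sub>1 \<cdot> (i\<^sub>1 \<cdot> x) = x"
    using assms by (simp add: Comp_reduce[OF biproduct_simps(13)[OF bp]])
  show "Cod C x = b \<Longrightarrow> p\<^sub>2 \<cdot> (i\<^sub>2 \<cdot> x) = x"
    using assms by (simp add: Comp_reduce[OF biproduct_simps(14)[OF bp]])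
  show "Cod C x = b \<Longrightarrow> p\<^sub>1 \<cdot> (i\<^sub>2 \<cdot> x) = Zero C (Dom C x) a"
    using assms by (simp add: Comp_reduce[OF biproduct_simps(15)[OF bp]])
  show "Cod C x = a \<Longrightarrow> p\<^sub>2 \<cdot> (i\<^sub>1 \<cdot> x) = Zero C (Dom C x) b"
    using assms by (simp add: Comp_reduce[OF biproduct_simps(16)[OF bp]])
qed

lemma biproduct_desc:
  assumes bp: "is_biproduct C a b c i\<^sub>1 i\<^sub>2 p\<^sub>1 p\<^sub>2"
    and "f \<in> Hom C a d" "g \<in> Hom C b d"
  obtains h where "h \<in> Hom C c d" "h \<cdot> i\<^sub>1 = f" "h \<cdot> i\<^sub>2 = g"
proof
  note [simp] = biproduct_simps[OF bp]
  have [simp]: "a \<in> Ob C" "b \<in> Ob C" "d \<in> Ob C"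
    using Hom_Ob assms(2,3) by blast+
  let ?h = "f \<cdot> p\<^sub>1 \<oplus>\<^sub>A g \<cdot> p\<^sub>2"
  show "?h \<in> Hom C c d" using assms by simp
  show "?h \<cdot> i\<^sub>1 = f" "?h \<cdot> i\<^sub>2 = g" using assms by simp_all
qed

lemma biproduct_lift:
  assumes bp: "is_biproduct C a b c i\<^sub>1 i\<^sub>2 p\<^sub>1 p\<^sub>2"
    and "f \<in> Hom C d a" "g \<in> Hom C d b"
  obtains h where "h \<in> Hom C d c" "p\<^sub>1 \<cdot> h = f" "p\<^sub>2 \<cdot> h = g"
proof
  note [simp] = biproduct_simps[OF bp]
  have [simp]: "a \<in> Ob C" "b \<in> Ob C" "d \<in> Ob C"
    by (rule Hom_Ob(2)[OF assms(2)] Hom_Ob(2)[OF assms(3)] Hom_Ob(1)[OF assms(2)])+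
  let ?h = "i\<^sub>1 \<cdot> f \<oplus>\<^sub>A i\<^sub>2 \<cdot> g"
  show "?h \<in> Hom C d c" using assms by simp
  show "p\<^sub>1 \<cdot> ?h = f" "p\<^sub>2 \<cdot> ?h = g"
    using assms by (simp_all add: biproduct_reduce[OF bp])
qed

text \<open>The pullback consists of the pairs on which the difference of the two maps vanishes. The
  biproduct and the kernel are kept explicit so that hypotheses about kernels of morphisms out of
  sums can be applied to pullbacks.\<close>

lemma kernel_is_pullback:
  assumes bp: "is_biproduct C a b d i\<^sub>1 i\<^sub>2 p\<^sub>1 p\<^sub>2"
    and y: "y \<in> Hom C a c" and g: "g \<in> Hom C b c"
    and n: "is_kernel C (sub (y \<cdot> p\<^sub>1) (g \<cdot> p\<^sub>2)) n"
  shows "n \<in> Ar C" "Cod C n = d"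
    and "y \<cdot> (p\<^sub>1 \<cdot> n) = g \<cdot> (p\<^sub>2 \<cdot> n)"
    and "\<And>u v x. \<lbrakk>u \<in> Hom C x a; v \<in> Hom C x b; y \<cdot> u = g \<cdot> v\<rbrakk>
      \<Longrightarrow> \<exists>h. h \<in> Hom C x (Dom C n) \<and> p\<^sub>1 \<cdot> n \<cdot> h = u \<and> p\<^sub>2 \<cdot> n \<cdot> h = v"
proof -
  note [simp] = biproduct_simps[OF bp]
  have [simp]: "y \<in> Ar C" "g \<in> Ar C" "Dom C y = a" "Dom C g = b" "Cod C y = c" "Cod C g = c"
    using y g by simp_all
  show [simp]: "n \<in> Ar C" "Cod C n = d" using is_kernel_Hom[OF n] by simp_all
  have "sub (y \<cdot> (p\<^sub>1 \<cdot> n)) (g \<cdot> (p\<^sub>2 \<cdot> n)) = Zero C (Dom C n) c"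
    using is_kernel_Hom(4)[OF n] by simp
  then show "y \<cdot> (p\<^sub>1 \<cdot> n) = g \<cdot> (p\<^sub>2 \<cdot> n)"
    by (subst (asm) sub_eq_Zero_iff) simp_all
  fix u v x assume uv: "u \<in> Hom C x a" "v \<in> Hom C x b" "y \<cdot> u = g \<cdot> v"
  obtain w where w: "w \<in> Hom C x d" "p\<^sub>1 \<cdot> w = u" "p\<^sub>2 \<cdot> w = v"
    using biproduct_lift[OF bp uv(1,2)] by blast
  have "sub (y \<cdot> p\<^sub>1) (g \<cdot> p\<^sub>2) \<cdot> w = Zero C x c"
    using w uv sub_eq_Zero_iff[of "y \<cdot> u" x c "g \<cdot> v"] by simp
  then obtain h where "h \<in> Hom C x (Dom C n)" "n \<cdot> h = w"
    using is_kernel_lift[OF n, of w] w by auto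
  then show "\<exists>h. h \<in> Hom C x (Dom C n) \<and> p\<^sub>1 \<cdot> n \<cdot> h = u \<and> p\<^sub>2 \<cdot> n \<cdot> h = v"
    using w by auto
qed

end

section \<open>Pullbacks of epimorphisms, images, and diagram chasing on covers\<close>

context abelian_category
begin

lemma mono_ex_cokernel:
  assumes "is_mono C k"
  obtains q where "is_cokernel C k q" "is_kernel C q k"
  using assms ex_cokernel[OF is_mono_Ar] mono_normal mono_is_kernel_of_cokernel by blast

lemma epi_ex_kernel:
  assumes "is_epi C q"
  obtains k where "is_kernel C q k" "is_cokernel C k q"
  using assms ex_kernel[OF is_epi_Ar] epi_normal epi_is_cokernel_of_kernel by blast

text \<open>The difference map restricts to \<open>y\<close> along \<open>i\<^sub>1\<close>, so it
  is epi and hence the cokernel of \<open>n\<close>. If \<open>v\<close> kills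
  \<open>p\<^sub>2 \<cdot> n\<close>, then \<open>v \<cdot> p\<^sub>2\<close> descends to some
  \<open>w\<close> on \<open>c\<close> that kills \<open>y\<close>; so \<open>w\<close> vanishes,
  and with it \<open>v\<close>.\<close>

lemma pullback_epi:
  assumes bp: "is_biproduct C a b d i\<^sub>1 i\<^sub>2 p\<^sub>1 p\<^sub>2"
    and y: "y \<in> Hom C a c" and g: "g \<in> Hom C b c"
    and n: "is_kernel C (sub (y \<cdot> p\<^sub>1) (g \<cdot> p\<^sub>2)) n" and epi: "is_epi C y"
  shows "is_epi C (p\<^sub>2 \<cdot> n)"
proof -
  note [simp] = biproduct_simps[OF bp] kernel_is_pullback(1,2)[OF assms(1-4)]
  have [simp]: "y \<in> Ar C" "g \<in> Ar C" "Dom C y = a" "Dom C g = b" "Cod C y = c" "Cod C g = c"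
    using y g by simp_all
  have Ob [simp]: "a \<in> Ob C" "b \<in> Ob C" "c \<in> Ob C" "d \<in> Ob C"
    using Hom_Ob y g bp unfolding is_biproduct_def by blast+
  let ?s = "sub (y \<cdot> p\<^sub>1) (g \<cdot> p\<^sub>2)"
  have si: "?s \<cdot> i\<^sub>1 = y"
    by simp
  have "is_epi C ?s" using is_epi_Comp_left[of ?s i\<^sub>1 a d c] epi by (simp only: si) simp
  then obtain n' where n': "is_cokernel C n' ?s" using epi_normal by blast
  have coker: "is_cokernel C n ?s" by (rule epi_is_cokernel_of_kernel[OF n' n])
  show ?thesis unfolding is_epi_iff_Zero
  proof (intro conjI ballI impI)
    show "p\<^sub>2 \<cdot> n \<in> Ar C" by simp
    fix v assume v: "v \<in> Ar C" "Dom C v = Cod C (p\<^sub>2 \<cdot> n)"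
      "v \<cdot> (p\<^sub>2 \<cdot> n) = Zero C (Dom C (p\<^sub>2 \<cdot> n)) (Cod C v)"
    then have [simp]: "Dom C v = b" by simp
    obtain w where w: "w \<in> Hom C c (Cod C v)" "w \<cdot> ?s = v \<cdot> p\<^sub>2"
      using is_cokernel_desc[OF coker, of "v \<cdot> p\<^sub>2"] v by auto
    have "w \<cdot> y = (w \<cdot> ?s) \<cdot> i\<^sub>1" using w(1) si by (subst Comp_assoc') simp_all
    also have "\<dots> = Zero C a (Cod C v)" using v by (simp add: w)
    finally have "w = Zero C c (Cod C v)" using epi w unfolding is_epi_iff_Zero by auto
    then have "v \<cdot> p\<^sub>2 = Zero C d (Cod C v)" using w v by simp
    then have "(v \<cdot> p\<^sub>2) \<cdot> i\<^sub>2 = Zero C d (Cod C v) \<cdot> i\<^sub>2" by simp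
    then have "v = Zero C b (Cod C v)" using v by simp
    then show "v = Zero C (Cod C (p\<^sub>2 \<cdot> n)) (Cod C v)" by simp
  qed
qed

text \<open>The substitute for choosing preimages: when \<open>y\<close> is epi, \<open>u\<close>
  lifts \<open>g\<close> along \<open>y\<close> after passing to the cover \<open>v\<close>.\<close>

lemma ex_pullback:
  assumes "y \<in> Hom C a c" "g \<in> Hom C b c"
  obtains P u v where "u \<in> Hom C P a" "v \<in> Hom C P b" "y \<cdot> u = g \<cdot> v" "is_epi C y \<Longrightarrow> is_epi C v"
proof -
  have "a \<in> Ob C" "b \<in> Ob C" using Hom_Ob assms by blast+
  then obtain d i\<^sub>1 i\<^sub>2 p\<^sub>1 p\<^sub>2 where bp: "is_biproduct C a b d i\<^sub>1 i\<^sub>2 p\<^sub>1 p\<^sub>2" using ex_biproduct by blast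
  note [simp] = biproduct_simps[OF bp]
  obtain n where n: "is_kernel C (sub (y \<cdot> p\<^sub>1) (g \<cdot> p\<^sub>2)) n"
    using ex_kernel[of "sub (y \<cdot> p\<^sub>1) (g \<cdot> p\<^sub>2)"] assms by auto
  note [simp] = kernel_is_pullback(1,2)[OF bp assms n]
  show ?thesis
    by (rule that[of "p\<^sub>1 \<cdot> n" "Dom C n" "p\<^sub>2 \<cdot> n"])
      (use kernel_is_pullback(3)[OF bp assms n] pullback_epi[OF bp assms n] in simp_all)
qed

text \<open>The image is the kernel of the cokernel. If \<open>v\<close> kills \<open>e\<close>,
  then \<open>f\<close> already factors through the part of the image where \<open>v\<close>
  vanishes; that part turns out to be the whole image, so \<open>v\<close> is zero.\<close>

lemma epi_mono_factorization:
  assumes f: "f \<in> Ar C" and q: "is_cokernel C f q" and m: "is_kernel C q m"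
  obtains e where "e \<in> Hom C (Dom C f) (Dom C m)" "m \<cdot> e = f" "is_epi C e"
proof -
  note [simp] = is_cokernel_Hom[OF q] is_kernel_Hom[OF m] f
  obtain e where e: "e \<in> Hom C (Dom C f) (Dom C m)" "m \<cdot> e = f"
    by (rule is_kernel_lift[OF m, of f]) simp_all
  have [simp]: "e \<in> Ar C" "Dom C e = Dom C f" "Cod C e = Dom C m" using e by simp_all
  have "is_epi C e" unfolding is_epi_iff_Zero
  proof (intro conjI ballI impI)
    fix v assume v: "v \<in> Ar C" "Dom C v = Cod C e" "v \<cdot> e = Zero C (Dom C e) (Cod C v)"
    obtain k where k: "is_kernel C v k" using ex_kernel v by blast
    note [simp] = is_kernel_Hom[OF k]
    obtain w where w: "w \<in> Hom C (Dom C f) (Dom C k)" "k \<cdot> w = e"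
      using is_kernel_lift[OF k, of e] v by auto
    have "is_mono C (m \<cdot> k)" unfolding is_mono_iff_Zero
    proof (intro conjI ballI impI)
      fix g assume g: "g \<in> Ar C" "Cod C g = Dom C (m \<cdot> k)"
        "m \<cdot> k \<cdot> g = Zero C (Dom C g) (Cod C (m \<cdot> k))"
      then have "m \<cdot> (k \<cdot> g) = Zero C (Dom C g) (Cod C m)" using v by simp
      moreover have "k \<cdot> g \<in> Ar C \<and> Cod C (k \<cdot> g) = Dom C m \<and> Dom C (k \<cdot> g) = Dom C g"
        using g v by simp
      ultimately have "k \<cdot> g = Zero C (Dom C g) (Dom C m)"
        using is_kernel_mono[OF m] unfolding is_mono_iff_Zero by metis
      then show "g = Zero C (Dom C g) (Dom C (m \<cdot> k))"
        using g v is_kernel_mono[OF k] unfolding is_mono_iff_Zero by simp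
    qed (use v in simp)
    \<comment> \<open>By normality the smaller subobject \<open>m \<cdot> k\<close> is the kernel of
      some \<open>h\<close>. As \<open>h\<close> kills \<open>f\<close>, it factors through
      \<open>q\<close> and kills \<open>m\<close>; thus \<open>m\<close> factors through
      \<open>m \<cdot> k\<close> and \<open>k\<close> splits.\<close>
    then obtain h where h: "is_kernel C h (m \<cdot> k)" using mono_normal by blast
    have [simp]: "h \<in> Ar C" "Dom C h = Cod C f" using is_kernel_Hom(1,3)[OF h] v by simp_all
    have 0: "h \<cdot> (m \<cdot> k) = Zero C (Dom C k) (Cod C h)" using is_kernel_Hom(4)[OF h] v by simp
    have "h \<cdot> f = (h \<cdot> (m \<cdot> k)) \<cdot> w" using e w v by simp
    also have "\<dots> = Zero C (Dom C f) (Cod C h)" using w v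
      by (simp only: 0) simp
    finally obtain r where r: "r \<in> Hom C (Cod C q) (Cod C h)" "r \<cdot> q = h"
      using is_cokernel_desc[OF q, of h] by auto
    have "h \<cdot> m = r \<cdot> (q \<cdot> m)" using r Comp_assoc'[of m q r] by simp
    then have "h \<cdot> m = Zero C (Dom C m) (Cod C h)" using r by simp
    then obtain s where s: "s \<in> Hom C (Dom C m) (Dom C k)" "m \<cdot> k \<cdot> s = m"
      using is_kernel_lift[OF h, of m] v by auto
    have "k \<cdot> s = Ident C (Dom C m)"
      by (rule is_monoD[OF is_kernel_mono[OF m], where a = "Dom C m"]) (use s v in simp_all)
    then have "v = (v \<cdot> k) \<cdot> s" using s v by (simp del: is_kernel_Hom(4)[OF k])
    then show "v = Zero C (Cod C e) (Cod C v)" using s v by simp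
  qed simp
  then show ?thesis using that e by blast
qed

text \<open>Exactness expressed by covers: \<open>x\<close> lands in the image of \<open>g\<close>,
  and pulling it back along the epimorphism onto that image gives the lift \<open>w\<close>.\<close>

lemma exact_at_cokernel:
  assumes q: "is_cokernel C g q" and x: "x \<in> Ar C" "Cod C x = Cod C g"
    and 0: "q \<cdot> x = Zero C (Dom C x) (Cod C q)"
  obtains P e w where "e \<in> Hom C P (Dom C x)" "is_epi C e" "w \<in> Hom C P (Dom C g)" "x \<cdot> e = g \<cdot> w"
proof -
  note [simp] = is_cokernel_Hom[OF q] x
  obtain m where m: "is_kernel C q m" using ex_kernel by force
  note [simp] = is_kernel_Hom[OF m]
  obtain e0 where e0: "e0 \<in> Hom C (Dom C g) (Dom C m)" "m \<cdot> e0 = g" "is_epi C e0"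
    using epi_mono_factorization[OF _ q m] by auto
  obtain x' where x': "x' \<in> Hom C (Dom C x) (Dom C m)" "m \<cdot> x' = x"
    using is_kernel_lift[OF m, of x] 0 by auto
  obtain P w e where we: "w \<in> Hom C P (Dom C g)" "e \<in> Hom C P (Dom C x)" "e0 \<cdot> w = x' \<cdot> e"
      "is_epi C e0 \<Longrightarrow> is_epi C e"
    using ex_pullback[OF e0(1) x'(1)] by metis
  have "x \<cdot> e = m \<cdot> (x' \<cdot> e)" using we x' Comp_assoc'[of e x' m] by simp
  also have "\<dots> = g \<cdot> w" using we e0 Comp_assoc'[of w e0 m] by simp
  finally show ?thesis using that[of e P w] we e0(3) by simp
qed

end

subsection \<open>Small sets and coproducts\<close>

lemma small_image: "small \<kappa> S \<Longrightarrow> small \<kappa> (f ` S)"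
  unfolding small_def by (rule ordLeq_ordLess_trans[OF card_of_image])

text \<open>\<open>Sum\<close> and \<open>cocomplete\<close> only speak of index sets in the type of
  \<open>\<kappa>\<close>; this injection moves any small set there.\<close>

lemma small_inj:
  assumes "regular_cardinal \<kappa>" "small \<kappa> S"
  obtains f where "inj_on f S" "f ` S \<subseteq> Field \<kappa>"
proof -
  have "(card_of S, card_of (Field \<kappa>)) \<in> ordLeq"
    using assms unfolding regular_cardinal_def small_def
    by (meson card_of_Field_ordIso ordIso_symmetric ordLess_imp_ordLeq ordLeq_ordIso_trans)
  then show ?thesis using that by (auto simp: card_of_ordLeq[symmetric])
qed

text \<open>Regularity of \<open>\<kappa>\<close> enters here, in its form
  \<open>stable\<close>.\<close>

lemma small_Sigma:
  assumes "regular_cardinal \<kappa>" "small \<kappa> A" "\<And>a. a \<in> A \<Longrightarrow> small \<kappa> (F a)"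
  shows "small \<kappa> (Sigma A F)"
  using assms regularCard_stable stable_elim[of \<kappa> A F]
  unfolding regular_cardinal_def small_def by blast

lemma small_Plus:
  assumes "regular_cardinal \<kappa>" "small \<kappa> A" "small \<kappa> B"
  shows "small \<kappa> (A <+> B)"
  using assms card_of_Plus_ordLess_infinite_Field[of \<kappa> A B]
  unfolding regular_cardinal_def small_def by blast

lemma small_finite: "\<lbrakk>regular_cardinal \<kappa>; finite S\<rbrakk> \<Longrightarrow> small \<kappa> S"
  unfolding regular_cardinal_def small_def
  by (auto intro!: finite_ordLess_infinite simp: Field_card_of card_of_well_order_on card_order_on_well_order_on)

section \<open>Coproducts: mapping property, reindexing and existence\<close>

context category
begin

lemma coproduct_Hom:
  assumes "is_coproduct C I X c \<iota>"
  shows "c \<in> Ob C" "i \<in> I \<Longrightarrow> \<iota> i \<in> Hom C (X i) c"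
  using assms by (auto simp: is_coproduct_def simp del: Hom_iff)

lemma coproduct_desc:
  assumes "is_coproduct C I X c \<iota>" "d \<in> Ob C" "\<And>i. i \<in> I \<Longrightarrow> g i \<in> Hom C (X i) d"
  obtains h where "h \<in> Hom C c d" "\<And>i. i \<in> I \<Longrightarrow> h \<cdot> \<iota> i = g i"
proof -
  have "\<exists>!h. h \<in> Hom C c d \<and> (\<forall>i\<in>I. h \<cdot> \<iota> i = g i)"
    using assms(1)[unfolded is_coproduct_def, THEN conjunct2, THEN conjunct2, THEN bspec, of d,
      THEN spec, of g] assms(2,3) by blast
  then show ?thesis using that by blast
qed

lemma coproduct_eqI:
  assumes "is_coproduct C I X c \<iota>" "f \<in> Hom C c d" "g \<in> Hom C c d"
    and "\<And>i. i \<in> I \<Longrightarrow> f \<cdot> \<iota> i = g \<cdot> \<iota> i"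
  shows "f = g"
proof -
  have "d \<in> Ob C" using assms(2) by (rule Hom_Ob)
  moreover have "\<forall>i\<in>I. g \<cdot> \<iota> i \<in> Hom C (X i) d"
    using Comp_closed[OF coproduct_Hom(2)[OF assms(1)] assms(3)] by blast
  ultimately have "\<exists>!h. h \<in> Hom C c d \<and> (\<forall>i\<in>I. h \<cdot> \<iota> i = g \<cdot> \<iota> i)"
    using assms(1)[unfolded is_coproduct_def, THEN conjunct2, THEN conjunct2, THEN bspec, of d,
      THEN spec, of "\<lambda>i. g \<cdot> \<iota> i"] by blast
  then show ?thesis using assms by blast
qed

lemma is_coproductI:
  assumes "c \<in> Ob C" "\<And>i. i \<in> I \<Longrightarrow> \<iota> i \<in> Hom C (X i) c"
    and "\<And>d g. \<lbrakk>d \<in> Ob C; \<And>i. i \<in> I \<Longrightarrow> g i \<in> Hom C (X i) d\<rbrakk>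
      \<Longrightarrow> \<exists>h. h \<in> Hom C c d \<and> (\<forall>i \<in> I. h \<cdot> \<iota> i = g i)"
    and "\<And>d f g. \<lbrakk>f \<in> Hom C c d; g \<in> Hom C c d; \<And>i. i \<in> I \<Longrightarrow> f \<cdot> \<iota> i = g \<cdot> \<iota> i\<rbrakk> \<Longrightarrow> f = g"
  shows "is_coproduct C I X c \<iota>"
  unfolding is_coproduct_def
proof (intro conjI ballI allI impI)
  fix d g assume d: "d \<in> Ob C" and g: "\<forall>i\<in>I. g i \<in> Hom C (X i) d"
  obtain h where h: "h \<in> Hom C c d" "\<forall>i \<in> I. h \<cdot> \<iota> i = g i"
    using assms(3)[of d g] d g by blast
  show "\<exists>!h. h \<in> Hom C c d \<and> (\<forall>i\<in>I. h \<cdot> \<iota> i = g i)"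
  proof (rule ex1I[of _ h])
    fix k assume k: "k \<in> Hom C c d \<and> (\<forall>i\<in>I. k \<cdot> \<iota> i = g i)"
    show "k = h" by (rule assms(4)[of _ d]) (use h k in \<open>auto simp del: Hom_iff\<close>)
  qed (use h in blast)
qed (use assms in blast)+

lemma coproduct_reindex:
  assumes "is_coproduct C I X c \<iota>" "bij_betw \<phi> J I"
  shows "is_coproduct C J (\<lambda>j. X (\<phi> j)) c (\<lambda>j. \<iota> (\<phi> j))"
proof (rule is_coproductI)
  have J: "\<phi> j \<in> I" if "j \<in> J" for j using assms(2) that by (auto simp: bij_betw_def)
  show "c \<in> Ob C" using coproduct_Hom[OF assms(1)] by blast
  show "\<iota> (\<phi> j) \<in> Hom C (X (\<phi> j)) c" if "j \<in> J" for j
    using coproduct_Hom[OF assms(1)] J that by blast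
  have inv: "inv_into J \<phi> i \<in> J \<and> \<phi> (inv_into J \<phi> i) = i" if "i \<in> I" for i
    using assms(2) that by (metis bij_betw_imp_surj_on f_inv_into_f inv_into_into)
  have inv': "inv_into J \<phi> (\<phi> j) = j" if "j \<in> J" for j
    using assms(2) that by (simp add: bij_betw_inv_into_left)
  {
    fix d g assume "d \<in> Ob C" and g: "\<And>j. j \<in> J \<Longrightarrow> g j \<in> Hom C (X (\<phi> j)) d"
    then obtain h where h: "h \<in> Hom C c d" "\<And>i. i \<in> I \<Longrightarrow> h \<cdot> \<iota> i = g (inv_into J \<phi> i)"
      using coproduct_desc[OF assms(1), of d "\<lambda>i. g (inv_into J \<phi> i)"] inv by metis
    then show "\<exists>h. h \<in> Hom C c d \<and> (\<forall>j \<in> J. h \<cdot> \<iota> (\<phi> j) = g j)"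
      using J inv' by metis
  }
  {
    fix d f g assume "f \<in> Hom C c d" "g \<in> Hom C c d" and e: "\<And>j. j \<in> J \<Longrightarrow> f \<cdot> \<iota> (\<phi> j) = g \<cdot> \<iota> (\<phi> j)"
    then show "f = g" using coproduct_eqI[OF assms(1)] inv by metis
  }
qed

lemma ex_coproduct:
  fixes \<kappa> :: "'i rel" and I :: "'j set"
  assumes "regular_cardinal \<kappa>" "cocomplete \<kappa> C" "small \<kappa> I" and X: "\<And>i. i \<in> I \<Longrightarrow> X i \<in> Ob C"
  obtains c \<iota> where "is_coproduct C I X c \<iota>"
proof -
  obtain f :: "'j \<Rightarrow> 'i" where f: "inj_on f I" using small_inj[OF assms(1,3)] by metis
  define g where "g = inv_into I f"
  have g: "g j \<in> I" if "j \<in> f ` I" for j using that by (simp add: g_def inv_into_into)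
  \<comment> \<open>The discrete category on the image of \<open>I\<close>, each object serving as
    its own identity arrow. Composable arrows are equal, so returning the first argument is the
    right composition.\<close>
  define J :: "('i, 'i) precategory" where
    "J = \<lparr>Ob = f ` I, Ar = f ` I, Dom = id, Cod = id, Ident = id, Comp = (\<lambda>a b. a)\<rparr>"
  have J [simp]: "Ob J = f ` I" "Ar J = f ` I" "Dom J j = j" "Cod J j = j" "Ident J j = j"
    "Comp J i j = i" for i j by (simp_all add: J_def)
  have "category J" by unfold_locales (auto simp: Hom_def)
  moreover have "is_functor J C (\<lambda>j. X (g j)) (\<lambda>j. Ident C (X (g j)))"
    unfolding is_functor_def using X g by (auto simp: Hom_def[of J])
  ultimately obtain c \<iota> where c: "is_colimit J C (\<lambda>j. X (g j)) (\<lambda>j. Ident C (X (g j))) c \<iota>"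
    using assms(2) small_image[OF assms(3), of f] unfolding cocomplete_def by force
  \<comment> \<open>The commutation condition only concerns identities, so cocones are plain
    families and a colimit is a coproduct.\<close>
  have cocone: "is_cocone J C (\<lambda>j. X (g j)) (\<lambda>j. Ident C (X (g j))) d \<gamma> \<longleftrightarrow>
    d \<in> Ob C \<and> (\<forall>j \<in> f ` I. \<gamma> j \<in> Hom C (X (g j)) d)" for d \<gamma>
    unfolding is_cocone_def by auto
  have "is_coproduct C (f ` I) (\<lambda>j. X (g j)) c \<iota>"
    using c unfolding is_colimit_def cocone is_coproduct_def by simp
  moreover have "bij_betw f I (f ` I)" using f by (simp add: bij_betw_def)
  ultimately have "is_coproduct C I (\<lambda>i. X (g (f i))) c (\<lambda>i. \<iota> (f i))"
    by (rule coproduct_reindex)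
  moreover have "g (f i) = i" if "i \<in> I" for i using f that by (simp add: g_def)
  ultimately have "is_coproduct C I X c (\<lambda>i. \<iota> (f i))"
    unfolding is_coproduct_def by (auto simp del: Hom_iff)
  then show ?thesis by (rule that)
qed

end

subsection \<open>Generated and presented objects\<close>

context preadditive_category
begin

lemma epi_cancel_Zero:
  assumes "is_epi C e" "e \<in> Hom C a b" "g \<in> Hom C b c" "g \<cdot> e = Zero C a c"
  shows "g = Zero C b c"
  using assms unfolding is_epi_iff_Zero by auto

lemma mono_cancel_Zero:
  assumes "is_mono C m" "m \<in> Hom C b c" "g \<in> Hom C a b" "m \<cdot> g = Zero C a c"
  shows "g = Zero C a b"
  using assms unfolding is_mono_iff_Zero by auto

end

section \<open>Standing assumptions; sums, canonical morphisms, presentations and traces\<close>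

locale cocomplete_abelian_with_small_set = abelian_category C
  for C :: "('o, 'm, 'z) preadditive_data_scheme" (structure) +
  fixes \<kappa> :: "'i rel" and \<U> :: "'o set"
  assumes regular: "regular_cardinal \<kappa>"
    and cocomplete: "cocomplete \<kappa> C"
    and \<U>_Ob: "\<U> \<subseteq> Ob C"
    and small_\<U>: "small \<kappa> \<U>"
    and small_Hom: "\<lbrakk>U \<in> \<U>; X \<in> Ob C\<rbrakk> \<Longrightarrow> small \<kappa> (Hom C U X)"
begin

abbreviation "SumU \<equiv> Sum \<kappa> C \<U>"
abbreviation "GenU \<equiv> Gen \<kappa> C \<U>"
abbreviation "PresU \<equiv> Pres \<kappa> C \<U>"

lemma Sum_Ob: "s \<in> SumU \<Longrightarrow> s \<in> Ob C"
  by (simp add: Sum_def)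

lemma Pres_Ob: "s \<in> PresU \<Longrightarrow> s \<in> Ob C"
  by (simp add: Pres_def)

text \<open>Allows index sets of any type, as the disjoint unions and sets of pairs below require;
  they are reindexed into the type of \<open>\<kappa>\<close>.\<close>

lemma SumI:
  assumes "small \<kappa> I" "\<And>i. i \<in> I \<Longrightarrow> X i \<in> \<U>" "is_coproduct C I X c \<iota>"
  shows "c \<in> SumU"
proof -
  obtain f where f: "inj_on f I" "f ` I \<subseteq> Field \<kappa>" using small_inj[OF regular assms(1)] by blast
  then have b: "bij_betw (inv_into I f) (f ` I) I" by (simp add: bij_betw_inv_into inj_on_imp_bij_betw)
  have "is_coproduct C (f ` I) (\<lambda>j. X (inv_into I f j)) c (\<lambda>j. \<iota> (inv_into I f j))"
    by (rule coproduct_reindex[OF assms(3) b])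
  moreover have "small \<kappa> (f ` I)" using assms(1) by (rule small_image)
  moreover have "\<forall>j \<in> f ` I. X (inv_into I f j) \<in> \<U>" using assms(2) by (simp add: inv_into_into)
  moreover have "c \<in> Ob C" using coproduct_Hom[OF assms(3)] by blast
  ultimately show ?thesis unfolding Sum_def mem_Collect_eq
    by (intro conjI exI[of _ "f ` I"] exI[of _ "\<lambda>j. X (inv_into I f j)"]
      exI[of _ "\<lambda>j. \<iota> (inv_into I f j)"])
qed

lemma SumE:
  assumes "s \<in> SumU"
  obtains I :: "'i set" and X \<iota> where "small \<kappa> I" "\<forall>i \<in> I. X i \<in> \<U>" "is_coproduct C I X s \<iota>"
  using assms unfolding Sum_def by blast

text \<open>The zero object is the empty coproduct, so the \<open>undefined\<close> families are
  never evaluated at an index.\<close>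

lemma zero_object_Sum: "is_zero_object C z \<Longrightarrow> z \<in> SumU"
  by (rule SumI[of "{} :: 'i set" undefined z undefined])
    (auto simp: small_finite[OF regular] is_coproduct_def is_zero_object_def simp del: Hom_iff)

lemma \<U>_Sum: "U \<in> \<U> \<Longrightarrow> U \<in> SumU"
proof (rule SumI[of "{()}" "\<lambda>_. U" U "\<lambda>_. Ident C U"])
  assume "U \<in> \<U>"
  then have [simp]: "U \<in> Ob C" using \<U>_Ob by blast
  show "is_coproduct C {()} (\<lambda>_. U) U (\<lambda>_. Ident C U)"
    by (rule is_coproductI) auto
qed (simp_all add: small_finite[OF regular])

lemma biproduct_Sum:
  assumes "a \<in> SumU" "b \<in> SumU" and bp: "is_biproduct C a b c i\<^sub>1 i\<^sub>2 p\<^sub>1 p\<^sub>2"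
  shows "c \<in> SumU"
proof -
  obtain I :: "'i set" and X \<iota> where I: "small \<kappa> I" "\<forall>i \<in> I. X i \<in> \<U>" "is_coproduct C I X a \<iota>"
    by (rule SumE[OF assms(1)])
  obtain J :: "'i set" and Y \<eta> where J: "small \<kappa> J" "\<forall>i \<in> J. Y i \<in> \<U>" "is_coproduct C J Y b \<eta>"
    by (rule SumE[OF assms(2)])
  let ?X = "case_sum X Y" and ?\<iota> = "case_sum (\<lambda>i. i\<^sub>1 \<cdot> \<iota> i) (\<lambda>j. i\<^sub>2 \<cdot> \<eta> j)"
  note bs = biproduct_simps[OF bp]
  have i1: "i\<^sub>1 \<in> Hom C a c" and i2: "i\<^sub>2 \<in> Hom C b c" using bs by simp_all
  show ?thesis
  proof (rule SumI[of "I <+> J" ?X c ?\<iota>])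
    show "small \<kappa> (I <+> J)" by (rule small_Plus[OF regular I(1) J(1)])
    show "?X i \<in> \<U>" if "i \<in> I <+> J" for i using that I(2) J(2) by auto
    show "is_coproduct C (I <+> J) ?X c ?\<iota>"
    proof (rule is_coproductI)
      show "c \<in> Ob C" using i1 by (rule Hom_Ob)
      show "?\<iota> i \<in> Hom C (?X i) c" if "i \<in> I <+> J" for i
        using that Comp_closed[OF coproduct_Hom(2)[OF I(3)] i1] Comp_closed[OF coproduct_Hom(2)[OF J(3)] i2]
        by (auto simp del: Hom_iff)
    next
      fix d g assume d: "d \<in> Ob C" and g: "\<And>i. i \<in> I <+> J \<Longrightarrow> g i \<in> Hom C (?X i) d"
      obtain u where u: "u \<in> Hom C a d" "\<And>i. i \<in> I \<Longrightarrow> u \<cdot> \<iota> i = g (Inl i)"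
        using coproduct_desc[OF I(3) d, of "\<lambda>i. g (Inl i)"] g[OF InlI] by auto
      obtain v where v: "v \<in> Hom C b d" "\<And>i. i \<in> J \<Longrightarrow> v \<cdot> \<eta> i = g (Inr i)"
        using coproduct_desc[OF J(3) d, of "\<lambda>i. g (Inr i)"] g[OF InrI] by auto
      obtain h where h: "h \<in> Hom C c d" "h \<cdot> i\<^sub>1 = u" "h \<cdot> i\<^sub>2 = v"
        by (rule biproduct_desc[OF bp u(1) v(1)])
      have "h \<cdot> (i\<^sub>1 \<cdot> \<iota> i) = g (Inl i)" if "i \<in> I" for i
        using Comp_assoc[OF coproduct_Hom(2)[OF I(3) that] i1 h(1)] h(2) u(2) that by simp
      moreover have "h \<cdot> (i\<^sub>2 \<cdot> \<eta> i) = g (Inr i)" if "i \<in> J" for i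
        using Comp_assoc[OF coproduct_Hom(2)[OF J(3) that] i2 h(1)] h(3) v(2) that by simp
      ultimately show "\<exists>h. h \<in> Hom C c d \<and> (\<forall>i\<in>I <+> J. h \<cdot> ?\<iota> i = g i)"
        using h(1) by (intro exI[of _ h]) (auto simp del: Hom_iff)
    next
      fix d f g assume f: "f \<in> Hom C c d" and g: "g \<in> Hom C c d"
        and e: "\<And>i. i \<in> I <+> J \<Longrightarrow> f \<cdot> ?\<iota> i = g \<cdot> ?\<iota> i"
      have "f \<cdot> i\<^sub>1 = g \<cdot> i\<^sub>1"
        by (rule coproduct_eqI[OF I(3) Comp_closed[OF i1 f] Comp_closed[OF i1 g]])
          (use e[OF InlI] Comp_assoc[OF coproduct_Hom(2)[OF I(3)] i1] f g in \<open>simp del: Hom_iff\<close>)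
      moreover have "f \<cdot> i\<^sub>2 = g \<cdot> i\<^sub>2"
        by (rule coproduct_eqI[OF J(3) Comp_closed[OF i2 f] Comp_closed[OF i2 g]])
          (use e[OF InrI] Comp_assoc[OF coproduct_Hom(2)[OF J(3)] i2] f g in \<open>simp del: Hom_iff\<close>)
      ultimately show "f = g" using biproduct_eqI[OF bp f g] by blast
    qed
  qed
qed

text \<open>The coproduct injections are themselves morphisms from members of
  \<open>\<U>\<close>.\<close>

lemma Sum_Zero:
  assumes "s \<in> SumU" "f \<in> Hom C s d"
    and 0: "\<And>U \<alpha>. \<lbrakk>U \<in> \<U>; \<alpha> \<in> Hom C U s\<rbrakk> \<Longrightarrow> f \<cdot> \<alpha> = Zero C U d"
  shows "f = Zero C s d"
proof -
  obtain I :: "'i set" and X \<iota> where I: "small \<kappa> I" "\<forall>i \<in> I. X i \<in> \<U>" "is_coproduct C I X s \<iota>"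
    by (rule SumE[OF assms(1)])
  have [simp]: "s \<in> Ob C" "d \<in> Ob C" using Hom_Ob assms(2) by blast+
  show ?thesis
  proof (rule coproduct_eqI[OF I(3) assms(2)])
    show "Zero C s d \<in> Hom C s d" by simp
    fix i assume i: "i \<in> I"
    then have \<iota>: "\<iota> i \<in> Hom C (X i) s" using coproduct_Hom(2)[OF I(3)] by blast
    show "f \<cdot> \<iota> i = Zero C s d \<cdot> \<iota> i" using 0[OF bspec[OF I(2) i] \<iota>] \<iota> by simp
  qed
qed

text \<open>The set of pairs indexing the coproduct is small, because \<open>\<U>\<close> and the
  hom-sets out of its members are.\<close>

lemma ex_canonical:
  assumes "a \<in> Ob C"
  obtains \<epsilon> where "is_canonical_morphism C \<U> a \<epsilon>"
proof -
  let ?I = "SIGMA U:\<U>. Hom C U a"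
  have "small \<kappa> ?I" by (rule small_Sigma[OF regular small_\<U> small_Hom[OF _ assms]])
  then obtain c \<iota> where c: "is_coproduct C ?I fst c \<iota>"
    by (rule ex_coproduct[OF regular cocomplete, of _ fst]) (use \<U>_Ob in auto)
  obtain h where h: "h \<in> Hom C c a" "\<And>i. i \<in> ?I \<Longrightarrow> h \<cdot> \<iota> i = snd i"
    by (rule coproduct_desc[OF c assms, of snd]) auto
  have "is_canonical_morphism C \<U> a h"
    unfolding is_canonical_morphism_def using h c by auto
  then show ?thesis by (rule that)
qed

lemma canonical_Hom:
  assumes "is_canonical_morphism C \<U> a \<epsilon>"
  shows "\<epsilon> \<in> Ar C" "Cod C \<epsilon> = a" "Dom C \<epsilon> \<in> SumU"
proof -
  show "\<epsilon> \<in> Ar C" "Cod C \<epsilon> = a" using assms unfolding is_canonical_morphism_def by simp_all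
  then have a: "a \<in> Ob C" by auto
  obtain \<iota> where "is_coproduct C (SIGMA U:\<U>. Hom C U a) fst (Dom C \<epsilon>) \<iota>"
    using assms unfolding is_canonical_morphism_def by blast
  then show "Dom C \<epsilon> \<in> SumU"
    by (rule SumI[rotated -1]) (auto intro!: small_Sigma[OF regular small_\<U> small_Hom[OF _ a]])
qed

text \<open>The restriction of \<open>g\<close> to a summand \<open>X i\<close> is a morphism from a
  member of \<open>\<U>\<close> to \<open>a\<close>, hence determines an index of the coproduct
  \<open>Dom C \<epsilon>\<close>. The lift \<open>u\<close> sends \<open>X i\<close> to the summand
  with that index.\<close>

lemma canonical_lift:
  assumes can: "is_canonical_morphism C \<U> a \<epsilon>" and s: "s \<in> SumU" and g: "g \<in> Hom C s a"
  obtains u where "u \<in> Hom C s (Dom C \<epsilon>)" "\<epsilon> \<cdot> u = g"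
proof -
  note [simp] = canonical_Hom[OF can]
  obtain \<eta> where \<eta>: "is_coproduct C (SIGMA U:\<U>. Hom C U a) fst (Dom C \<epsilon>) \<eta>"
    "\<And>U \<alpha>. U \<in> \<U> \<Longrightarrow> \<alpha> \<in> Hom C U a \<Longrightarrow> \<epsilon> \<cdot> \<eta> (U, \<alpha>) = \<alpha>"
    using can unfolding is_canonical_morphism_def by blast
  obtain I :: "'i set" and X \<iota> where I: "small \<kappa> I" "\<forall>i \<in> I. X i \<in> \<U>" "is_coproduct C I X s \<iota>"
    by (rule SumE[OF s])
  have g\<iota>: "g \<cdot> \<iota> i \<in> Hom C (X i) a" if "i \<in> I" for i
    using Comp_closed[OF coproduct_Hom(2)[OF I(3)] g] that by blast
  have \<eta>': "\<eta> (X i, g \<cdot> \<iota> i) \<in> Hom C (X i) (Dom C \<epsilon>)" if "i \<in> I" for i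
    using coproduct_Hom(2)[OF \<eta>(1), of "(X i, g \<cdot> \<iota> i)"] g\<iota>[OF that] bspec[OF I(2) that] by simp
  obtain u where u: "u \<in> Hom C s (Dom C \<epsilon>)" "\<And>i. i \<in> I \<Longrightarrow> u \<cdot> \<iota> i = \<eta> (X i, g \<cdot> \<iota> i)"
    by (rule coproduct_desc[OF I(3), of "Dom C \<epsilon>" "\<lambda>i. \<eta> (X i, g \<cdot> \<iota> i)"]) (use \<eta>' in auto)
  have \<epsilon>: "\<epsilon> \<in> Hom C (Dom C \<epsilon>) a" by simp
  have "\<epsilon> \<cdot> u = g"
  proof (rule coproduct_eqI[OF I(3) Comp_closed[OF u(1) \<epsilon>] g])
    fix i assume i: "i \<in> I"
    show "(\<epsilon> \<cdot> u) \<cdot> \<iota> i = g \<cdot> \<iota> i"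
      using Comp_assoc[OF coproduct_Hom(2)[OF I(3) i] u(1) \<epsilon>] u(2)[OF i] \<eta>(2)[OF bspec[OF I(2) i] g\<iota>[OF i]]
      by (simp del: Hom_iff)
  qed
  then show ?thesis using that u(1) by blast
qed

lemma Gen_quotient:
  assumes "a \<in> GenU" "p \<in> Hom C a b" "is_epi C p"
  shows "b \<in> GenU"
proof -
  obtain s e where e: "s \<in> SumU" "e \<in> Hom C s a" "is_epi C e" using assms(1) unfolding Gen_def by blast
  have "is_epi C (p \<cdot> e)" using e assms by (intro is_epi_Comp) simp_all
  moreover have "p \<cdot> e \<in> Hom C s b" using e assms by simp
  moreover have "b \<in> Ob C" using assms(2) by (rule Hom_Ob)
  ultimately show ?thesis using e unfolding Gen_def by blast
qed

lemma Sum_Gen: "s \<in> SumU \<Longrightarrow> s \<in> GenU"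
  using Sum_Ob Ident_closed is_epi_Ident unfolding Gen_def by blast

text \<open>The isomorphism in the definition of \<open>Pres\<close> is absorbed into the cokernel
  map, so the presentation ends in \<open>a\<close> itself.\<close>

lemma PresE:
  assumes "a \<in> PresU"
  obtains s t f p where "s \<in> SumU" "t \<in> SumU" "f \<in> Hom C s t" "p \<in> Hom C t a" "is_cokernel C f p"
proof -
  obtain s t f q where st: "s \<in> SumU" "t \<in> SumU" "f \<in> Hom C s t" "is_cokernel C f q"
    "isomorphic_objects C (Cod C q) a"
    using assms unfolding Pres_def by blast
  then obtain u v where uv: "u \<in> Hom C (Cod C q) a" "v \<in> Hom C a (Cod C q)"
    "v \<cdot> u = Ident C (Cod C q)" "u \<cdot> v = Ident C a"
    unfolding isomorphic_objects_def by blast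
  note [simp] = is_cokernel_Hom[OF st(4)]
  have [simp]: "a \<in> Ob C" using uv(1) by (rule Hom_Ob)
  have [simp]: "Dom C f = s" "Cod C f = t" using st by simp_all
  have q: "q \<in> Hom C t (Cod C q)" by simp
  have [simp]: "s \<in> Ob C" "t \<in> Ob C" using st Sum_Ob by blast+
  have uq: "is_epi C (u \<cdot> q)"
  proof (rule is_epi_Comp[OF is_cokernel_epi[OF st(4)]])
    show "is_epi C u" using is_epi_Comp_left[OF _ uv(2,1)] uv(4) is_epi_Ident by simp
  qed (use uv in simp)
  have "is_cokernel C f (u \<cdot> q)"
  proof (rule is_cokernelI[OF st(3)])
    show "u \<cdot> q \<in> Hom C t a" "u \<cdot> q \<cdot> f = Zero C s a" using uv by simp_all
    fix g assume g: "g \<in> Ar C" "Dom C g = t" "g \<cdot> f = Zero C s (Cod C g)"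
    then obtain h where h: "h \<in> Hom C (Cod C q) (Cod C g)" "h \<cdot> q = g"
      using is_cokernel_desc[OF st(4), of g] by auto
    have "(h \<cdot> v) \<cdot> (u \<cdot> q) = g"
      using h uv Comp_reduce[OF uv(3), of q] by simp
    then show "\<exists>h. h \<in> Hom C a (Cod C g) \<and> h \<cdot> (u \<cdot> q) = g"
      using h uv by (intro exI[of _ "h \<cdot> v"]) simp
  qed (rule uq)
  then show ?thesis using that[OF st(1-3), of "u \<cdot> q"] uv by simp
qed

lemma Pres_Gen: "a \<in> PresU \<Longrightarrow> a \<in> GenU"
  by (erule PresE) (meson Gen_quotient Sum_Gen is_cokernel_epi)

lemma cokernel_Sum_Pres:
  assumes "s \<in> SumU" "t \<in> SumU" "f \<in> Hom C s t" "is_cokernel C f p"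
  shows "Cod C p \<in> PresU"
proof -
  have "Cod C p \<in> Ob C" using is_cokernel_Hom[OF assms(4)] by simp
  then have "isomorphic_objects C (Cod C p) (Cod C p)"
    unfolding isomorphic_objects_def by (intro conjI bexI[of _ "Ident C (Cod C p)"]) simp_all
  then show ?thesis unfolding Pres_def using assms \<open>Cod C p \<in> Ob C\<close> by blast
qed

text \<open>A sum is presented without relations: its identity is the cokernel of the morphism from
  a zero object.\<close>

lemma Sum_Pres:
  assumes "s \<in> SumU"
  shows "s \<in> PresU"
proof -
  obtain z where z: "is_zero_object C z" using ex_zero_object by blast
  have [simp]: "z \<in> Ob C" "s \<in> Ob C" using z assms Sum_Ob by (auto simp: is_zero_object_def)
  have "is_cokernel C (Zero C z s) (Ident C s)"
    by (rule is_cokernelI) (auto simp: is_epi_Ident)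
  then show ?thesis using cokernel_Sum_Pres[OF zero_object_Sum[OF z] assms, of "Zero C z s"] by force
qed

text \<open>The epimorphism \<open>p\<close> is the cokernel of its kernel, and precomposing that
  kernel with a cover by a sum does not change the cokernel.\<close>

lemma PresI:
  assumes t: "t \<in> SumU" and p: "p \<in> Hom C t b" "is_epi C p" and k: "is_kernel C p k" "Dom C k \<in> GenU"
  shows "b \<in> PresU"
proof -
  obtain s e where e: "s \<in> SumU" "e \<in> Hom C s (Dom C k)" "is_epi C e" using k unfolding Gen_def by blast
  obtain k' where "is_kernel C p k'" "is_cokernel C k' p" by (rule epi_ex_kernel[OF p(2)])
  then have pk: "is_cokernel C k p" using epi_is_cokernel_of_kernel k(1) by blast
  note [simp] = is_cokernel_Hom[OF pk]
  have [simp]: "Dom C p = t" "Cod C p = b" "Cod C k = t" "b \<in> Ob C"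
    using is_kernel_Hom(3)[OF k(1)] p(1) Cod_Ob[of p] by auto
  have "is_cokernel C (k \<cdot> e) p"
  proof (rule is_cokernelI)
    show "k \<cdot> e \<in> Hom C s t" using e by simp
    show "p \<cdot> (k \<cdot> e) = Zero C s b" using e Comp_reduce[OF is_cokernel_Hom(4)[OF pk], of e] by simp
    fix g assume g: "g \<in> Ar C" "Dom C g = t" "g \<cdot> (k \<cdot> e) = Zero C s (Cod C g)"
    then have "(g \<cdot> k) \<cdot> e = Zero C s (Cod C g)" using e by simp
    then have "g \<cdot> k = Zero C (Dom C k) (Cod C g)"
      by (rule epi_cancel_Zero[OF e(3,2), rotated]) (use g in simp)
    then show "\<exists>h. h \<in> Hom C b (Cod C g) \<and> h \<cdot> p = g"
      using is_cokernel_desc[OF pk, of g] g by auto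
  qed (use p in simp_all)
  then show ?thesis using cokernel_Sum_Pres[OF e(1) t, of "k \<cdot> e" p] e by simp
qed

text \<open>\<open>is_trace\<close> only speaks of subobjects. The image of \<open>g\<close> is a
  generated one, being a quotient of \<open>a\<close>.\<close>

lemma trace_lift:
  assumes t: "is_trace \<kappa> C \<U> K t" and g: "g \<in> Hom C a K" "a \<in> GenU"
  obtains h where "h \<in> Hom C a (Dom C t)" "t \<cdot> h = g"
proof -
  have [simp]: "g \<in> Ar C" "Dom C g = a" "Cod C g = K" using g by simp_all
  have [simp]: "t \<in> Ar C" "Cod C t = K" using t by (simp_all add: is_trace_def is_mono_Ar)
  obtain q where q: "is_cokernel C g q" using ex_cokernel by force
  note [simp] = is_cokernel_Hom[OF q]
  obtain m where m: "is_kernel C q m" using ex_kernel by force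
  note [simp] = is_kernel_Hom[OF m]
  obtain e where e: "e \<in> Hom C (Dom C g) (Dom C m)" "m \<cdot> e = g" "is_epi C e"
    by (rule epi_mono_factorization[OF _ q m]) simp_all
  have "Dom C m \<in> GenU" using Gen_quotient[of a e "Dom C m"] e g by simp
  moreover have "Cod C m = K" by simp
  ultimately obtain h where h: "h \<in> Hom C (Dom C m) (Dom C t)" "t \<cdot> h = m"
    using t is_kernel_mono[OF m] unfolding is_trace_def by blast
  have "t \<cdot> (h \<cdot> e) = g" using Comp_reduce[OF h(2), of e] h e by simp
  then show ?thesis using that[of "h \<cdot> e"] h e by simp
qed

text \<open>The trace is the image of the canonical morphism \<open>\<epsilon>\<close>. A generated
  subobject has a cover by a sum, whose map to \<open>K\<close> lifts along
  \<open>\<epsilon>\<close>; so the cokernel of \<open>\<epsilon>\<close> kills the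
  subobject.\<close>

lemma ex_trace:
  assumes "K \<in> Ob C"
  obtains t where "is_trace \<kappa> C \<U> K t"
proof -
  obtain \<epsilon> where \<epsilon>: "is_canonical_morphism C \<U> K \<epsilon>" by (rule ex_canonical[OF assms])
  note [simp] = canonical_Hom[OF \<epsilon>]
  obtain q where q: "is_cokernel C \<epsilon> q" using ex_cokernel by force
  note [simp] = is_cokernel_Hom[OF q]
  obtain m where m: "is_kernel C q m" using ex_kernel by force
  note [simp] = is_kernel_Hom[OF m]
  obtain e where e: "e \<in> Hom C (Dom C \<epsilon>) (Dom C m)" "m \<cdot> e = \<epsilon>" "is_epi C e"
    by (rule epi_mono_factorization[OF _ q m]) simp_all
  have "is_trace \<kappa> C \<U> K m"
    unfolding is_trace_def
  proof (intro conjI allI impI)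
    show "is_mono C m" by (rule is_kernel_mono[OF m])
    show "Cod C m = K" by simp
    show "Dom C m \<in> GenU" using Gen_quotient[OF Sum_Gen e(1,3)] by simp
    fix s assume s: "is_mono C s \<and> Cod C s = K \<and> Dom C s \<in> GenU"
    then have [simp]: "s \<in> Ar C" "Cod C s = K" by (simp_all add: is_mono_Ar)
    obtain c p where p: "c \<in> SumU" "p \<in> Hom C c (Dom C s)" "is_epi C p"
      using s unfolding Gen_def by blast
    have sp: "s \<cdot> p \<in> Hom C c K" using p by simp
    obtain u where u: "u \<in> Hom C c (Dom C \<epsilon>)" "\<epsilon> \<cdot> u = s \<cdot> p" by (rule canonical_lift[OF \<epsilon> p(1) sp])
    have "q \<cdot> (s \<cdot> p) = Zero C c (Cod C q)"
      unfolding u(2)[symmetric] using u(1) Comp_reduce[OF is_cokernel_Hom(4)[OF q], of u] by simp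
    then have "(q \<cdot> s) \<cdot> p = Zero C c (Cod C q)" using p by simp
    then have "q \<cdot> s = Zero C (Dom C s) (Cod C q)"
      by (rule epi_cancel_Zero[OF p(3,2), rotated]) simp
    then obtain h where "h \<in> Hom C (Dom C s) (Dom C m)" "m \<cdot> h = s"
      using is_kernel_lift[OF m, of s] by auto
    then show "\<exists>h\<in>Hom C (Dom C s) (Dom C m). m \<cdot> h = s" by blast
  qed
  then show ?thesis by (rule that)
qed

end

subsection \<open>Condition (b) implies condition (c)\<close>

context abelian_category
begin

text \<open>If \<open>m\<close> kills \<open>g\<close>, lift \<open>g\<close> along \<open>q\<close>
  to \<open>y\<close> on a cover. Then \<open>k \<cdot> y\<close> comes from \<open>T\<close> on a
  further cover; as \<open>k\<close> is mono, so does \<open>y\<close>, and \<open>g\<close>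
  vanishes.\<close>

lemma quotient_map_mono:
  assumes k: "is_mono C k" "k \<in> Hom C K S" and t: "t \<in> Hom C T K"
    and q: "is_cokernel C t q" and e: "is_cokernel C (k \<cdot> t) e"
    and m: "m \<in> Hom C (Cod C q) (Cod C e)" "m \<cdot> q = e \<cdot> k"
  shows "is_mono C m"
  unfolding is_mono_iff_Zero
proof (intro conjI ballI impI)
  note [simp] = k(2)[unfolded Hom_iff] t[unfolded Hom_iff] m(1)[unfolded Hom_iff] is_cokernel_Hom(1,2)[OF q] is_cokernel_Hom(1,2)[OF e]
  have [simp]: "Dom C q = K" "Dom C e = S" "q \<cdot> t = Zero C T (Cod C q)"
    using is_cokernel_Hom(3)[OF e] is_cokernel_Hom(3,4)[OF q] by simp_all
  fix g assume g: "g \<in> Ar C" "Cod C g = Dom C m" "m \<cdot> g = Zero C (Dom C g) (Cod C m)"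
  have g' [simp]: "g \<in> Ar C" "Cod C g = Cod C q" using g by simp_all
  have "q \<in> Hom C K (Cod C q)" "g \<in> Hom C (Dom C g) (Cod C q)" by simp_all
  then obtain P y a where ya: "y \<in> Hom C P K" "a \<in> Hom C P (Dom C g)" "q \<cdot> y = g \<cdot> a" "is_epi C a"
    using ex_pullback[of q K "Cod C q" g "Dom C g"] is_cokernel_epi[OF q] by metis
  note [simp] = ya(1,2)[unfolded Hom_iff]
  have "e \<cdot> (k \<cdot> y) = m \<cdot> (q \<cdot> y)"
    using Comp_reduce[OF m(2), of y] Comp_assoc'[of y q m] by simp
  also have "\<dots> = Zero C P (Cod C e)"
    using g(3) Comp_reduce[OF g(3), of a] by (simp add: ya)
  finally obtain Q b w where bw: "b \<in> Hom C Q P" "is_epi C b" "w \<in> Hom C Q T"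
      "(k \<cdot> y) \<cdot> b = (k \<cdot> t) \<cdot> w"
    using exact_at_cokernel[OF e, of "k \<cdot> y"] by auto
  note [simp] = bw(1,3)[unfolded Hom_iff]
  have "k \<cdot> (y \<cdot> b) = k \<cdot> (t \<cdot> w)" using bw by simp
  then have yb: "y \<cdot> b = t \<cdot> w" by (rule is_monoD[OF k(1), where a = Q]) simp_all
  have "g \<cdot> (a \<cdot> b) = q \<cdot> (y \<cdot> b)"
    using Comp_reduce[OF ya(3), of b] by simp
  also have "\<dots> = Zero C Q (Cod C q)"
    using Comp_reduce[of q t "Zero C T (Cod C q)" w] by (simp add: yb)
  finally show "g = Zero C (Dom C g) (Dom C m)"
    using epi_cancel_Zero[OF is_epi_Comp[OF bw(2) ya(4)], of Q "Dom C g" g "Cod C q"] by simp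
qed (use m in simp)

end

context cocomplete_abelian_with_small_set
begin

lemma Sum_Hom_Zero:
  assumes "s \<in> SumU" "f \<in> Hom C s d" "\<And>U. U \<in> \<U> \<Longrightarrow> Hom C U d = {Zero C U d}"
  shows "f = Zero C s d"
  by (rule Sum_Zero[OF assms(1,2)]) (use Comp_closed[OF _ assms(2)] assms(3) in blast)

lemma condition_a_imp_b: "condition_a \<kappa> C \<U> \<Longrightarrow> condition_b \<kappa> C \<U>"
  unfolding condition_a_def condition_b_def
  by (metis canonical_Hom(3) is_kernel_Hom(3) is_kernel_mono)

lemma condition_b_imp_c:
  assumes cond: "condition_b \<kappa> C \<U>"
  shows "condition_c \<kappa> C \<U>"
  unfolding condition_c_def
proof (intro ballI allI impI, elim conjE)
  fix b \<epsilon> k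
  assume b: "b \<in> PresU" and \<epsilon>: "is_canonical_morphism C \<U> b \<epsilon>" and k: "is_kernel C \<epsilon> k"
  let ?S = "Dom C \<epsilon>" and ?K = "Dom C k"
  note [simp] = canonical_Hom[OF \<epsilon>] is_kernel_Hom[OF k] Pres_Ob[OF b]
  obtain t where t: "is_trace \<kappa> C \<U> ?K t" by (rule ex_trace[of ?K]) simp
  then have tm: "is_mono C t" and [simp]: "t \<in> Ar C" "Cod C t = ?K" by (simp_all add: is_trace_def is_mono_Ar)
  obtain q where q: "is_cokernel C t q" "is_kernel C q t" by (rule mono_ex_cokernel[OF tm])
  note [simp] = is_cokernel_Hom[OF q(1)]
  let ?X = "Cod C q"
  have X0: "Hom C U ?X = {Zero C U ?X}" if "U \<in> \<U>" for U
    using cond Pres_Ob[OF b] \<epsilon> k t q(1) that unfolding condition_b_def no_maps_mod_trace_def by blast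
  obtain s\<^sub>1 s\<^sub>0 f p where p: "s\<^sub>1 \<in> SumU" "s\<^sub>0 \<in> SumU" "f \<in> Hom C s\<^sub>1 s\<^sub>0" "p \<in> Hom C s\<^sub>0 b" "is_cokernel C f p"
    by (rule PresE[OF b])
  note [simp] = p(3,4)[unfolded Hom_iff] Sum_Ob[OF p(1)] Sum_Ob[OF p(2)]
  have [simp]: "p \<cdot> f = Zero C s\<^sub>1 b" using is_cokernel_Hom(4)[OF p(5)] by simp
  obtain u where u: "u \<in> Hom C s\<^sub>0 ?S" "\<epsilon> \<cdot> u = p" by (rule canonical_lift[OF \<epsilon> p(2,4)])
  note [simp] = u(1)[unfolded Hom_iff]
  have "\<epsilon> \<cdot> (u \<cdot> f) = Zero C s\<^sub>1 b" using Comp_reduce[OF u(2), of f] by simp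
  then obtain v where v: "v \<in> Hom C s\<^sub>1 ?K" "k \<cdot> v = u \<cdot> f"
    using is_kernel_lift[OF k, of "u \<cdot> f"] by auto
  note [simp] = v(1)[unfolded Hom_iff]
  \<comment> \<open>The relations of \<open>b\<close> land in \<open>?K\<close>, and modulo the
    trace they vanish since no nonzero morphism leads from a sum to \<open>?X\<close>. So
    \<open>v\<close> lands in the trace, and \<open>e\<close> kills
    \<open>u \<cdot> f\<close>.\<close>
  have "q \<cdot> v = Zero C s\<^sub>1 ?X" by (rule Sum_Hom_Zero[OF p(1) _ X0]) simp_all
  then obtain w where w: "w \<in> Hom C s\<^sub>1 (Dom C t)" "t \<cdot> w = v"
    using is_kernel_lift[OF q(2), of v] by auto
  note [simp] = w(1)[unfolded Hom_iff]
  obtain e where e: "is_cokernel C (k \<cdot> t) e" using ex_cokernel[of "k \<cdot> t"] by auto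
  note [simp] = is_cokernel_Hom(1,2)[OF e]
  let ?E = "Cod C e"
  have [simp]: "Dom C e = ?S" "e \<cdot> (k \<cdot> t) = Zero C (Dom C t) ?E"
    using is_cokernel_Hom(3,4)[OF e] by simp_all
  have "(e \<cdot> u) \<cdot> f = e \<cdot> (k \<cdot> (t \<cdot> w))" using v(2) w(2) by simp
  also have "\<dots> = Zero C s\<^sub>1 ?E"
    using Comp_reduce[of e "k \<cdot> t" "Zero C (Dom C t) ?E" w] by simp
  \<comment> \<open>This \<open>s\<close> becomes the section of the induced map
    \<open>\<pi>\<close> from \<open>?E\<close> to \<open>b\<close>.\<close>
  finally obtain s where s: "s \<in> Hom C b ?E" "s \<cdot> p = e \<cdot> u"
    using is_cokernel_desc[OF p(5), of "e \<cdot> u"] by auto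
  note [simp] = s(1)[unfolded Hom_iff]
  have "\<epsilon> \<cdot> (k \<cdot> t) = Zero C (Dom C t) b"
    using Comp_reduce[of \<epsilon> k "Zero C ?K b" t] by simp
  then obtain \<pi> where \<pi>: "\<pi> \<in> Hom C ?E b" "\<pi> \<cdot> e = \<epsilon>"
    using is_cokernel_desc[OF e, of \<epsilon>] by auto
  note [simp] = \<pi>(1)[unfolded Hom_iff]
  have "(\<pi> \<cdot> s) \<cdot> p = Ident C b \<cdot> p"
    using s(2) u(2) Comp_reduce[OF \<pi>(2), of u] by simp
  then have \<pi>s: "\<pi> \<cdot> s = Ident C b"
    by (rule is_epiD[OF is_cokernel_epi[OF p(5)]]) simp_all
  obtain m where m: "m \<in> Hom C ?X ?E" "m \<cdot> q = e \<cdot> k"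
    using is_cokernel_desc[OF q(1), of "e \<cdot> k"] by auto
  note [simp] = m(1)[unfolded Hom_iff]
  have mm: "is_mono C m"
    by (rule quotient_map_mono[OF is_kernel_mono[OF k] _ _ q(1) e m]) simp_all
  \<comment> \<open>The projection of \<open>?E\<close> along the section, composed with
    \<open>e\<close>. It is killed by \<open>\<pi>\<close>, so it should take values in the
    subobject \<open>?X\<close> of \<open>?E\<close>.\<close>
  define d where "d = sub e (s \<cdot> \<epsilon>)"
  have d: "d \<in> Hom C ?S ?E" by (simp add: d_def)
  note [simp] = d[unfolded Hom_iff]
  have \<pi>d: "\<pi> \<cdot> d = Zero C ?S b"
    using Comp_reduce[OF \<pi>s, of \<epsilon>] sub_eq_Zero_iff[of \<epsilon> ?S b \<epsilon>] by (simp add: d_def \<pi>)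
  have e': "e \<in> Hom C ?S ?E" by simp
  \<comment> \<open>The factorization of \<open>d\<close> through \<open>?X\<close> is built on a
    cover: there \<open>d\<close> lifts to \<open>y\<close>, which lies in \<open>?K\<close>, and
    \<open>q \<cdot> z\<close> kills the kernel of \<open>a\<close>, hence descends to
    \<open>r\<close> on \<open>?S\<close>.\<close>
  obtain P y a where ya: "y \<in> Hom C P ?S" "a \<in> Hom C P ?S" "e \<cdot> y = d \<cdot> a" "is_epi C a"
    using ex_pullback[OF e' d] is_cokernel_epi[OF e] by metis
  note [simp] = ya(1,2)[unfolded Hom_iff]
  have "\<epsilon> \<cdot> y = \<pi> \<cdot> (e \<cdot> y)" using Comp_reduce[OF \<pi>(2), of y] by simp
  also have "\<dots> = Zero C P b" using Comp_reduce[OF \<pi>d, of a] Hom_Ob[OF ya(1)] by (simp add: ya)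
  finally obtain z where z: "z \<in> Hom C P ?K" "k \<cdot> z = y"
    using is_kernel_lift[OF k, of y] by auto
  note [simp] = z(1)[unfolded Hom_iff]
  have da: "m \<cdot> (q \<cdot> z) = d \<cdot> a" using Comp_reduce[OF m(2), of z] z(2) ya(3) by simp
  obtain n where n: "is_kernel C a n" "is_cokernel C n a" by (rule epi_ex_kernel[OF ya(4)])
  have [simp]: "n \<in> Ar C" "Cod C n = P" "a \<cdot> n = Zero C (Dom C n) ?S" using is_kernel_Hom[OF n(1)] by simp_all
  have "m \<cdot> (q \<cdot> (z \<cdot> n)) = Zero C (Dom C n) ?E"
    using Comp_reduce[OF da, of n] by simp
  then have "q \<cdot> (z \<cdot> n) = Zero C (Dom C n) ?X"
    by (rule mono_cancel_Zero[OF mm, rotated -1]) simp_all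
  then obtain r where r: "r \<in> Hom C ?S ?X" "r \<cdot> a = q \<cdot> z"
    using is_cokernel_desc[OF n(2), of "q \<cdot> z"] by auto
  \<comment> \<open>As \<open>?S\<close> is a sum, it has only the zero morphism to
    \<open>?X\<close>. Hence \<open>d\<close> is zero, so \<open>e\<close> factors through
    \<open>\<epsilon>\<close> and kills \<open>k\<close>; this makes \<open>q\<close> zero and its
    kernel \<open>t\<close> epi.\<close>
  have "r = Zero C ?S ?X" by (rule Sum_Hom_Zero[OF _ r(1) X0]) simp_all
  then have "q \<cdot> z = Zero C P ?X" using r(2)[symmetric] by simp
  then have "d \<cdot> a = Zero C P ?E" using da[symmetric] Hom_Ob[OF ya(1)] by simp
  then have "d = Zero C ?S ?E" by (rule epi_cancel_Zero[OF ya(4,2) d])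
  then have "e = s \<cdot> \<epsilon>" unfolding d_def by (rule iffD1[OF sub_eq_Zero_iff, rotated -1]) simp_all
  then have "e \<cdot> k = (s \<cdot> \<epsilon>) \<cdot> k" by (rule arg_cong)
  also have "\<dots> = Zero C ?K ?E" by simp
  finally have "e \<cdot> k = Zero C ?K ?E" .
  then have "q = Zero C ?K ?X"
    using m(2) by (intro mono_cancel_Zero[OF mm m(1)]) simp_all
  then obtain h where h: "h \<in> Hom C ?K (Dom C t)" "t \<cdot> h = Ident C ?K"
    using is_kernel_lift[OF q(2), of "Ident C ?K"] by auto
  then have "is_epi C t"
    using is_epi_Comp_left[of t h ?K "Dom C t" ?K] is_epi_Ident[of ?K] by simp
  then show "?K \<in> GenU"
    using t Gen_quotient[of "Dom C t" t ?K] unfolding is_trace_def by simp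
qed

end

subsection \<open>Closure properties of presented objects\<close>

context abelian_category
begin

lemma biproduct_kernel_lift:
  assumes bp: "is_biproduct C a b d i\<^sub>1 i\<^sub>2 p\<^sub>1 p\<^sub>2"
    and y: "y \<in> Hom C a c" and g: "g \<in> Hom C b c"
    and n: "is_kernel C (sub (y \<cdot> p\<^sub>1) (g \<cdot> p\<^sub>2)) n"
    and uv: "u \<in> Hom C x a" "v \<in> Hom C x b" "y \<cdot> u = g \<cdot> v"
  obtains h where "h \<in> Hom C x (Dom C n)" "p\<^sub>1 \<cdot> n \<cdot> h = u" "p\<^sub>2 \<cdot> n \<cdot> h = v"
  using kernel_is_pullback(4)[OF bp y g n uv] by blast

lemma ex_biproduct_kernel:
  assumes "y \<in> Hom C a c" "g \<in> Hom C b c"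
  obtains d i\<^sub>1 i\<^sub>2 p\<^sub>1 p\<^sub>2 n where "is_biproduct C a b d i\<^sub>1 i\<^sub>2 p\<^sub>1 p\<^sub>2"
    "sub (y \<cdot> p\<^sub>1) (g \<cdot> p\<^sub>2) \<in> Hom C d c" "is_kernel C (sub (y \<cdot> p\<^sub>1) (g \<cdot> p\<^sub>2)) n"
proof -
  have "a \<in> Ob C" "b \<in> Ob C" using Hom_Ob assms by blast+
  then obtain d i\<^sub>1 i\<^sub>2 p\<^sub>1 p\<^sub>2 where bp: "is_biproduct C a b d i\<^sub>1 i\<^sub>2 p\<^sub>1 p\<^sub>2" using ex_biproduct by blast
  note [simp] = biproduct_simps[OF bp]
  have h: "sub (y \<cdot> p\<^sub>1) (g \<cdot> p\<^sub>2) \<in> Hom C d c" using assms by simp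
  then obtain n where "is_kernel C (sub (y \<cdot> p\<^sub>1) (g \<cdot> p\<^sub>2)) n"
    using ex_kernel by auto
  then show ?thesis using that bp h by blast
qed

end

context cocomplete_abelian_with_small_set
begin

lemma Gen_cover:
  assumes "a \<in> GenU"
  obtains s e where "s \<in> SumU" "e \<in> Hom C s a" "is_epi C e"
  using assms unfolding Gen_def by blast

lemma Pres_cover:
  assumes "a \<in> PresU"
  obtains s e where "s \<in> SumU" "e \<in> Hom C s a" "is_epi C e"
  using Gen_cover[OF Pres_Gen[OF assms]] by blast

text \<open>The kernel of \<open>g\<close> is the preimage of the kernel of
  \<open>\<epsilon>\<close> under a lift \<open>u\<close> of \<open>g\<close>. By (c) the latter
  kernel has a cover by a sum \<open>s'\<close>. The pullback along this cover is the kernel of a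
  morphism of sums, hence generated, and it maps onto the kernel of \<open>g\<close>.\<close>

lemma kernel_Sum_Pres_Gen:
  assumes skg: "Sum_kernels_generated \<kappa> C \<U>" and c: "condition_c \<kappa> C \<U>"
    and s: "s \<in> SumU" and b: "b \<in> PresU" and g: "g \<in> Hom C s b" and l: "is_kernel C g l"
  shows "Dom C l \<in> GenU"
proof -
  obtain \<epsilon> where \<epsilon>: "is_canonical_morphism C \<U> b \<epsilon>" by (rule ex_canonical[OF Pres_Ob[OF b]])
  let ?S = "Dom C \<epsilon>"
  note [simp] = canonical_Hom[OF \<epsilon>] Pres_Ob[OF b] g[unfolded Hom_iff]
  obtain k where k: "is_kernel C \<epsilon> k" using ex_kernel[of \<epsilon>] by auto
  let ?K = "Dom C k"
  note [simp] = is_kernel_Hom[OF k]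
  have "?K \<in> GenU" using c b \<epsilon> k unfolding condition_c_def by blast
  then obtain s' e where e: "s' \<in> SumU" "e \<in> Hom C s' ?K" "is_epi C e" by (rule Gen_cover)
  note [simp] = e(2)[unfolded Hom_iff]
  have [simp]: "l \<in> Ar C" "Cod C l = s" "g \<cdot> l = Zero C (Dom C l) b"
    using is_kernel_Hom[OF l] by simp_all
  obtain u where u: "u \<in> Hom C s ?S" "\<epsilon> \<cdot> u = g" by (rule canonical_lift[OF \<epsilon> s g])
  note [simp] = u(1)[unfolded Hom_iff]
  have ke: "k \<cdot> e \<in> Hom C s' ?S" by simp
  obtain d i\<^sub>1 i\<^sub>2 p\<^sub>1 p\<^sub>2 n where bp: "is_biproduct C s s' d i\<^sub>1 i\<^sub>2 p\<^sub>1 p\<^sub>2"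
    and h: "sub (u \<cdot> p\<^sub>1) ((k \<cdot> e) \<cdot> p\<^sub>2) \<in> Hom C d ?S"
    and n: "is_kernel C (sub (u \<cdot> p\<^sub>1) ((k \<cdot> e) \<cdot> p\<^sub>2)) n"
    by (rule ex_biproduct_kernel[OF u(1) ke])
  note [simp] = biproduct_simps[OF bp] kernel_is_pullback(1,2)[OF bp u(1) ke n]
  have "Dom C n \<in> GenU"
    using skg biproduct_Sum[OF s e(1) bp] h n canonical_Hom(3)[OF \<epsilon>]
    unfolding Sum_kernels_generated_def by blast
  define y where "y = p\<^sub>1 \<cdot> n"
  have y [simp]: "y \<in> Ar C" "Dom C y = Dom C n" "Cod C y = s" by (simp_all add: y_def)
  have uy: "u \<cdot> y = (k \<cdot> e) \<cdot> (p\<^sub>2 \<cdot> n)"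
    unfolding y_def by (rule kernel_is_pullback(3)[OF bp u(1) ke n])
  have "g \<cdot> y = \<epsilon> \<cdot> (u \<cdot> y)" using Comp_reduce[OF u(2), of y] by simp
  also have "\<dots> = Zero C (Dom C n) b"
    unfolding uy using Comp_reduce[OF is_kernel_Hom(4)[OF k], of "e \<cdot> p\<^sub>2 \<cdot> n"] by simp
  finally obtain z where z: "z \<in> Hom C (Dom C n) (Dom C l)" "l \<cdot> z = y"
    using is_kernel_lift[OF l, of y] by auto
  note [simp] = z(1)[unfolded Hom_iff]
  have "\<epsilon> \<cdot> (u \<cdot> l) = Zero C (Dom C l) b" using Comp_reduce[OF u(2), of l] by simp
  then obtain x where x: "x \<in> Hom C (Dom C l) ?K" "k \<cdot> x = u \<cdot> l"
    using is_kernel_lift[OF k, of "u \<cdot> l"] by auto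
  \<comment> \<open>To see that \<open>z\<close> is epi, the map \<open>x\<close> into
    \<open>?K\<close> is lifted along the cover \<open>e\<close>; together with
    \<open>l \<cdot> b'\<close> the lift gives a map into the pullback.\<close>
  obtain Q a b' where ab: "a \<in> Hom C Q s'" "b' \<in> Hom C Q (Dom C l)" "e \<cdot> a = x \<cdot> b'" "is_epi C b'"
    using ex_pullback[OF e(2) x(1)] e(3) by metis
  note [simp] = ab(1,2)[unfolded Hom_iff] x(1)[unfolded Hom_iff]
  have eq: "u \<cdot> (l \<cdot> b') = (k \<cdot> e) \<cdot> a"
    using Comp_reduce[OF x(2), of b'] ab(3) by simp
  have "l \<cdot> b' \<in> Hom C Q s" by simp
  then obtain h where h: "h \<in> Hom C Q (Dom C n)" "p\<^sub>1 \<cdot> n \<cdot> h = l \<cdot> b'"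
    using biproduct_kernel_lift[OF bp u(1) ke n _ ab(1) eq] by metis
  note [simp] = h(1)[unfolded Hom_iff]
  have "l \<cdot> (z \<cdot> h) = l \<cdot> b'" using Comp_reduce[OF z(2), of h] h(2) by (simp add: y_def)
  then have "z \<cdot> h = b'" by (rule is_monoD[OF is_kernel_mono[OF l], where a = Q]) simp_all
  then have "is_epi C z" using is_epi_Comp_left[OF _ h(1) z(1)] ab(4) by simp
  then show ?thesis using Gen_quotient[OF \<open>Dom C n \<in> GenU\<close> z(1)] by simp
qed

text \<open>Two uses of \<open>kernel_Sum_Pres_Gen\<close>: for \<open>f\<close> after a cover of
  \<open>a\<close>, it shows that the kernel is generated; for \<open>k\<close> after a cover of the
  kernel, it supplies the generated relations that \<open>PresI\<close> needs.\<close>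

lemma kernel_Pres:
  assumes skg: "Sum_kernels_generated \<kappa> C \<U>" and c: "condition_c \<kappa> C \<U>"
    and a: "a \<in> PresU" and b: "b \<in> PresU" and f: "f \<in> Hom C a b" and k: "is_kernel C f k"
  shows "Dom C k \<in> PresU"
proof -
  let ?K = "Dom C k"
  note [simp] = f[unfolded Hom_iff]
  have [simp]: "k \<in> Ar C" "Cod C k = a" "f \<cdot> k = Zero C ?K b" "a \<in> Ob C" "b \<in> Ob C"
    using is_kernel_Hom[OF k] Pres_Ob[OF a] Pres_Ob[OF b] by simp_all
  obtain t p where p: "t \<in> SumU" "p \<in> Hom C t a" "is_epi C p" by (rule Pres_cover[OF a])
  note [simp] = p(2)[unfolded Hom_iff]
  have fp: "f \<cdot> p \<in> Hom C t b" by simp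
  obtain l where l: "is_kernel C (f \<cdot> p) l" using ex_kernel[of "f \<cdot> p"] by auto
  have [simp]: "l \<in> Ar C" "Cod C l = t" using is_kernel_Hom[OF l] by simp_all
  have fpl: "f \<cdot> (p \<cdot> l) = Zero C (Dom C l) b" using is_kernel_Hom(4)[OF l] by simp
  obtain z where z: "z \<in> Hom C (Dom C l) ?K" "k \<cdot> z = p \<cdot> l"
    using is_kernel_lift[OF k, of "p \<cdot> l"] fpl by auto
  have k': "k \<in> Hom C ?K a" by simp
  \<comment> \<open>To see that \<open>z\<close> is epi, \<open>k\<close> is lifted along
    \<open>p\<close> on a cover; the lift lies in the kernel of \<open>f \<cdot> p\<close>.\<close>
  obtain Q y b' where y: "y \<in> Hom C Q t" "b' \<in> Hom C Q ?K" "p \<cdot> y = k \<cdot> b'" "is_epi C b'"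
    using ex_pullback[OF p(2) k'] p(3) by metis
  note [simp] = y(1,2)[unfolded Hom_iff] z(1)[unfolded Hom_iff]
  have "f \<cdot> (k \<cdot> b') = Zero C Q b" using Comp_reduce[OF is_kernel_Hom(4)[OF k], of b'] by simp
  then have "(f \<cdot> p) \<cdot> y = Zero C Q b" by (simp add: y(3))
  then obtain h where h: "h \<in> Hom C Q (Dom C l)" "l \<cdot> h = y"
    using is_kernel_lift[OF l, of y] by auto
  note [simp] = h(1)[unfolded Hom_iff]
  have "k \<cdot> (z \<cdot> h) = k \<cdot> b'" using Comp_reduce[OF z(2), of h] h(2) y(3) by simp
  then have "z \<cdot> h = b'" by (rule is_monoD[OF is_kernel_mono[OF k], where a = Q]) simp_all
  then have "is_epi C z" using is_epi_Comp_left[OF _ h(1) z(1)] y(4) by simp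
  then have "?K \<in> GenU"
    using Gen_quotient[OF kernel_Sum_Pres_Gen[OF skg c p(1) b fp l] z(1)] by simp
  then obtain s e where e: "s \<in> SumU" "e \<in> Hom C s ?K" "is_epi C e" by (rule Gen_cover)
  note [simp] = e(2)[unfolded Hom_iff]
  obtain j where j: "is_kernel C e j" using ex_kernel[of e] by auto
  note [simp] = is_kernel_Hom[OF j]
  \<comment> \<open>As \<open>k\<close> is mono, the relations of the cover \<open>e\<close> form
    the kernel of a morphism from a sum to the presented object \<open>a\<close>.\<close>
  have "is_kernel C (k \<cdot> e) j"
  proof (rule is_kernelI)
    show "k \<cdot> e \<in> Hom C s a" "j \<in> Hom C (Dom C j) s" "(k \<cdot> e) \<cdot> j = Zero C (Dom C j) a" by simp_all
    show "is_mono C j" by (rule is_kernel_mono[OF j])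
    fix g assume g: "g \<in> Ar C" "Cod C g = s" "(k \<cdot> e) \<cdot> g = Zero C (Dom C g) a"
    then have "k \<cdot> (e \<cdot> g) = Zero C (Dom C g) a" by simp
    then have "e \<cdot> g = Zero C (Dom C g) ?K"
      by (rule mono_cancel_Zero[OF is_kernel_mono[OF k] k', rotated]) (use g in simp)
    then show "\<exists>h. h \<in> Hom C (Dom C g) (Dom C j) \<and> j \<cdot> h = g"
      using is_kernel_lift[OF j, of g] g by auto
  qed
  then have "Dom C j \<in> GenU"
    by (rule kernel_Sum_Pres_Gen[OF skg c e(1) a, rotated]) simp
  then show ?thesis by (rule PresI[OF e j])
qed

text \<open>By \<open>PresI\<close> it suffices that the kernel of the cover
  \<open>q \<cdot> p\<^sub>b\<close> is generated. The pullback of \<open>p\<^sub>b\<close> and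
  \<open>f \<cdot> p\<^sub>a\<close> maps onto it, and is generated as the kernel of a morphism from
  a sum to \<open>b\<close>.\<close>

lemma cokernel_Pres:
  assumes skg: "Sum_kernels_generated \<kappa> C \<U>" and c: "condition_c \<kappa> C \<U>"
    and a: "a \<in> PresU" and b: "b \<in> PresU" and f: "f \<in> Hom C a b" and q: "is_cokernel C f q"
  shows "Cod C q \<in> PresU"
proof -
  note [simp] = f[unfolded Hom_iff]
  have [simp]: "q \<in> Ar C" "Dom C q = b" "q \<cdot> f = Zero C a (Cod C q)" "a \<in> Ob C" "b \<in> Ob C"
    using is_cokernel_Hom[OF q] Pres_Ob[OF a] Pres_Ob[OF b] by simp_all
  obtain s p\<^sub>a where pa: "s \<in> SumU" "p\<^sub>a \<in> Hom C s a" "is_epi C p\<^sub>a" by (rule Pres_cover[OF a])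
  obtain t p\<^sub>b where pb: "t \<in> SumU" "p\<^sub>b \<in> Hom C t b" "is_epi C p\<^sub>b" by (rule Pres_cover[OF b])
  note [simp] = pa(2)[unfolded Hom_iff] pb(2)[unfolded Hom_iff]
  have fp: "f \<cdot> p\<^sub>a \<in> Hom C s b" by simp
  obtain l where l: "is_kernel C (q \<cdot> p\<^sub>b) l" using ex_kernel[of "q \<cdot> p\<^sub>b"] by auto
  have [simp]: "l \<in> Ar C" "Cod C l = t" using is_kernel_Hom[OF l] by simp_all
  have ql: "q \<cdot> (p\<^sub>b \<cdot> l) = Zero C (Dom C l) (Cod C q)" using is_kernel_Hom(4)[OF l] by simp
  obtain d i\<^sub>1 i\<^sub>2 p\<^sub>1 p\<^sub>2 n where bp: "is_biproduct C t s d i\<^sub>1 i\<^sub>2 p\<^sub>1 p\<^sub>2"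
    and h: "sub (p\<^sub>b \<cdot> p\<^sub>1) ((f \<cdot> p\<^sub>a) \<cdot> p\<^sub>2) \<in> Hom C d b"
    and n: "is_kernel C (sub (p\<^sub>b \<cdot> p\<^sub>1) ((f \<cdot> p\<^sub>a) \<cdot> p\<^sub>2)) n"
    by (rule ex_biproduct_kernel[OF pb(2) fp])
  note [simp] = biproduct_simps[OF bp] kernel_is_pullback(1,2)[OF bp pb(2) fp n]
  have nG: "Dom C n \<in> GenU"
    by (rule kernel_Sum_Pres_Gen[OF skg c biproduct_Sum[OF pb(1) pa(1) bp] b h n])
  define y where "y = p\<^sub>1 \<cdot> n"
  have y [simp]: "y \<in> Ar C" "Dom C y = Dom C n" "Cod C y = t" by (simp_all add: y_def)
  have py: "p\<^sub>b \<cdot> y = (f \<cdot> p\<^sub>a) \<cdot> (p\<^sub>2 \<cdot> n)"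
    unfolding y_def by (rule kernel_is_pullback(3)[OF bp pb(2) fp n])
  have "(q \<cdot> p\<^sub>b) \<cdot> y = q \<cdot> (p\<^sub>b \<cdot> y)" by simp
  also have "\<dots> = Zero C (Dom C n) (Cod C q)"
    unfolding py using Comp_reduce[OF is_cokernel_Hom(4)[OF q], of "p\<^sub>a \<cdot> p\<^sub>2 \<cdot> n"] by simp
  finally obtain z where z: "z \<in> Hom C (Dom C n) (Dom C l)" "l \<cdot> z = y"
    using is_kernel_lift[OF l, of y] by auto
  note [simp] = z(1)[unfolded Hom_iff]
  \<comment> \<open>To see that \<open>z\<close> is epi, \<open>p\<^sub>b \<cdot> l\<close> is
    lifted twice: along \<open>f\<close>, as \<open>q\<close> kills it, and then along
    \<open>p\<^sub>a\<close>.\<close>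
  obtain Q e w where ew: "e \<in> Hom C Q (Dom C l)" "is_epi C e" "w \<in> Hom C Q a" "(p\<^sub>b \<cdot> l) \<cdot> e = f \<cdot> w"
    using exact_at_cokernel[OF q, of "p\<^sub>b \<cdot> l"] ql by auto
  obtain R x e' where x: "x \<in> Hom C R s" "e' \<in> Hom C R Q" "p\<^sub>a \<cdot> x = w \<cdot> e'" "is_epi C e'"
    using ex_pullback[OF pa(2) ew(3)] pa(3) by metis
  note [simp] = ew(1,3)[unfolded Hom_iff] x(1,2)[unfolded Hom_iff]
  have eq: "p\<^sub>b \<cdot> (l \<cdot> e \<cdot> e') = (f \<cdot> p\<^sub>a) \<cdot> x"
    using Comp_reduce[OF ew(4), of e'] x(3) by simp
  have "l \<cdot> e \<cdot> e' \<in> Hom C R t" by simp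
  then obtain h where h: "h \<in> Hom C R (Dom C n)" "p\<^sub>1 \<cdot> n \<cdot> h = l \<cdot> e \<cdot> e'"
    using biproduct_kernel_lift[OF bp pb(2) fp n _ x(1) eq] by metis
  note [simp] = h(1)[unfolded Hom_iff]
  have "l \<cdot> (z \<cdot> h) = l \<cdot> (e \<cdot> e')" using Comp_reduce[OF z(2), of h] h(2) by (simp add: y_def)
  then have "z \<cdot> h = e \<cdot> e'" by (rule is_monoD[OF is_kernel_mono[OF l], where a = R]) simp_all
  then have "is_epi C z"
    using is_epi_Comp_left[OF _ h(1) z(1)] is_epi_Comp[OF x(4) ew(2)] by simp
  then have "Dom C l \<in> GenU" using Gen_quotient[OF nG z(1)] by simp
  moreover have "is_epi C (q \<cdot> p\<^sub>b)"
    by (rule is_epi_Comp[OF pb(3) is_cokernel_epi[OF q]]) simp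
  moreover have "q \<cdot> p\<^sub>b \<in> Hom C t (Cod C q)" by simp
  ultimately show ?thesis using PresI[OF pb(1) _ _ l] by blast
qed

text \<open>The direct sum of two presentations is a presentation; all equations are checked on the
  two injections.\<close>

lemma biproduct_Pres:
  assumes a: "a \<in> PresU" and b: "b \<in> PresU" and bp: "is_biproduct C a b c i\<^sub>1 i\<^sub>2 p\<^sub>1 p\<^sub>2"
  shows "c \<in> PresU"
proof -
  obtain s\<^sub>1 t\<^sub>1 f\<^sub>1 q\<^sub>1 where 1: "s\<^sub>1 \<in> SumU" "t\<^sub>1 \<in> SumU" "f\<^sub>1 \<in> Hom C s\<^sub>1 t\<^sub>1" "q\<^sub>1 \<in> Hom C t\<^sub>1 a" "is_cokernel C f\<^sub>1 q\<^sub>1"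
    by (rule PresE[OF a])
  obtain s\<^sub>2 t\<^sub>2 f\<^sub>2 q\<^sub>2 where 2: "s\<^sub>2 \<in> SumU" "t\<^sub>2 \<in> SumU" "f\<^sub>2 \<in> Hom C s\<^sub>2 t\<^sub>2" "q\<^sub>2 \<in> Hom C t\<^sub>2 b" "is_cokernel C f\<^sub>2 q\<^sub>2"
    by (rule PresE[OF b])
  obtain s j\<^sub>1 j\<^sub>2 r\<^sub>1 r\<^sub>2 where s: "is_biproduct C s\<^sub>1 s\<^sub>2 s j\<^sub>1 j\<^sub>2 r\<^sub>1 r\<^sub>2"
    using ex_biproduct Sum_Ob 1 2 by blast
  obtain t k\<^sub>1 k\<^sub>2 u\<^sub>1 u\<^sub>2 where t: "is_biproduct C t\<^sub>1 t\<^sub>2 t k\<^sub>1 k\<^sub>2 u\<^sub>1 u\<^sub>2"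
    using ex_biproduct Sum_Ob 1 2 by blast
  note [simp] = biproduct_simps[OF bp] biproduct_simps[OF s] biproduct_simps[OF t]
    1(3,4)[unfolded Hom_iff] 2(3,4)[unfolded Hom_iff]
  have [simp]: "q\<^sub>1 \<cdot> f\<^sub>1 = Zero C s\<^sub>1 a" "q\<^sub>2 \<cdot> f\<^sub>2 = Zero C s\<^sub>2 b" "a \<in> Ob C" "b \<in> Ob C"
    "s\<^sub>1 \<in> Ob C" "s\<^sub>2 \<in> Ob C" "c \<in> Ob C" "s \<in> Ob C" "t \<in> Ob C"
    using is_cokernel_Hom(4)[OF 1(5)] is_cokernel_Hom(4)[OF 2(5)] Sum_Ob 1 2 Pres_Ob[OF a] Pres_Ob[OF b]
      bp s t by (simp_all add: is_biproduct_def)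
  have "k\<^sub>1 \<cdot> f\<^sub>1 \<in> Hom C s\<^sub>1 t" "k\<^sub>2 \<cdot> f\<^sub>2 \<in> Hom C s\<^sub>2 t" by simp_all
  then obtain f where f: "f \<in> Hom C s t" "f \<cdot> j\<^sub>1 = k\<^sub>1 \<cdot> f\<^sub>1" "f \<cdot> j\<^sub>2 = k\<^sub>2 \<cdot> f\<^sub>2"
    by (rule biproduct_desc[OF s])
  have "i\<^sub>1 \<cdot> q\<^sub>1 \<in> Hom C t\<^sub>1 c" "i\<^sub>2 \<cdot> q\<^sub>2 \<in> Hom C t\<^sub>2 c" by simp_all
  then obtain q where q: "q \<in> Hom C t c" "q \<cdot> k\<^sub>1 = i\<^sub>1 \<cdot> q\<^sub>1" "q \<cdot> k\<^sub>2 = i\<^sub>2 \<cdot> q\<^sub>2"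
    by (rule biproduct_desc[OF t])
  note [simp] = f(1)[unfolded Hom_iff] q(1)[unfolded Hom_iff]
  have "is_cokernel C f q"
  proof (rule is_cokernelI[OF f(1) q(1)])
    show "q \<cdot> f = Zero C s c"
    proof (rule biproduct_eqI[OF s])
      show "(q \<cdot> f) \<cdot> j\<^sub>1 = Zero C s c \<cdot> j\<^sub>1" using f(2) Comp_reduce[OF q(2), of f\<^sub>1] by simp
      show "(q \<cdot> f) \<cdot> j\<^sub>2 = Zero C s c \<cdot> j\<^sub>2" using f(3) Comp_reduce[OF q(3), of f\<^sub>2] by simp
    qed simp_all
    show "is_epi C q"
      unfolding is_epi_iff_Zero
    proof (intro conjI ballI impI)
      fix g assume g: "g \<in> Ar C" "Dom C g = Cod C q" "g \<cdot> q = Zero C (Dom C q) (Cod C g)"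
      have [simp]: "g \<in> Ar C" "Dom C g = c" using g by simp_all
      have gq: "g \<cdot> q = Zero C t (Cod C g)" using g by simp
      have "(g \<cdot> i\<^sub>1) \<cdot> q\<^sub>1 = Zero C t\<^sub>1 (Cod C g)"
        using q(2) Comp_reduce[OF gq, of k\<^sub>1] by simp
      then have a1: "g \<cdot> i\<^sub>1 = Zero C a (Cod C g)"
        by (rule epi_cancel_Zero[OF is_cokernel_epi[OF 1(5)] 1(4), rotated]) simp
      have "(g \<cdot> i\<^sub>2) \<cdot> q\<^sub>2 = Zero C t\<^sub>2 (Cod C g)"
        using q(3) Comp_reduce[OF gq, of k\<^sub>2] by simp
      then have a2: "g \<cdot> i\<^sub>2 = Zero C b (Cod C g)"
        by (rule epi_cancel_Zero[OF is_cokernel_epi[OF 2(5)] 2(4), rotated]) simp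
      have "g = Zero C c (Cod C g)" by (rule biproduct_eqI[OF bp]) (simp_all add: a1 a2)
      then show "g = Zero C (Cod C q) (Cod C g)" by simp
    qed simp
    fix g assume g: "g \<in> Ar C" "Dom C g = t" "g \<cdot> f = Zero C s (Cod C g)"
    note [simp] = g(1,2)
    have "(g \<cdot> k\<^sub>1) \<cdot> f\<^sub>1 = Zero C s\<^sub>1 (Cod C g)" using f(2) Comp_reduce[OF g(3), of j\<^sub>1] by simp
    then obtain h\<^sub>1 where h1: "h\<^sub>1 \<in> Hom C a (Cod C g)" "h\<^sub>1 \<cdot> q\<^sub>1 = g \<cdot> k\<^sub>1"
      using is_cokernel_desc[OF 1(5), of "g \<cdot> k\<^sub>1"] by auto
    have "(g \<cdot> k\<^sub>2) \<cdot> f\<^sub>2 = Zero C s\<^sub>2 (Cod C g)" using f(3) Comp_reduce[OF g(3), of j\<^sub>2] by simp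
    then obtain h\<^sub>2 where h2: "h\<^sub>2 \<in> Hom C b (Cod C g)" "h\<^sub>2 \<cdot> q\<^sub>2 = g \<cdot> k\<^sub>2"
      using is_cokernel_desc[OF 2(5), of "g \<cdot> k\<^sub>2"] by auto
    obtain h where h: "h \<in> Hom C c (Cod C g)" "h \<cdot> i\<^sub>1 = h\<^sub>1" "h \<cdot> i\<^sub>2 = h\<^sub>2"
      by (rule biproduct_desc[OF bp h1(1) h2(1)])
    note [simp] = h(1)[unfolded Hom_iff]
    have "h \<cdot> q = g"
    proof (rule biproduct_eqI[OF t])
      show "(h \<cdot> q) \<cdot> k\<^sub>1 = g \<cdot> k\<^sub>1" using q(2) h1(2) Comp_reduce[OF h(2), of q\<^sub>1] by simp
      show "(h \<cdot> q) \<cdot> k\<^sub>2 = g \<cdot> k\<^sub>2" using q(3) h2(2) Comp_reduce[OF h(3), of q\<^sub>2] by simp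
    qed simp_all
    then show "\<exists>h. h \<in> Hom C c (Cod C g) \<and> h \<cdot> q = g" using h(1) by blast
  qed
  then show ?thesis
    using cokernel_Sum_Pres[OF biproduct_Sum[OF 1(1) 2(1) s] biproduct_Sum[OF 1(2) 2(2) t] f(1), of q] by simp
qed

text \<open>The coreflection is \<open>Dom C \<epsilon>\<close> modulo the trace of the kernel of
  \<open>\<epsilon>\<close>. Dividing by the image of the canonical morphism
  \<open>\<epsilon>'\<close> onto that trace exhibits it as the cokernel of a morphism of
  sums.\<close>

lemma Pres_coreflection:
  assumes skg: "Sum_kernels_generated \<kappa> C \<U>" and c: "condition_c \<kappa> C \<U>" and a: "a \<in> Ob C"
  obtains r \<rho> where "r \<in> PresU" "\<rho> \<in> Hom C r a"
    "\<And>b f. b \<in> PresU \<Longrightarrow> f \<in> Hom C b a \<Longrightarrow> \<exists>!h. h \<in> Hom C b r \<and> \<rho> \<cdot> h = f"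
proof -
  obtain \<epsilon> where \<epsilon>: "is_canonical_morphism C \<U> a \<epsilon>" by (rule ex_canonical[OF a])
  let ?S = "Dom C \<epsilon>"
  note [simp] = canonical_Hom[OF \<epsilon>] a
  obtain k where k: "is_kernel C \<epsilon> k" using ex_kernel[of \<epsilon>] by auto
  let ?K = "Dom C k"
  note [simp] = is_kernel_Hom[OF k]
  obtain \<epsilon>' where \<epsilon>': "is_canonical_morphism C \<U> ?K \<epsilon>'" by (rule ex_canonical[of ?K]) simp
  note [simp] = canonical_Hom[OF \<epsilon>']
  let ?S' = "Dom C \<epsilon>'"
  obtain q where q: "is_cokernel C (k \<cdot> \<epsilon>') q" using ex_cokernel[of "k \<cdot> \<epsilon>'"] by auto
  let ?R = "Cod C q"
  have [simp]: "q \<in> Ar C" "Dom C q = ?S" and qk: "q \<cdot> (k \<cdot> \<epsilon>') = Zero C ?S' ?R"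
    using is_cokernel_Hom[OF q] by simp_all
  have R: "?R \<in> PresU" by (rule cokernel_Sum_Pres[OF _ _ _ q, of ?S' ?S]) simp_all
  have "\<epsilon> \<cdot> (k \<cdot> \<epsilon>') = Zero C ?S' a" using Comp_reduce[OF is_kernel_Hom(4)[OF k], of \<epsilon>'] by simp
  then obtain \<rho> where \<rho>: "\<rho> \<in> Hom C ?R a" "\<rho> \<cdot> q = \<epsilon>"
    using is_cokernel_desc[OF q, of \<epsilon>] by auto
  note [simp] = \<rho>(1)[unfolded Hom_iff]
  \<comment> \<open>A generated object mapping into the kernel of \<open>\<epsilon>\<close> lands in
    its trace, because its cover lifts along \<open>\<epsilon>'\<close>.\<close>
  have Gen0: "q \<cdot> y = Zero C P ?R" if y: "y \<in> Hom C P ?S" "\<epsilon> \<cdot> y = Zero C P a" and P: "P \<in> GenU" for P y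
  proof -
    note [simp] = y(1)[unfolded Hom_iff]
    obtain s e where e: "s \<in> SumU" "e \<in> Hom C s P" "is_epi C e" by (rule Gen_cover[OF P])
    note [simp] = e(2)[unfolded Hom_iff]
    obtain x where x: "x \<in> Hom C P ?K" "k \<cdot> x = y"
      using is_kernel_lift[OF k, of y] y by auto
    note [simp] = x(1)[unfolded Hom_iff]
    have xe: "x \<cdot> e \<in> Hom C s ?K" by simp
    obtain w where w: "w \<in> Hom C s ?S'" "\<epsilon>' \<cdot> w = x \<cdot> e" by (rule canonical_lift[OF \<epsilon>' e(1) xe])
    note [simp] = w(1)[unfolded Hom_iff]
    have "(q \<cdot> y) \<cdot> e = q \<cdot> (k \<cdot> (\<epsilon>' \<cdot> w))" unfolding w(2) using Comp_reduce[OF x(2), of e] by simp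
    also have "\<dots> = Zero C s ?R" using Comp_reduce[OF qk, of w] by simp
    finally show ?thesis by (rule epi_cancel_Zero[OF e(3,2), rotated]) simp
  qed
  \<comment> \<open>Uniqueness of factorizations, reduced to zero. The pullback of \<open>q\<close>
    and \<open>h \<cdot> p\<close> is generated and maps into the kernel of
    \<open>\<epsilon>\<close>, so \<open>Gen0\<close> makes it vanish in \<open>?R\<close>; its
    projection to \<open>t\<close> is epi.\<close>
  have zero: "h = Zero C b ?R" if b: "b \<in> PresU" and h: "h \<in> Hom C b ?R" "\<rho> \<cdot> h = Zero C b a" for b h
  proof -
    note [simp] = h(1)[unfolded Hom_iff] Pres_Ob[OF b]
    obtain t p where p: "t \<in> SumU" "p \<in> Hom C t b" "is_epi C p" by (rule Pres_cover[OF b])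
    note [simp] = p(2)[unfolded Hom_iff]
    have hp: "h \<cdot> p \<in> Hom C t ?R" and q': "q \<in> Hom C ?S ?R" by simp_all
    obtain d i\<^sub>1 i\<^sub>2 p\<^sub>1 p\<^sub>2 n where bp: "is_biproduct C ?S t d i\<^sub>1 i\<^sub>2 p\<^sub>1 p\<^sub>2"
      and g: "sub (q \<cdot> p\<^sub>1) ((h \<cdot> p) \<cdot> p\<^sub>2) \<in> Hom C d ?R"
      and n: "is_kernel C (sub (q \<cdot> p\<^sub>1) ((h \<cdot> p) \<cdot> p\<^sub>2)) n"
      by (rule ex_biproduct_kernel[OF q' hp])
    note [simp] = biproduct_simps[OF bp] kernel_is_pullback(1,2)[OF bp q' hp n]
    have nG: "Dom C n \<in> GenU"
      by (rule kernel_Sum_Pres_Gen[OF skg c biproduct_Sum[OF _ p(1) bp] R g n]) simp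
    have eq: "q \<cdot> (p\<^sub>1 \<cdot> n) = (h \<cdot> p) \<cdot> (p\<^sub>2 \<cdot> n)"
      by (rule kernel_is_pullback(3)[OF bp q' hp n])
    have epi: "is_epi C (p\<^sub>2 \<cdot> n)" by (rule pullback_epi[OF bp q' hp n is_cokernel_epi[OF q]])
    have "\<epsilon> \<cdot> (p\<^sub>1 \<cdot> n) = \<rho> \<cdot> (q \<cdot> (p\<^sub>1 \<cdot> n))" using Comp_reduce[OF \<rho>(2), of "p\<^sub>1 \<cdot> n"] by simp
    also have "\<dots> = Zero C (Dom C n) a"
      unfolding eq using Comp_reduce[OF h(2), of "p \<cdot> p\<^sub>2 \<cdot> n"] by simp
    finally have "q \<cdot> (p\<^sub>1 \<cdot> n) = Zero C (Dom C n) ?R" by (intro Gen0 nG) simp_all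
    then have "(h \<cdot> p) \<cdot> (p\<^sub>2 \<cdot> n) = Zero C (Dom C n) ?R" by (simp only: eq)
    then have "h \<cdot> p = Zero C t ?R"
      by (rule epi_cancel_Zero[OF epi, rotated -1]) simp_all
    then show ?thesis by (rule epi_cancel_Zero[OF p(3,2) h(1)])
  qed
  show ?thesis
  proof (rule that[OF R \<rho>(1)])
    fix b f assume b: "b \<in> PresU" and f: "f \<in> Hom C b a"
    note [simp] = f[unfolded Hom_iff] Pres_Ob[OF b]
    obtain s\<^sub>1 s\<^sub>0 g p where p: "s\<^sub>1 \<in> SumU" "s\<^sub>0 \<in> SumU" "g \<in> Hom C s\<^sub>1 s\<^sub>0" "p \<in> Hom C s\<^sub>0 b" "is_cokernel C g p"
      by (rule PresE[OF b])
    note [simp] = p(3,4)[unfolded Hom_iff] Sum_Ob[OF p(1)]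
    have fp: "f \<cdot> p \<in> Hom C s\<^sub>0 a" by simp
    \<comment> \<open>Existence of factorizations: \<open>u\<close> sends the relations of
      \<open>b\<close> into the kernel of \<open>\<epsilon>\<close>, and \<open>Gen0\<close> lets
      \<open>q \<cdot> u\<close> descend to \<open>b\<close>.\<close>
    obtain u where u: "u \<in> Hom C s\<^sub>0 ?S" "\<epsilon> \<cdot> u = f \<cdot> p" by (rule canonical_lift[OF \<epsilon> p(2) fp])
    note [simp] = u(1)[unfolded Hom_iff]
    have "\<epsilon> \<cdot> (u \<cdot> g) = Zero C s\<^sub>1 a"
      using Comp_reduce[OF u(2), of g] is_cokernel_Hom(4)[OF p(5)] by simp
    then have "q \<cdot> (u \<cdot> g) = Zero C s\<^sub>1 ?R" by (intro Gen0 Sum_Gen[OF p(1)]) simp_all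
    then have "(q \<cdot> u) \<cdot> g = Zero C s\<^sub>1 ?R" by simp
    then obtain h where h: "h \<in> Hom C b ?R" "h \<cdot> p = q \<cdot> u"
      using is_cokernel_desc[OF p(5), of "q \<cdot> u"] by auto
    note [simp] = h(1)[unfolded Hom_iff]
    have "(\<rho> \<cdot> h) \<cdot> p = f \<cdot> p" using h(2) Comp_reduce[OF \<rho>(2), of u] u(2) by simp
    then have \<rho>h: "\<rho> \<cdot> h = f"
      by (rule is_epiD[OF is_cokernel_epi[OF p(5)]]) simp_all
    show "\<exists>!h. h \<in> Hom C b ?R \<and> \<rho> \<cdot> h = f"
    proof (rule ex1I[of _ h])
      fix h' assume h': "h' \<in> Hom C b ?R \<and> \<rho> \<cdot> h' = f"
      then have "\<rho> \<cdot> sub h' h = Zero C b a" using \<rho>h sub_eq_Zero_iff[OF f f] by simp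
      then have "sub h' h = Zero C b ?R" using h' by (intro zero[OF b]) simp_all
      then show "h' = h" using h h' sub_eq_Zero_iff by blast
    qed (use h \<rho>h in simp)
  qed
qed

end

subsection \<open>Full subcategories\<close>

lemma full_subcategory_simps [simp]:
  "Ob (full_subcategory C B) = B"
  "Ar (full_subcategory C B) = {f \<in> Ar C. Dom C f \<in> B \<and> Cod C f \<in> B}"
  "Dom (full_subcategory C B) = Dom C"
  "Cod (full_subcategory C B) = Cod C"
  "Ident (full_subcategory C B) = Ident C"
  "Comp (full_subcategory C B) = Comp C"
  by (simp_all add: full_subcategory_def)

lemma full_subcategory_additive_simps [simp]:
  fixes C :: "('o, 'm, 'z) preadditive_data_scheme"
  shows "Add (full_subcategory C B) = Add C" "Zero (full_subcategory C B) = Zero C"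
  by (simp_all add: full_subcategory_def)

lemma Hom_full_subcategory:
  "Hom (full_subcategory C B) a b = (if a \<in> B \<and> b \<in> B then Hom C a b else {})"
  by (auto simp: Hom_def)

lemma Hom_group_full_subcategory:
  "\<lbrakk>a \<in> B; b \<in> B\<rbrakk> \<Longrightarrow> Hom_group (full_subcategory C B) a b = Hom_group C a b"
  by (simp add: Hom_group_def Hom_full_subcategory)

lemma is_biproduct_full_subcategory:
  "\<lbrakk>a \<in> B; b \<in> B; c \<in> B; B \<subseteq> Ob C\<rbrakk> \<Longrightarrow>
    is_biproduct (full_subcategory C B) a b c i\<^sub>1 i\<^sub>2 p\<^sub>1 p\<^sub>2 \<longleftrightarrow> is_biproduct C a b c i\<^sub>1 i\<^sub>2 p\<^sub>1 p\<^sub>2"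
  by (auto simp: is_biproduct_def Hom_full_subcategory)

text \<open>The subcategory has fewer test objects. The converse direction is not automatic;
  exactness of the inclusion provides it below.\<close>

lemma is_kernel_full_subcategory:
  assumes "is_kernel C f k" "f \<in> Ar (full_subcategory C B)" "Dom C k \<in> B" "B \<subseteq> Ob C"
  shows "is_kernel (full_subcategory C B) f k"
  using assms unfolding is_kernel_def by (auto simp: Hom_full_subcategory subset_iff)

lemma is_cokernel_full_subcategory:
  assumes "is_cokernel C f q" "f \<in> Ar (full_subcategory C B)" "Cod C q \<in> B" "B \<subseteq> Ob C"
  shows "is_cokernel (full_subcategory C B) f q"
  using assms unfolding is_cokernel_def by (auto simp: Hom_full_subcategory subset_iff)

section \<open>Coreflective subcategories described by universal arrows\<close>

context category
begin

lemma category_full_subcategory: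
  assumes "B \<subseteq> Ob C"
  shows "category (full_subcategory C B)"
  by unfold_locales
    (use assms in \<open>auto simp: Hom_full_subcategory split: if_splits simp del: Hom_iff
      intro: Comp_closed Comp_assoc Comp_Ident_left Comp_Ident_right Ident_closed\<close>)

lemma is_functor_inclusion:
  "is_functor (full_subcategory C B) C (\<lambda>a. a) (\<lambda>f. f)" if "B \<subseteq> Ob C"
  using that by (auto simp: is_functor_def Hom_full_subcategory simp del: Hom_iff)

text \<open>The universal arrows \<open>\<rho> a\<close> form the counit. The adjunction bijection
  is the unique lifting along \<open>\<rho>\<close>, and all laws follow from uniqueness.\<close>

lemma coreflective_subcategoryI:
  assumes rep: "replete C B"
    and cor: "\<And>a. a \<in> Ob C \<Longrightarrow> \<exists>r \<rho>. r \<in> B \<and> \<rho> \<in> Hom C r a \<and>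
      (\<forall>b \<in> B. \<forall>f \<in> Hom C b a. \<exists>!h. h \<in> Hom C b r \<and> \<rho> \<cdot> h = f)"
  shows "coreflective_subcategory C B"
proof -
  have B: "B \<subseteq> Ob C" using rep by (simp add: replete_def)
  obtain r \<rho> where r: "\<And>a. a \<in> Ob C \<Longrightarrow> r a \<in> B" and \<rho>: "\<And>a. a \<in> Ob C \<Longrightarrow> \<rho> a \<in> Hom C (r a) a"
    and ex1: "\<And>a b f. \<lbrakk>a \<in> Ob C; b \<in> B; f \<in> Hom C b a\<rbrakk> \<Longrightarrow> \<exists>!h. h \<in> Hom C b (r a) \<and> \<rho> a \<cdot> h = f"
    using cor by metis
  define lift where "lift a b f = (THE h. h \<in> Hom C b (r a) \<and> \<rho> a \<cdot> h = f)" for a b f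
  have lift: "lift a b f \<in> Hom C b (r a)" "\<rho> a \<cdot> lift a b f = f"
    if "a \<in> Ob C" "b \<in> B" "f \<in> Hom C b a" for a b f
    using theI'[OF ex1[OF that]] unfolding lift_def by blast+
  have liftI: "lift a b f = h"
    if "a \<in> Ob C" "b \<in> B" "f \<in> Hom C b a" "h \<in> Hom C b (r a)" "\<rho> a \<cdot> h = f" for a b f h
    using lift[OF that(1-3)] ex1[OF that(1-3)] that(4,5) by blast
  \<comment> \<open>Naturality of the counit forces this choice. By \<open>GmI\<close> any arrow
    filling the naturality square equals it, which yields functoriality.\<close>
  define Gm where "Gm g = lift (Cod C g) (r (Dom C g)) (g \<cdot> \<rho> (Dom C g))" for g
  have Gm: "Gm g \<in> Hom C (r a) (r a')" "\<rho> a' \<cdot> Gm g = g \<cdot> \<rho> a" if "g \<in> Hom C a a'" for g a a'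
  proof -
    have a: "a \<in> Ob C" "a' \<in> Ob C" "Dom C g = a" "Cod C g = a'" using that Hom_Ob[OF that] by simp_all
    have "g \<cdot> \<rho> a \<in> Hom C (r a) a'" by (rule Comp_closed[OF \<rho>[OF a(1)] that])
    then show "Gm g \<in> Hom C (r a) (r a')" "\<rho> a' \<cdot> Gm g = g \<cdot> \<rho> a"
      unfolding Gm_def a(3,4) using lift a(1,2) r by blast+
  qed
  have GmI: "Gm g = h" if "g \<in> Hom C a a'" "h \<in> Hom C (r a) (r a')" "\<rho> a' \<cdot> h = g \<cdot> \<rho> a" for g a a' h
  proof -
    have a: "a \<in> Ob C" "a' \<in> Ob C" "Dom C g = a" "Cod C g = a'" using that Hom_Ob[OF that(1)] by simp_all
    have "g \<cdot> \<rho> a \<in> Hom C (r a) a'" by (rule Comp_closed[OF \<rho>[OF a(1)] that(1)])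
    then show ?thesis unfolding Gm_def a(3,4) using liftI a(1,2) r that by blast
  qed
  have "is_functor C (full_subcategory C B) r Gm"
    unfolding is_functor_def
  proof (intro conjI ballI)
    show "r a \<in> Ob (full_subcategory C B)" if "a \<in> Ob C" for a using r that by simp
    show "Gm f \<in> Hom (full_subcategory C B) (r a) (r b)"
      if "a \<in> Ob C" "b \<in> Ob C" "f \<in> Hom C a b" for a b f
      using that r Gm by (simp add: Hom_full_subcategory del: Hom_iff)
    show "Gm (Ident C a) = Ident (full_subcategory C B) (r a)" if a: "a \<in> Ob C" for a
    proof -
      have "r a \<in> Ob C" using r a B by blast
      then have "Gm (Ident C a) = Ident C (r a)"
        using \<rho>[OF a] a by (intro GmI[of _ a a]) simp_all
      then show ?thesis by simp
    qed
    fix a b c f g assume f: "f \<in> Hom C a b" and g: "g \<in> Hom C b c" and abc: "a \<in> Ob C" "b \<in> Ob C" "c \<in> Ob C"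
    have "\<rho> c \<cdot> (Gm g \<cdot> Gm f) = (\<rho> c \<cdot> Gm g) \<cdot> Gm f"
      by (rule Comp_assoc[OF Gm(1)[OF f] Gm(1)[OF g] \<rho>[OF abc(3)], symmetric])
    also have "\<dots> = g \<cdot> (\<rho> b \<cdot> Gm f)"
      unfolding Gm(2)[OF g] by (rule Comp_assoc[OF Gm(1)[OF f] \<rho>[OF abc(2)] g])
    also have "\<dots> = (g \<cdot> f) \<cdot> \<rho> a"
      unfolding Gm(2)[OF f] by (rule Comp_assoc[OF \<rho>[OF abc(1)] f g, symmetric])
    finally have "Gm (g \<cdot> f) = Gm g \<cdot> Gm f"
      by (rule GmI[OF Comp_closed[OF f g] Comp_closed[OF Gm(1)[OF f] Gm(1)[OF g]]])
    then show "Gm (g \<cdot> f) = Comp (full_subcategory C B) (Gm g) (Gm f)" by simp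
  qed
  moreover have "bij_betw (\<lambda>f. lift d c f) (Hom C c d) (Hom (full_subcategory C B) c (r d))"
    if "c \<in> B" "d \<in> Ob C" for c d
  proof (rule bij_betw_byWitness[of _ "\<lambda>h. \<rho> d \<cdot> h"])
    have H: "Hom (full_subcategory C B) c (r d) = Hom C c (r d)"
      using that r by (simp add: Hom_full_subcategory del: Hom_iff)
    show "\<forall>f \<in> Hom C c d. \<rho> d \<cdot> lift d c f = f" using lift that by blast
    show "\<forall>h \<in> Hom (full_subcategory C B) c (r d). lift d c (\<rho> d \<cdot> h) = h"
      unfolding H using liftI that Comp_closed \<rho> by blast
    show "(\<lambda>f. lift d c f) ` Hom C c d \<subseteq> Hom (full_subcategory C B) c (r d)"
      unfolding H using lift that by blast
    show "(\<lambda>h. \<rho> d \<cdot> h) ` Hom (full_subcategory C B) c (r d) \<subseteq> Hom C c d"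
      unfolding H using that Comp_closed \<rho> by blast
  qed
  moreover have "lift d' c' (k \<cdot> f \<cdot> h) = Gm k \<cdot> lift d c f \<cdot> h"
    if c: "c \<in> B" "c' \<in> B" "d \<in> Ob C" "d' \<in> Ob C" and h: "h \<in> Hom C c' c" and f: "f \<in> Hom C c d"
      and k: "k \<in> Hom C d d'" for c c' d d' h f k
  proof (rule liftI[OF c(4,2)])
    note l = lift[OF c(3,1) f]
    show "k \<cdot> f \<cdot> h \<in> Hom C c' d'" using h f k by simp
    show "Gm k \<cdot> lift d c f \<cdot> h \<in> Hom C c' (r d')" using h l(1) Gm(1)[OF k] by simp
    have "\<rho> d' \<cdot> (Gm k \<cdot> lift d c f \<cdot> h) = (\<rho> d' \<cdot> Gm k) \<cdot> (lift d c f \<cdot> h)"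
      using h l(1) Gm(1)[OF k] \<rho>[OF c(4)] by simp
    also have "\<dots> = k \<cdot> (\<rho> d \<cdot> lift d c f) \<cdot> h"
      unfolding Gm(2)[OF k] using h l(1) k \<rho>[OF c(3)] by simp
    finally show "\<rho> d' \<cdot> (Gm k \<cdot> lift d c f \<cdot> h) = k \<cdot> f \<cdot> h" by (simp only: l(2))
  qed
  ultimately have "adjunction (full_subcategory C B) C (\<lambda>a. a) (\<lambda>f. f) r Gm (\<lambda>c d f. lift d c f)"
    using is_functor_inclusion[OF B]
    unfolding adjunction_def by (simp add: Hom_full_subcategory del: Hom_iff)
  then show ?thesis using rep unfolding coreflective_subcategory_def by blast
qed

text \<open>The counit is the preimage of the identity under \<open>\<phi>\<close>. By naturality,
  composing with it is inverse to \<open>\<phi>\<close>.\<close>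

lemma coreflective_subcategoryD:
  assumes cor: "coreflective_subcategory C B" and a: "a \<in> Ob C"
  obtains r \<rho> where "r \<in> B" "\<rho> \<in> Hom C r a"
    "\<And>b f. \<lbrakk>b \<in> B; f \<in> Hom C b a\<rbrakk> \<Longrightarrow> \<exists>!h. h \<in> Hom C b r \<and> \<rho> \<cdot> h = f"
proof -
  have B: "B \<subseteq> Ob C" using cor by (simp add: replete_def coreflective_subcategory_def)
  obtain Go Gm \<phi> where adj: "adjunction (full_subcategory C B) C (\<lambda>a. a) (\<lambda>f. f) Go Gm \<phi>"
    using cor unfolding coreflective_subcategory_def by blast
  let ?r = "Go a"
  have F: "is_functor C (full_subcategory C B) Go Gm" using adj by (simp add: adjunction_def)
  have r: "?r \<in> B" using F a by (simp add: is_functor_def)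
  then have r': "?r \<in> Ob C" using B by blast
  have bij: "bij_betw (\<phi> b a) (Hom C b a) (Hom C b ?r)" if "b \<in> B" for b
  proof -
    have "bij_betw (\<phi> b a) (Hom C b a) (Hom (full_subcategory C B) b ?r)"
      using adj that a unfolding adjunction_def full_subcategory_simps by blast
    then show ?thesis using that r by (simp add: Hom_full_subcategory del: Hom_iff)
  qed
  have "Ident C ?r \<in> Hom C ?r ?r" using r' by simp
  then obtain \<rho> where \<rho>: "\<rho> \<in> Hom C ?r a" "\<phi> ?r a \<rho> = Ident C ?r"
    using bij[OF r] by (metis bij_betw_imp_surj_on imageE)
  have GI: "Gm (Ident C a) = Ident C ?r" using F a by (simp add: is_functor_def)
  have nat: "\<phi> b a (\<rho> \<cdot> h) = h" if b: "b \<in> B" and h: "h \<in> Hom C b ?r" for b h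
  proof -
    have "\<phi> b a (Ident C a \<cdot> \<rho> \<cdot> h) = Gm (Ident C a) \<cdot> \<phi> ?r a \<rho> \<cdot> h"
      using adj b h r a \<rho>(1) Ident_closed[OF a] unfolding adjunction_def
      by (simp add: Hom_full_subcategory del: Hom_iff)
    then show ?thesis using \<rho> h r' a by (simp add: GI)
  qed
  show ?thesis
  proof (rule that[OF r \<rho>(1)])
    fix b f assume b: "b \<in> B" and f: "f \<in> Hom C b a"
    have h: "\<phi> b a f \<in> Hom C b ?r" using bij[OF b] f by (meson bij_betwE)
    have "\<phi> b a (\<rho> \<cdot> \<phi> b a f) = \<phi> b a f" by (rule nat[OF b h])
    then have "\<rho> \<cdot> \<phi> b a f = f"
      using bij[OF b] Comp_closed[OF h \<rho>(1)] f unfolding bij_betw_def inj_on_def by blast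
    then show "\<exists>!h. h \<in> Hom C b ?r \<and> \<rho> \<cdot> h = f" using h nat[OF b] by metis
  qed
qed

end

context preadditive_category
begin

text \<open>With repleteness, membership of one kernel in a subcategory passes to all
  others.\<close>

lemma kernel_isomorphic:
  assumes k: "is_kernel C f k" and k': "is_kernel C f k'"
  shows "isomorphic_objects C (Dom C k) (Dom C k')"
proof -
  note [simp] = is_kernel_Hom[OF k] is_kernel_Hom[OF k']
  obtain h where h: "h \<in> Hom C (Dom C k) (Dom C k')" "k' \<cdot> h = k"
    by (rule is_kernel_lift[OF k', of k]) simp_all
  obtain h' where h': "h' \<in> Hom C (Dom C k') (Dom C k)" "k \<cdot> h' = k'"
    by (rule is_kernel_lift[OF k, of k']) simp_all
  note [simp] = h(1)[unfolded Hom_iff] h'(1)[unfolded Hom_iff]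
  have "h' \<cdot> h = Ident C (Dom C k)"
    by (rule is_monoD[OF is_kernel_mono[OF k], where a = "Dom C k"])
      (use h Comp_reduce[OF h'(2), of h] in simp_all)
  moreover have "h \<cdot> h' = Ident C (Dom C k')"
    by (rule is_monoD[OF is_kernel_mono[OF k'], where a = "Dom C k'"])
      (use h' Comp_reduce[OF h(2), of h'] in simp_all)
  moreover have "Dom C k \<in> Ob C" "Dom C k' \<in> Ob C" by simp_all
  ultimately show ?thesis using h(1) h'(1) unfolding isomorphic_objects_def by blast
qed

lemma mono_if_kernel_Zero:
  assumes k: "is_kernel C f k" and k0: "k = Zero C (Dom C k) (Dom C f)"
  shows "is_mono C f"
  unfolding is_mono_iff_Zero
proof (intro conjI ballI impI)
  note [simp] = is_kernel_Hom[OF k]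
  show "f \<in> Ar C" by simp
  fix g assume g: "g \<in> Ar C" "Cod C g = Dom C f" "f \<cdot> g = Zero C (Dom C g) (Cod C f)"
  then obtain h where h: "h \<in> Hom C (Dom C g) (Dom C k)" "k \<cdot> h = g"
    using is_kernel_lift[OF k, of g] by auto
  have "k \<cdot> h = Zero C (Dom C k) (Dom C f) \<cdot> h" by (rule arg_cong[OF k0])
  also have "\<dots> = Zero C (Dom C g) (Dom C f)" using h(1) by simp
  finally show "g = Zero C (Dom C g) (Dom C f)" by (simp only: h(2))
qed

lemma epi_if_cokernel_Zero:
  assumes q: "is_cokernel C f q" and q0: "q = Zero C (Cod C f) (Cod C q)"
  shows "is_epi C f"
  unfolding is_epi_iff_Zero
proof (intro conjI ballI impI)
  note [simp] = is_cokernel_Hom[OF q]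
  show "f \<in> Ar C" by simp
  fix g assume g: "g \<in> Ar C" "Dom C g = Cod C f" "g \<cdot> f = Zero C (Dom C f) (Cod C g)"
  then obtain h where h: "h \<in> Hom C (Cod C q) (Cod C g)" "h \<cdot> q = g"
    using is_cokernel_desc[OF q, of g] by auto
  have "h \<cdot> q = h \<cdot> Zero C (Cod C f) (Cod C q)" by (rule arg_cong[OF q0])
  also have "\<dots> = Zero C (Cod C f) (Cod C g)" using h(1) by simp
  finally show "g = Zero C (Cod C f) (Cod C g)" by (simp only: h(2))
qed

lemma preadditive_full_subcategory:
  assumes "B \<subseteq> Ob C"
  shows "preadditive_category (full_subcategory C B)"
proof -
  interpret D: category "full_subcategory C B" using assms by (rule category_full_subcategory)
  show ?thesis
  proof (intro preadditive_category.intro preadditive_category_axioms.intro)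
    show "category (full_subcategory C B)" by (rule D.category_axioms)
    show "comm_group (Hom_group (full_subcategory C B) a b)"
      if "a \<in> Ob (full_subcategory C B)" "b \<in> Ob (full_subcategory C B)" for a b
      using that assms Hom_comm_group[of a b] by (auto simp: Hom_group_full_subcategory)
  next
    fix f a b g c h
    assume "f \<in> Hom (full_subcategory C B) a b" "g \<in> Hom (full_subcategory C B) b c"
      "h \<in> Hom (full_subcategory C B) b c"
    then have "f \<in> Hom C a b" "g \<in> Hom C b c" "h \<in> Hom C b c" by simp_all
    then show "Comp (full_subcategory C B) (Add (full_subcategory C B) g h) f =
        Add (full_subcategory C B) (Comp (full_subcategory C B) g f) (Comp (full_subcategory C B) h f)"
      unfolding full_subcategory_simps full_subcategory_additive_simps by (rule Comp_Add_left)
  next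
    fix f a b g h c
    assume "f \<in> Hom (full_subcategory C B) a b" "g \<in> Hom (full_subcategory C B) a b"
      "h \<in> Hom (full_subcategory C B) b c"
    then have "f \<in> Hom C a b" "g \<in> Hom C a b" "h \<in> Hom C b c" by simp_all
    then show "Comp (full_subcategory C B) h (Add (full_subcategory C B) f g) =
        Add (full_subcategory C B) (Comp (full_subcategory C B) h f) (Comp (full_subcategory C B) h g)"
      unfolding full_subcategory_simps full_subcategory_additive_simps by (rule Comp_Add_right)
  qed
qed

end

section \<open>Abelian exact subcategories and closure under kernels and cokernels\<close>

context abelian_category
begin

text \<open>Kernels and cokernels are computed in \<open>C\<close>. The point is that monomorphisms
  and epimorphisms of the subcategory are such in \<open>C\<close>; then normality and exactness
  transfer.\<close>

lemma abelian_exact_subcategoryI: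
  assumes rep: "replete C B"
    and zero: "\<exists>z \<in> B. is_zero_object C z"
    and biprod: "\<And>a b c i\<^sub>1 i\<^sub>2 p\<^sub>1 p\<^sub>2. \<lbrakk>a \<in> B; b \<in> B; is_biproduct C a b c i\<^sub>1 i\<^sub>2 p\<^sub>1 p\<^sub>2\<rbrakk> \<Longrightarrow> c \<in> B"
    and ker: "\<And>f a b k. \<lbrakk>f \<in> Hom C a b; a \<in> B; b \<in> B; is_kernel C f k\<rbrakk> \<Longrightarrow> Dom C k \<in> B"
    and coker: "\<And>f a b q. \<lbrakk>f \<in> Hom C a b; a \<in> B; b \<in> B; is_cokernel C f q\<rbrakk> \<Longrightarrow> Cod C q \<in> B"
  shows "abelian_exact_subcategory C B"
proof -
  have B: "B \<subseteq> Ob C" using rep by (simp add: replete_def)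
  let ?D = "full_subcategory C B"
  interpret D: preadditive_category ?D using B by (rule preadditive_full_subcategory)
  have ker': "Dom C k \<in> B" if "f \<in> Ar ?D" "is_kernel C f k" for f k using that ker[of f "Dom C f" "Cod C f" k] by simp
  have coker': "Cod C q \<in> B" if "f \<in> Ar ?D" "is_cokernel C f q" for f q using that coker[of f "Dom C f" "Cod C f" q] by simp
  \<comment> \<open>The kernel of \<open>f\<close> in \<open>C\<close> lies in \<open>B\<close>, so
    it is a test morphism of the subcategory and vanishes.\<close>
  have mono: "is_mono C f" if f: "is_mono ?D f" for f
  proof -
    have fD: "f \<in> Ar ?D" using f by (rule D.is_mono_Ar)
    then have [simp]: "f \<in> Ar C" "Dom C f \<in> B" "Cod C f \<in> B" by simp_all
    obtain k where k: "is_kernel C f k" using ex_kernel[of f] by auto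
    note [simp] = is_kernel_Hom[OF k] ker'[OF fD k]
    have k0: "k = Zero C (Dom C k) (Dom C f)"
      using D.mono_cancel_Zero[OF f, of "Dom C f" "Cod C f" k "Dom C k"] by simp
    show "is_mono C f" by (rule mono_if_kernel_Zero[OF k k0])
  qed
  have epi: "is_epi C f" if f: "is_epi ?D f" for f
  proof -
    have fD: "f \<in> Ar ?D" using f by (rule D.is_epi_Ar)
    then have [simp]: "f \<in> Ar C" "Dom C f \<in> B" "Cod C f \<in> B" by simp_all
    obtain q where q: "is_cokernel C f q" using ex_cokernel[of f] by auto
    note [simp] = is_cokernel_Hom[OF q] coker'[OF fD q]
    have q0: "q = Zero C (Cod C f) (Cod C q)"
      using D.epi_cancel_Zero[OF f, of "Dom C f" "Cod C f" q "Cod C q"] by simp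
    show "is_epi C f" by (rule epi_if_cokernel_Zero[OF q q0])
  qed
  have abelian: "abelian_category ?D"
  proof unfold_locales
    show "\<exists>z. is_zero_object ?D z"
    proof -
      obtain z where z: "z \<in> B" "is_zero_object C z" using zero by blast
      then have "is_zero_object ?D z"
        using B unfolding is_zero_object_def full_subcategory_simps
        by (simp add: Hom_full_subcategory subset_iff del: Hom_iff D.Hom_iff)
      then show ?thesis by blast
    qed
    show "\<exists>c i\<^sub>1 i\<^sub>2 p\<^sub>1 p\<^sub>2. is_biproduct ?D a b c i\<^sub>1 i\<^sub>2 p\<^sub>1 p\<^sub>2" if "a \<in> Ob ?D" "b \<in> Ob ?D" for a b
    proof -
      have ab: "a \<in> B" "b \<in> B" using that by simp_all
      then obtain c i\<^sub>1 i\<^sub>2 p\<^sub>1 p\<^sub>2 where bp: "is_biproduct C a b c i\<^sub>1 i\<^sub>2 p\<^sub>1 p\<^sub>2"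
        using ex_biproduct B by blast
      then have "is_biproduct ?D a b c i\<^sub>1 i\<^sub>2 p\<^sub>1 p\<^sub>2"
        using is_biproduct_full_subcategory[OF ab biprod[OF ab bp] B] by blast
      then show ?thesis by blast
    qed
    show "\<exists>k. is_kernel ?D f k" if "f \<in> Ar ?D" for f
      using ex_kernel[of f] is_kernel_full_subcategory[OF _ that ker'[OF that] B] that by auto
    show "\<exists>q. is_cokernel ?D f q" if "f \<in> Ar ?D" for f
      using ex_cokernel[of f] is_cokernel_full_subcategory[OF _ that coker'[OF that] B] that by auto
    show "\<exists>g. is_kernel ?D g f" if f: "is_mono ?D f" for f
    proof -
      have fD: "f \<in> Ar ?D" using f by (rule D.is_mono_Ar)
      obtain q where q: "is_cokernel C f q" "is_kernel C q f" by (rule mono_ex_cokernel[OF mono[OF f]])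
      have "q \<in> Ar ?D" using is_cokernel_Hom[OF q(1)] coker'[OF fD q(1)] fD by simp
      then show ?thesis using is_kernel_full_subcategory[OF q(2) _ _ B] fD by auto
    qed
    show "\<exists>g. is_cokernel ?D g f" if f: "is_epi ?D f" for f
    proof -
      have fD: "f \<in> Ar ?D" using f by (rule D.is_epi_Ar)
      obtain k where k: "is_kernel C f k" "is_cokernel C k f" by (rule epi_ex_kernel[OF epi[OF f]])
      have "k \<in> Ar ?D" using is_kernel_Hom[OF k(1)] ker'[OF fD k(1)] fD by simp
      then show ?thesis using is_cokernel_full_subcategory[OF k(2) _ _ B] fD by auto
    qed
  qed
  have "short_exact C f g" if se: "short_exact ?D f g" for f g
  proof -
    have fD: "is_kernel ?D g f" and gD: "is_cokernel ?D f g" using se by (simp_all add: short_exact_def)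
    have [simp]: "g \<in> Ar C" "f \<in> Ar C" "Dom C f \<in> B" "Cod C f \<in> B" "Dom C g = Cod C f" "Cod C g \<in> B"
      "g \<cdot> f = Zero C (Dom C f) (Cod C g)"
      using D.is_kernel_Hom[OF fD] by simp_all
    have gAr: "g \<in> Ar ?D" by simp
    obtain k where k: "is_kernel C g k" using ex_kernel[of g] by auto
    note kB = ker'[OF gAr k]
    have kD: "is_kernel ?D g k" by (rule is_kernel_full_subcategory[OF k gAr kB B])
    note [simp] = is_kernel_Hom(2,3)[OF k] kB
    \<comment> \<open>The kernel \<open>k\<close> in \<open>C\<close> lies in \<open>B\<close> and
      so factors through \<open>f\<close>. Hence every morphism killed by \<open>g\<close> factors
      through \<open>f\<close>, also from objects outside \<open>B\<close>.\<close>
    obtain h where h: "h \<in> Hom C (Dom C k) (Dom C f)" "f \<cdot> h = k"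
      using D.is_kernel_lift[OF fD, of k] is_kernel_Hom(4)[OF k] by auto
    note [simp] = h(1)[unfolded Hom_iff]
    have fm: "is_mono C f" by (rule mono[OF D.is_kernel_mono[OF fD]])
    have "is_kernel C g f"
    proof (rule is_kernelI[OF _ _ _ fm])
      fix x assume x: "x \<in> Ar C" "Cod C x = Cod C f" "g \<cdot> x = Zero C (Dom C x) (Cod C g)"
      then obtain y where y: "y \<in> Hom C (Dom C x) (Dom C k)" "k \<cdot> y = x"
        using is_kernel_lift[OF k, of x] by auto
      then have "f \<cdot> (h \<cdot> y) = x" using Comp_reduce[OF h(2), of y] by simp
      then show "\<exists>h. h \<in> Hom C (Dom C x) (Dom C f) \<and> f \<cdot> h = x"
        using y by (intro exI[of _ "h \<cdot> y"]) simp
    qed simp_all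
    moreover have "is_cokernel C f g"
    proof -
      obtain k' where "is_kernel C g k'" "is_cokernel C k' g"
        by (rule epi_ex_kernel[OF epi[OF D.is_cokernel_epi[OF gD]]])
      then show ?thesis using epi_is_cokernel_of_kernel calculation by blast
    qed
    ultimately show ?thesis by (simp add: short_exact_def)
  qed
  then have "exact_functor ?D C (\<lambda>a. a) (\<lambda>f. f)"
    using is_functor_inclusion[OF B] by (simp add: exact_functor_def)
  then show ?thesis using rep abelian by (simp add: abelian_exact_subcategory_def)
qed

text \<open>The inclusion is only known to preserve short exact sequences, so \<open>f\<close> is
  factored in the subcategory into an epimorphism \<open>e\<close> and a monomorphism
  \<open>m\<close>. Exactness makes \<open>m\<close> mono in \<open>C\<close> and the kernel of
  \<open>e\<close> a kernel in \<open>C\<close>, and this is then a kernel of \<open>f\<close> as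
  well.\<close>

lemma abelian_exact_subcategory_kernel:
  assumes ex: "abelian_exact_subcategory C B" and f: "f \<in> Hom C a b" and ab: "a \<in> B" "b \<in> B"
    and k: "is_kernel C f k"
  shows "Dom C k \<in> B"
proof -
  let ?D = "full_subcategory C B"
  have rep: "replete C B" and se: "\<And>f g. short_exact ?D f g \<Longrightarrow> short_exact C f g"
    using ex by (simp_all add: abelian_exact_subcategory_def exact_functor_def)
  interpret D: abelian_category ?D using ex by (simp add: abelian_exact_subcategory_def)
  have fD: "f \<in> Ar ?D" using f ab by simp
  obtain k' where k': "is_kernel ?D f k'" using D.ex_kernel[OF fD] by blast
  obtain c where c: "is_cokernel ?D f c" using D.ex_cokernel[OF fD] by blast
  obtain m where m: "is_kernel ?D c m" using D.ex_kernel[OF D.is_cokernel_Hom(2)[OF c]] by blast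
  obtain e where e: "e \<in> Hom ?D (Dom ?D f) (Dom ?D m)" "Comp ?D m e = f" "is_epi ?D e"
    by (rule D.epi_mono_factorization[OF fD c m])
  have [simp]: "f \<in> Ar C" "Dom C f = a" "Cod C f = b" using f by simp_all
  have [simp]: "e \<in> Ar C" "Dom C e = a" "Cod C e = Dom C m" "m \<cdot> e = f" using e by simp_all
  have [simp]: "m \<in> Ar C" "Dom C m \<in> B" "Cod C m = b"
    using D.is_kernel_Hom[OF m] D.is_cokernel_Hom[OF c] by simp_all
  have [simp]: "k' \<in> Ar C" "Dom C k' \<in> B" "Cod C k' = a" and fk': "f \<cdot> k' = Zero C (Dom C k') b"
    using D.is_kernel_Hom[OF k'] by simp_all
  have [simp]: "Dom C m \<in> Ob C" "b \<in> Ob C" "Dom C k' \<in> Ob C" by (simp_all add: Hom_Ob(2)[OF f])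
  have mD: "is_mono ?D m" by (rule D.is_kernel_mono[OF m])
  obtain c' where "is_cokernel ?D m c'" "is_kernel ?D c' m" by (rule D.mono_ex_cokernel[OF mD])
  then have "short_exact C m c'" by (intro se) (simp add: short_exact_def)
  then have mm: "is_mono C m" using is_kernel_mono by (auto simp: short_exact_def)
  have m': "m \<in> Hom C (Dom C m) b" by simp
  have "m \<cdot> (e \<cdot> k') = Zero C (Dom C k') b" using Comp_reduce[of m e f k'] fk' by simp
  then have ek': "e \<cdot> k' = Zero C (Dom C k') (Dom C m)"
    by (rule mono_cancel_Zero[OF mm m', rotated]) simp
  have "is_kernel ?D e k'"
  proof (rule D.is_kernelI[of _ a "Dom C m" _ "Dom C k'"])
    show "is_mono ?D k'" by (rule D.is_kernel_mono[OF k'])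
    fix g assume g: "g \<in> Ar ?D" "Cod ?D g = a" "Comp ?D e g = Zero ?D (Dom ?D g) (Dom C m)"
    then have "f \<cdot> g = m \<cdot> (e \<cdot> g)" using Comp_reduce[of m e f g] by simp
    then have "f \<cdot> g = Zero C (Dom C g) b" using g by simp
    then show "\<exists>h. h \<in> Hom ?D (Dom ?D g) (Dom C k') \<and> Comp ?D k' h = g"
      using D.is_kernel_lift[OF k', of g] g ab by auto
  qed (use ab ek' in simp_all)
  moreover obtain j where "is_kernel ?D e j" "is_cokernel ?D j e" by (rule D.epi_ex_kernel[OF e(3)])
  ultimately have "is_kernel ?D e k'" "is_cokernel ?D k' e" using D.epi_is_cokernel_of_kernel by blast+
  then have "short_exact C k' e" by (intro se) (simp add: short_exact_def)
  then have ker_e: "is_kernel C e k'" by (simp add: short_exact_def)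
  have "is_kernel C f k'"
  proof (rule is_kernelI[OF f _ fk' is_kernel_mono[OF ker_e]])
    show "k' \<in> Hom C (Dom C k') a" by simp
    fix g assume g: "g \<in> Ar C" "Cod C g = a" "f \<cdot> g = Zero C (Dom C g) b"
    then have "m \<cdot> (e \<cdot> g) = Zero C (Dom C g) b" using Comp_reduce[of m e f g] by simp
    then have "e \<cdot> g = Zero C (Dom C g) (Dom C m)"
      by (rule mono_cancel_Zero[OF mm m', rotated]) (use g in simp)
    then show "\<exists>h. h \<in> Hom C (Dom C g) (Dom C k') \<and> k' \<cdot> h = g"
      using is_kernel_lift[OF ker_e, of g] g by auto
  qed
  then have "isomorphic_objects C (Dom C k') (Dom C k)" using k by (rule kernel_isomorphic)
  moreover have "Dom C k' \<in> B" by simp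
  ultimately show ?thesis using rep unfolding replete_def by blast
qed

text \<open>With fewer test objects \<open>f\<close> stays mono in the subcategory, where it begins
  a short exact sequence that the inclusion preserves.\<close>

lemma abelian_exact_subcategory_cokernel_of_mono:
  assumes ex: "abelian_exact_subcategory C B" and f: "f \<in> Hom C a b" and ab: "a \<in> B" "b \<in> B"
    and m: "is_mono C f"
  obtains q where "is_cokernel C f q" "Cod C q \<in> B"
proof -
  let ?D = "full_subcategory C B"
  have rep: "replete C B" and se: "\<And>f g. short_exact ?D f g \<Longrightarrow> short_exact C f g"
    using ex by (simp_all add: abelian_exact_subcategory_def exact_functor_def)
  have B: "B \<subseteq> Ob C" using rep by (simp add: replete_def)
  interpret D: abelian_category ?D using ex by (simp add: abelian_exact_subcategory_def)
  have "f \<in> Ar C" "Dom C f = a" "Cod C f = b" using f by simp_all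
  then have "is_mono ?D f"
    using m ab B unfolding is_mono_def
    by (simp add: Hom_full_subcategory subset_iff del: Hom_iff D.Hom_iff) blast
  then obtain q where q: "is_cokernel ?D f q" "is_kernel ?D q f" by (rule D.mono_ex_cokernel)
  then have "short_exact C f q" by (intro se) (simp add: short_exact_def)
  then show ?thesis using that[of q] D.is_cokernel_Hom(2)[OF q(1)] by (simp add: short_exact_def)
qed

end

section \<open>The implications between the subcategory properties and the conditions on
  \<open>\<U>\<close>\<close>

context cocomplete_abelian_with_small_set
begin

lemma replete_Pres: "replete C PresU"
  unfolding replete_def
proof (intro conjI ballI allI impI)
  show "PresU \<subseteq> Ob C" using Pres_Ob by blast
  fix a b assume a: "a \<in> PresU" and iso: "isomorphic_objects C a b"
  obtain s t f p where p: "s \<in> SumU" "t \<in> SumU" "f \<in> Hom C s t" "p \<in> Hom C t a" "is_cokernel C f p"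
    by (rule PresE[OF a])
  then have "isomorphic_objects C (Cod C p) b" "b \<in> Ob C" using iso by (simp_all add: isomorphic_objects_def)
  then show "b \<in> PresU" using p(1-3,5) unfolding Pres_def by blast
qed

lemma abelian_exact_coreflective_Pres:
  assumes "Sum_kernels_generated \<kappa> C \<U>" "condition_c \<kappa> C \<U>"
  shows "coreflective_subcategory C PresU" "abelian_exact_subcategory C PresU"
proof -
  show "coreflective_subcategory C PresU"
    using coreflective_subcategoryI[OF replete_Pres] Pres_coreflection[OF assms] by metis
  show "abelian_exact_subcategory C PresU"
  proof (rule abelian_exact_subcategoryI[OF replete_Pres])
    show "\<exists>z\<in>PresU. is_zero_object C z" using ex_zero_object zero_object_Sum Sum_Pres by blast
  qed (use biproduct_Pres kernel_Pres[OF assms] cokernel_Pres[OF assms] in blast)+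
qed

lemma abelian_exact_imp_Sum_kernels_generated:
  assumes "abelian_exact_subcategory C PresU"
  shows "Sum_kernels_generated \<kappa> C \<U>"
  unfolding Sum_kernels_generated_def
  using abelian_exact_subcategory_kernel[OF assms] Sum_Pres Pres_Gen by blast

lemma coreflective_abelian_exact_imp_condition_a:
  assumes cor: "coreflective_subcategory C PresU" and ex: "abelian_exact_subcategory C PresU"
  shows "condition_a \<kappa> C \<U>"
  unfolding condition_a_def no_maps_mod_trace_def
proof (intro ballI allI impI, elim conjE)
  fix S k t q U
  assume S: "S \<in> SumU" and k: "is_mono C k" "Cod C k = S" and t: "is_trace \<kappa> C \<U> (Dom C k) t"
    and q: "is_cokernel C t q" and U: "U \<in> \<U>"
  let ?K = "Dom C k" and ?X = "Cod C q"
  have [simp]: "k \<in> Ar C" "Cod C k = S" "S \<in> Ob C" using k Sum_Ob[OF S] by (simp_all add: is_mono_Ar)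
  have [simp]: "t \<in> Ar C" "Cod C t = ?K" using t by (simp_all add: is_trace_def is_mono_Ar)
  note [simp] = is_cokernel_Hom[OF q]
  have k': "k \<in> Hom C ?K S" by simp
  obtain R \<rho> where R: "R \<in> PresU" "\<rho> \<in> Hom C R ?K"
    and univ: "\<And>b f. \<lbrakk>b \<in> PresU; f \<in> Hom C b ?K\<rbrakk> \<Longrightarrow> \<exists>!h. h \<in> Hom C b R \<and> \<rho> \<cdot> h = f"
    by (rule coreflective_subcategoryD[OF cor, of ?K]) auto
  note [simp] = R(2)[unfolded Hom_iff] Pres_Ob[OF R(1)]
  have k\<rho>: "k \<cdot> \<rho> \<in> Hom C R S" by simp
  \<comment> \<open>The kernel of \<open>k \<cdot> \<rho>\<close> is presented and
    \<open>\<rho>\<close> kills it, so it vanishes by uniqueness of factorizations through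
    \<open>\<rho>\<close>.\<close>
  have k\<rho>_mono: "is_mono C (k \<cdot> \<rho>)"
  proof -
    obtain n where n: "is_kernel C (k \<cdot> \<rho>) n" using ex_kernel[of "k \<cdot> \<rho>"] by auto
    have nP: "Dom C n \<in> PresU"
      by (rule abelian_exact_subcategory_kernel[OF ex k\<rho> R(1) Sum_Pres[OF S] n])
    have [simp]: "n \<in> Ar C" "Cod C n = R" "Dom C n \<in> Ob C" using is_kernel_Hom[OF n] by simp_all
    have "k \<cdot> (\<rho> \<cdot> n) = Zero C (Dom C n) S" using is_kernel_Hom(4)[OF n] by simp
    then have "\<rho> \<cdot> n = Zero C (Dom C n) ?K" by (rule mono_cancel_Zero[OF k(1) k', rotated]) simp
    moreover have "\<rho> \<cdot> Zero C (Dom C n) R = Zero C (Dom C n) ?K"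
      "n \<in> Hom C (Dom C n) R" "Zero C (Dom C n) R \<in> Hom C (Dom C n) R" by simp_all
    moreover have "\<exists>!h. h \<in> Hom C (Dom C n) R \<and> \<rho> \<cdot> h = Zero C (Dom C n) ?K"
      by (rule univ[OF nP]) simp
    ultimately have "n = Zero C (Dom C n) R" by blast
    then show ?thesis by (intro mono_if_kernel_Zero[OF n]) simp
  qed
  obtain y where y: "is_cokernel C (k \<cdot> \<rho>) y" "Cod C y \<in> PresU"
    by (rule abelian_exact_subcategory_cokernel_of_mono[OF ex k\<rho> R(1) Sum_Pres[OF S] k\<rho>_mono])
  let ?Y = "Cod C y"
  have [simp]: "y \<in> Ar C" "Dom C y = S" "y \<cdot> (k \<cdot> \<rho>) = Zero C R ?Y"
    using is_cokernel_Hom[OF y(1)] by simp_all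
  obtain w where w: "w \<in> Hom C R (Dom C t)" "t \<cdot> w = \<rho>"
    by (rule trace_lift[OF t R(2) Pres_Gen[OF R(1)]])
  note [simp] = w(1)[unfolded Hom_iff]
  have q\<rho>: "q \<cdot> \<rho> = Zero C R ?X" using Comp_reduce[OF is_cokernel_Hom(4)[OF q], of w] w(2) by simp
  \<comment> \<open>Dividing by \<open>\<rho>\<close> or by the trace is the same:
    \<open>\<rho>\<close> factors through \<open>t\<close>, and a cover of the trace by a sum
    factors through \<open>\<rho>\<close>.\<close>
  have qc: "is_cokernel C \<rho> q"
  proof (rule is_cokernelI[OF R(2) _ q\<rho> is_cokernel_epi[OF q]])
    fix g assume g: "g \<in> Ar C" "Dom C g = ?K" "g \<cdot> \<rho> = Zero C R (Cod C g)"
    have "Dom C t \<in> GenU" using t by (simp add: is_trace_def)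
    then obtain s p where p: "s \<in> SumU" "p \<in> Hom C s (Dom C t)" "is_epi C p" by (rule Gen_cover)
    note [simp] = p(2)[unfolded Hom_iff]
    have "t \<cdot> p \<in> Hom C s ?K" by simp
    then obtain v where v: "v \<in> Hom C s R" "\<rho> \<cdot> v = t \<cdot> p" using univ[OF Sum_Pres[OF p(1)]] by blast
    have "(g \<cdot> t) \<cdot> p = (g \<cdot> \<rho>) \<cdot> v" using v g(1,2) by simp
    also have "\<dots> = Zero C s (Cod C g)" using v g by simp
    finally have "g \<cdot> t = Zero C (Dom C t) (Cod C g)"
      by (rule epi_cancel_Zero[OF p(3,2), rotated]) (use g in simp)
    then show "\<exists>h. h \<in> Hom C ?X (Cod C g) \<and> h \<cdot> q = g"
      using is_cokernel_desc[OF q, of g] g by auto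
  qed simp
  obtain m where m: "m \<in> Hom C ?X ?Y" "m \<cdot> q = y \<cdot> k"
    using is_cokernel_desc[OF qc, of "y \<cdot> k"] by auto
  note [simp] = m(1)[unfolded Hom_iff]
  have mm: "is_mono C m" by (rule quotient_map_mono[OF k(1) k' R(2) qc y(1) m])
  have "g = Zero C U ?X" if g: "g \<in> Hom C U ?X" for g
  proof -
    note [simp] = g[unfolded Hom_iff]
    have y': "y \<in> Hom C S ?Y" and mg: "m \<cdot> g \<in> Hom C U ?Y" by simp_all
    obtain d i\<^sub>1 i\<^sub>2 p\<^sub>1 p\<^sub>2 n where bp: "is_biproduct C S U d i\<^sub>1 i\<^sub>2 p\<^sub>1 p\<^sub>2"
      and h: "sub (y \<cdot> p\<^sub>1) ((m \<cdot> g) \<cdot> p\<^sub>2) \<in> Hom C d ?Y"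
      and n: "is_kernel C (sub (y \<cdot> p\<^sub>1) ((m \<cdot> g) \<cdot> p\<^sub>2)) n"
      by (rule ex_biproduct_kernel[OF y' mg])
    note [simp] = biproduct_simps[OF bp] kernel_is_pullback(1,2)[OF bp y' mg n]
    \<comment> \<open>The pullback of \<open>y\<close> and \<open>m \<cdot> g\<close> is the kernel
      of a morphism from a sum to the presented object \<open>?Y\<close>, so it is
      presented.\<close>
    have P: "Dom C n \<in> PresU"
      by (rule abelian_exact_subcategory_kernel[OF ex h Sum_Pres[OF biproduct_Sum[OF S \<U>_Sum[OF U] bp]] y(2) n])
    have b: "is_epi C (p\<^sub>2 \<cdot> n)" by (rule pullback_epi[OF bp y' mg n is_cokernel_epi[OF y(1)]])
    have eq: "y \<cdot> (p\<^sub>1 \<cdot> n) = (m \<cdot> g) \<cdot> (p\<^sub>2 \<cdot> n)" by (rule kernel_is_pullback(3)[OF bp y' mg n])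
    \<comment> \<open>The quotient of \<open>S\<close> by \<open>?K\<close> is used to see that the
      projection of the pullback to \<open>S\<close> lands in \<open>?K\<close>: it factors through
      \<open>?Y\<close> as \<open>e'\<close>, and \<open>e'\<close> kills the subobject
      \<open>?X\<close>.\<close>
    obtain e where e: "is_cokernel C k e" "is_kernel C e k" by (rule mono_ex_cokernel[OF k(1)])
    have [simp]: "e \<in> Ar C" "Dom C e = S" and ek: "e \<cdot> k = Zero C ?K (Cod C e)"
      using is_cokernel_Hom[OF e(1)] by simp_all
    have "e \<cdot> (k \<cdot> \<rho>) = Zero C R (Cod C e)" using Comp_reduce[OF ek, of \<rho>] by simp
    then obtain e' where e': "e' \<in> Hom C ?Y (Cod C e)" "e' \<cdot> y = e"
      using is_cokernel_desc[OF y(1), of e] by auto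
    note [simp] = e'(1)[unfolded Hom_iff]
    have "(e' \<cdot> m) \<cdot> q = Zero C ?K (Cod C e)"
      using m(2) Comp_reduce[OF e'(2), of k] ek by simp
    then have e'm: "e' \<cdot> m = Zero C ?X (Cod C e)"
      by (rule epi_cancel_Zero[OF is_cokernel_epi[OF q], rotated -1]) simp_all
    have "e \<cdot> (p\<^sub>1 \<cdot> n) = e' \<cdot> (y \<cdot> (p\<^sub>1 \<cdot> n))" using Comp_reduce[OF e'(2), of "p\<^sub>1 \<cdot> n"] by simp
    also have "\<dots> = Zero C (Dom C n) (Cod C e)"
      unfolding eq using Comp_reduce[OF e'm, of "g \<cdot> (p\<^sub>2 \<cdot> n)"] by simp
    finally obtain z where z: "z \<in> Hom C (Dom C n) ?K" "k \<cdot> z = p\<^sub>1 \<cdot> n"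
      using is_kernel_lift[OF e(2), of "p\<^sub>1 \<cdot> n"] by auto
    note [simp] = z(1)[unfolded Hom_iff]
    have "m \<cdot> (q \<cdot> z) = m \<cdot> (g \<cdot> (p\<^sub>2 \<cdot> n))"
      using Comp_reduce[OF m(2), of z] z(2) eq by simp
    then have qz: "q \<cdot> z = g \<cdot> (p\<^sub>2 \<cdot> n)"
      by (rule is_monoD[OF mm, where a = "Dom C n"]) simp_all
    \<comment> \<open>A morphism from a presented object to \<open>?K\<close> factors through
      \<open>\<rho>\<close>, so \<open>q\<close> kills \<open>z\<close>; as the pullback maps onto
      \<open>U\<close>, \<open>g\<close> vanishes.\<close>
    obtain v where v: "v \<in> Hom C (Dom C n) R" "\<rho> \<cdot> v = z" using univ[OF P z(1)] by blast
    have "q \<cdot> (\<rho> \<cdot> v) = Zero C (Dom C n) ?X"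
      using Comp_reduce[OF q\<rho>, of v] v(1) by simp
    then have "g \<cdot> (p\<^sub>2 \<cdot> n) = Zero C (Dom C n) ?X" by (simp only: v(2) qz)
    then show ?thesis by (rule epi_cancel_Zero[OF b _ g, rotated]) simp
  qed
  moreover have "Zero C U ?X \<in> Hom C U ?X" using Sum_Ob[OF \<U>_Sum[OF U]] by simp
  ultimately show "Hom C U ?X = {Zero C U ?X}" by blast
qed

end

theorem theorem8p9:
  fixes \<A> :: "('o, 'm, 'z) preadditive_data_scheme"
    and \<kappa> :: "'i rel"
    and \<U> :: "'o set"
  assumes "regular_cardinal \<kappa>"
    and "abelian_category \<A>"
    and "cocomplete \<kappa> \<A>"
    and "\<U> \<subseteq> Ob \<A>"
    and "small \<kappa> \<U>"
    and "\<And>U X. U \<in> \<U> \<Longrightarrow> X \<in> Ob \<A> \<Longrightarrow> small \<kappa> (Hom \<A> U X)"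
  shows
    "((coreflective_subcategory \<A> (Pres \<kappa> \<A> \<U>) \<and> abelian_exact_subcategory \<A> (Pres \<kappa> \<A> \<U>))
       \<longleftrightarrow> (Sum_kernels_generated \<kappa> \<A> \<U> \<and> condition_a \<kappa> \<A> \<U>)) \<and>
     ((coreflective_subcategory \<A> (Pres \<kappa> \<A> \<U>) \<and> abelian_exact_subcategory \<A> (Pres \<kappa> \<A> \<U>))
       \<longleftrightarrow> (Sum_kernels_generated \<kappa> \<A> \<U> \<and> condition_b \<kappa> \<A> \<U>)) \<and>
     ((coreflective_subcategory \<A> (Pres \<kappa> \<A> \<U>) \<and> abelian_exact_subcategory \<A> (Pres \<kappa> \<A> \<U>))
       \<longleftrightarrow> (Sum_kernels_generated \<kappa> \<A> \<U> \<and> condition_c \<kappa> \<A> \<U>)) \<and>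
     ((coreflective_subcategory \<A> (Pres \<kappa> \<A> \<U>) \<and> abelian_exact_subcategory \<A> (Pres \<kappa> \<A> \<U>))
       \<longleftrightarrow> (Sum_kernels_generated \<kappa> \<A> \<U> \<and>
            condition_a \<kappa> \<A> \<U> \<and> condition_b \<kappa> \<A> \<U> \<and> condition_c \<kappa> \<A> \<U>))"
proof -
  interpret cocomplete_abelian_with_small_set \<A> \<kappa> \<U>
    using assms by (simp add: cocomplete_abelian_with_small_set_def
      cocomplete_abelian_with_small_set_axioms_def)
  \<comment> \<open>The implications close a cycle: (1) gives the kernel condition with (a), which
    passes to (b) and then (c), from which (1) returns.\<close>
  show ?thesis
    using condition_a_imp_b condition_b_imp_c abelian_exact_coreflective_Pres
      abelian_exact_imp_Sum_kernels_generated coreflective_abelian_exact_imp_condition_a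
    by blast
qed

end
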